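(* Let $K$ be a field and let $A$ be a $K$-algebra with enough idempotents. Then the category $\mathcal{M}^{A^0}$ of right $A^0$-comodules is isomorphic to the category $LocFin_A\mathcal{M}$ of locally finite unital left $A$-modules.
   Context: A $K$-algebra $A$ (associative, not necessarily with unit) has enough idempotents if there is a system $(e_\alpha)_{\alpha\in R}$ of pairwise orthogonal idempotents of $A$ with $A=\bigoplus_{\alpha\in R}Ae_\alpha=\bigoplus_{\alpha\in R}e_\alpha A$. The finite dual $A^0=\{f\in A^*\mid \mathrm{Ker}(f)$ contains a two-sided ideal of $A$ of finite codimension$\}$ is a coalgebra with comultiplication given by $\Delta(f)=\sum_i u_i\otimes v_i$ (with $u_i,v_i\in A^0$) if and only if $f(xy)=\sum_i u_i(x)v_i(y)$ for all $x,y\in A$, and counit $\varepsilon(f)=\sum_{\alpha\in R}f(e_\alpha)$ (only finitely many terms are nonzero). A left $A$-module $M$ is unital if $AM=M$, and locally finite if the submodule generated by any element is finite dimensional over $K$. $LocFin_A\mathcal{M}$ is the full subcategory of the category of left $A$-modules consisting of all locally finite unital modules. *)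

theory Defs
  imports "Jordan_Normal_Form.Missing_VectorSpace" "HOL-Algebra.AbelCoset"
begin

section \<open>Categories and isomorphism of categories\<close>

text \<open>
  Morphisms do not carry their endpoints, so composition takes the three objects as arguments:
  \<open>Comp C X Y Z g f\<close> is the composite of \<open>f : X \<rightarrow> Y\<close> followed by \<open>g : Y \<rightarrow> Z\<close>.
\<close>

record ('o, 'f) category =
  Obj :: "'o set"
  Hom :: "'o \<Rightarrow> 'o \<Rightarrow> 'f set"
  Ident :: "'o \<Rightarrow> 'f"
  Comp :: "'o \<Rightarrow> 'o \<Rightarrow> 'o \<Rightarrow> 'f \<Rightarrow> 'f \<Rightarrow> 'f"

locale category =
  fixes C :: "('o, 'f) category"
  assumes Ident_Hom: "X \<in> Obj C \<Longrightarrow> Ident C X \<in> Hom C X X"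
    and Comp_Hom:
      "\<lbrakk>X \<in> Obj C; Y \<in> Obj C; Z \<in> Obj C; f \<in> Hom C X Y; g \<in> Hom C Y Z\<rbrakk>
        \<Longrightarrow> Comp C X Y Z g f \<in> Hom C X Z"
    and Comp_Ident:
      "\<lbrakk>X \<in> Obj C; Y \<in> Obj C; f \<in> Hom C X Y\<rbrakk> \<Longrightarrow> Comp C X X Y f (Ident C X) = f"
    and Ident_Comp:
      "\<lbrakk>X \<in> Obj C; Y \<in> Obj C; f \<in> Hom C X Y\<rbrakk> \<Longrightarrow> Comp C X Y Y (Ident C Y) f = f"
    and Comp_assoc:
      "\<lbrakk>W \<in> Obj C; X \<in> Obj C; Y \<in> Obj C; Z \<in> Obj C;
        f \<in> Hom C W X; g \<in> Hom C X Y; h \<in> Hom C Y Z\<rbrakk>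
        \<Longrightarrow> Comp C W X Z (Comp C X Y Z h g) f = Comp C W Y Z h (Comp C W X Y g f)"

locale category_functor = C: category C + D: category D
  for C :: "('o, 'f) category" and D :: "('p, 'g) category" +
  fixes Fo :: "'o \<Rightarrow> 'p" and Fm :: "'o \<Rightarrow> 'o \<Rightarrow> 'f \<Rightarrow> 'g"
  assumes F_Obj: "X \<in> Obj C \<Longrightarrow> Fo X \<in> Obj D"
    and F_Hom:
      "\<lbrakk>X \<in> Obj C; Y \<in> Obj C; f \<in> Hom C X Y\<rbrakk> \<Longrightarrow> Fm X Y f \<in> Hom D (Fo X) (Fo Y)"
    and F_Ident: "X \<in> Obj C \<Longrightarrow> Fm X X (Ident C X) = Ident D (Fo X)"
    and F_Comp:
      "\<lbrakk>X \<in> Obj C; Y \<in> Obj C; Z \<in> Obj C; f \<in> Hom C X Y; g \<in> Hom C Y Z\<rbrakk>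
        \<Longrightarrow> Fm X Z (Comp C X Y Z g f) = Comp D (Fo X) (Fo Y) (Fo Z) (Fm Y Z g) (Fm X Y f)"

text \<open>Isomorphism in the strict sense: two functors that are mutually inverse on objects and on morphisms.\<close>

definition isomorphic_categories :: "('o, 'f) category \<Rightarrow> ('p, 'g) category \<Rightarrow> bool" where
  "isomorphic_categories C D \<longleftrightarrow>
    (\<exists>Fo Fm Go Gm. category_functor C D Fo Fm \<and> category_functor D C Go Gm \<and>
      (\<forall>X\<in>Obj C. Go (Fo X) = X) \<and>
      (\<forall>Y\<in>Obj D. Fo (Go Y) = Y) \<and>
      (\<forall>X\<in>Obj C. \<forall>X'\<in>Obj C. \<forall>f\<in>Hom C X X'. Gm (Fo X) (Fo X') (Fm X X' f) = f) \<and>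
      (\<forall>Y\<in>Obj D. \<forall>Y'\<in>Obj D. \<forall>g\<in>Hom D Y Y'. Fm (Go Y) (Go Y') (Gm Y Y' g) = g))"

definition full_subcategory :: "('o, 'f) category \<Rightarrow> ('o \<Rightarrow> bool) \<Rightarrow> ('o, 'f) category" where
  "full_subcategory C P = C\<lparr>Obj := {X \<in> Obj C. P X}\<rparr>"


section \<open>Vector spaces\<close>

text \<open>
  A record of type \<open>module\<close> also has the ring components \<open>mult\<close> and \<open>one\<close>, which play no role for a
  vector space, and its operations have values outside the carrier. An object of a category is
  compared with another one by equality, so these irrelevant values are fixed by the next predicate;
  it puts no condition on the vector space itself.
\<close>

definition normalized :: "('k, 'n) ring_scheme \<Rightarrow> ('k, 'v, 'm) module_scheme \<Rightarrow> bool" where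
  "normalized K V \<longleftrightarrow>
    mult V = undefined \<and> one V = undefined \<and>
    (\<forall>x y. \<not> (x \<in> carrier V \<and> y \<in> carrier V) \<longrightarrow> x \<oplus>\<^bsub>V\<^esub> y = undefined) \<and>
    (\<forall>c x. \<not> (c \<in> carrier K \<and> x \<in> carrier V) \<longrightarrow> c \<odot>\<^bsub>V\<^esub> x = undefined)"

definition base_space :: "('k, 'n) ring_scheme \<Rightarrow> ('k, 'k) module" where
  "base_space K = \<lparr>carrier = carrier K, mult = mult K, one = one K,
     zero = zero K, add = add K, smult = mult K\<rparr>"

definition quotient_space :: "('k, 'v, 'm) module_scheme \<Rightarrow> 'v set \<Rightarrow> ('k, 'v set) module" where
  "quotient_space V W = \<lparr>carrier = a_rcosets\<^bsub>V\<^esub> W, mult = undefined, one = undefined,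
     zero = W, add = set_add V, smult = (\<lambda>c S. \<Union>s\<in>S. W +>\<^bsub>V\<^esub> (c \<odot>\<^bsub>V\<^esub> s))\<rparr>"

definition internal_direct_sum ::
  "('k, 'v, 'm) module_scheme \<Rightarrow> 'r set \<Rightarrow> ('r \<Rightarrow> 'v set) \<Rightarrow> bool" where
  "internal_direct_sum V R S \<longleftrightarrow>
    (\<forall>\<alpha>\<in>R. S \<alpha> \<subseteq> carrier V) \<and>
    (\<forall>v\<in>carrier V. \<exists>!x. x \<in> (\<Pi>\<^sub>E \<alpha>\<in>R. S \<alpha>) \<and> finite {\<alpha>\<in>R. x \<alpha> \<noteq> \<zero>\<^bsub>V\<^esub>} \<and>
       v = (\<Oplus>\<^bsub>V\<^esub>\<alpha>\<in>{\<alpha>\<in>R. x \<alpha> \<noteq> \<zero>\<^bsub>V\<^esub>}. x \<alpha>))"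


section \<open>Tensor products\<close>

text \<open>
  The tensor product of \<open>V\<close> and \<open>W\<close> is the free vector space on \<open>carrier V \<times> carrier W\<close> modulo the
  subspace spanned by the bilinearity relations.
\<close>

definition free_space :: "('k, 'n) ring_scheme \<Rightarrow> 's set \<Rightarrow> ('k, 's \<Rightarrow> 'k) module" where
  "free_space K S = (ring.func_space K S)
     \<lparr>carrier := {\<phi> \<in> S \<rightarrow>\<^sub>E carrier K. finite {s \<in> S. \<phi> s \<noteq> \<zero>\<^bsub>K\<^esub>}}\<rparr>"

definition free_gen :: "('k, 'n) ring_scheme \<Rightarrow> 's set \<Rightarrow> 's \<Rightarrow> 's \<Rightarrow> 'k" where
  "free_gen K S s = (\<lambda>t\<in>S. if t = s then \<one>\<^bsub>K\<^esub> else \<zero>\<^bsub>K\<^esub>)"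

definition tensor_relations ::
  "('k, 'n) ring_scheme \<Rightarrow> ('k, 'v, 'm1) module_scheme \<Rightarrow> ('k, 'w, 'm2) module_scheme
    \<Rightarrow> ('v \<times> 'w \<Rightarrow> 'k) set" where
  "tensor_relations K V W =
    (let F = free_space K (carrier V \<times> carrier W); g = free_gen K (carrier V \<times> carrier W) in
      module.span K F
       ({g (v \<oplus>\<^bsub>V\<^esub> v', w) \<ominus>\<^bsub>F\<^esub> (g (v, w) \<oplus>\<^bsub>F\<^esub> g (v', w)) | v v' w.
            v \<in> carrier V \<and> v' \<in> carrier V \<and> w \<in> carrier W} \<union>
        {g (v, w \<oplus>\<^bsub>W\<^esub> w') \<ominus>\<^bsub>F\<^esub> (g (v, w) \<oplus>\<^bsub>F\<^esub> g (v, w')) | v w w'.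
            v \<in> carrier V \<and> w \<in> carrier W \<and> w' \<in> carrier W} \<union>
        {g (c \<odot>\<^bsub>V\<^esub> v, w) \<ominus>\<^bsub>F\<^esub> c \<odot>\<^bsub>F\<^esub> g (v, w) | c v w.
            c \<in> carrier K \<and> v \<in> carrier V \<and> w \<in> carrier W} \<union>
        {g (v, c \<odot>\<^bsub>W\<^esub> w) \<ominus>\<^bsub>F\<^esub> c \<odot>\<^bsub>F\<^esub> g (v, w) | c v w.
            c \<in> carrier K \<and> v \<in> carrier V \<and> w \<in> carrier W}))"

definition tensor_space ::
  "('k, 'n) ring_scheme \<Rightarrow> ('k, 'v, 'm1) module_scheme \<Rightarrow> ('k, 'w, 'm2) module_scheme
    \<Rightarrow> ('k, ('v \<times> 'w \<Rightarrow> 'k) set) module" where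
  "tensor_space K V W =
     quotient_space (free_space K (carrier V \<times> carrier W)) (tensor_relations K V W)"

definition tensor ::
  "('k, 'n) ring_scheme \<Rightarrow> ('k, 'v, 'm1) module_scheme \<Rightarrow> ('k, 'w, 'm2) module_scheme
    \<Rightarrow> 'v \<Rightarrow> 'w \<Rightarrow> ('v \<times> 'w \<Rightarrow> 'k) set" where
  "tensor K V W v w =
     tensor_relations K V W +>\<^bsub>free_space K (carrier V \<times> carrier W)\<^esub>
       free_gen K (carrier V \<times> carrier W) (v, w)"

text \<open>
  The linear map from the tensor product of \<open>V\<close> and \<open>W\<close> to \<open>U\<close> induced by a bilinear map \<open>b\<close>: it
  sends \<open>\<Sum>\<^sub>i v\<^sub>i \<otimes> w\<^sub>i\<close> to \<open>\<Sum>\<^sub>i b v\<^sub>i w\<^sub>i\<close>, and only bilinearity of \<open>b\<close> makes the value independent of the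
  presentation.
\<close>

definition tensor_lift ::
  "('k, 'n) ring_scheme \<Rightarrow> ('k, 'v, 'm1) module_scheme \<Rightarrow> ('k, 'w, 'm2) module_scheme
    \<Rightarrow> ('k, 'u, 'm3) module_scheme \<Rightarrow> ('v \<Rightarrow> 'w \<Rightarrow> 'u) \<Rightarrow> ('v \<times> 'w \<Rightarrow> 'k) set \<Rightarrow> 'u" where
  "tensor_lift K V W U b t =
    (THE u. \<exists>(n::nat) v w. v \<in> {..<n} \<rightarrow> carrier V \<and> w \<in> {..<n} \<rightarrow> carrier W \<and>
       t = (\<Oplus>\<^bsub>tensor_space K V W\<^esub>i\<in>{..<n}. tensor K V W (v i) (w i)) \<and>
       u = (\<Oplus>\<^bsub>U\<^esub>i\<in>{..<n}. b (v i) (w i)))"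

definition tensor_map ::
  "('k, 'n) ring_scheme \<Rightarrow> ('k, 'v, 'm1) module_scheme \<Rightarrow> ('k, 'w, 'm2) module_scheme
    \<Rightarrow> ('k, 'v', 'm3) module_scheme \<Rightarrow> ('k, 'w', 'm4) module_scheme
    \<Rightarrow> ('v \<Rightarrow> 'v') \<Rightarrow> ('w \<Rightarrow> 'w') \<Rightarrow> ('v \<times> 'w \<Rightarrow> 'k) set \<Rightarrow> ('v' \<times> 'w' \<Rightarrow> 'k) set" where
  "tensor_map K V W V' W' f g =
     tensor_lift K V W (tensor_space K V' W') (\<lambda>v w. tensor K V' W' (f v) (g w))"

text \<open>The associativity isomorphism \<open>(u \<otimes> v) \<otimes> w \<mapsto> u \<otimes> (v \<otimes> w)\<close>.\<close>

definition tensor_assoc ::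
  "('k, 'n) ring_scheme \<Rightarrow> ('k, 'u, 'm1) module_scheme \<Rightarrow> ('k, 'v, 'm2) module_scheme
    \<Rightarrow> ('k, 'w, 'm3) module_scheme
    \<Rightarrow> (('u \<times> 'v \<Rightarrow> 'k) set \<times> 'w \<Rightarrow> 'k) set \<Rightarrow> ('u \<times> ('v \<times> 'w \<Rightarrow> 'k) set \<Rightarrow> 'k) set" where
  "tensor_assoc K U V W =
    (let T = tensor_space K U (tensor_space K V W) in
      tensor_lift K (tensor_space K U V) W T
        (\<lambda>t w. tensor_lift K U V T
           (\<lambda>u v. tensor K U (tensor_space K V W) u (tensor K V W v w)) t))"


section \<open>Coalgebras and right comodules\<close>

record ('k, 'c) coalgebra = "('k, 'c) module" +
  comult :: "'c \<Rightarrow> ('c \<times> 'c \<Rightarrow> 'k) set"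
  counit :: "'c \<Rightarrow> 'k"

locale coalgebra = C: vectorspace K C
  for K :: "('k, 'n) ring_scheme" and C :: "('k, 'c, 'd) coalgebra_scheme" +
  assumes comult_linear: "comult C \<in> module_hom K C (tensor_space K C C)"
    and counit_linear: "counit C \<in> module_hom K C (base_space K)"
    and coassoc:
      "c \<in> carrier C \<Longrightarrow>
        tensor_assoc K C C C
          (tensor_map K C C (tensor_space K C C) C (comult C) id (comult C c)) =
        tensor_map K C C C (tensor_space K C C) id (comult C) (comult C c)"
    and counit_left:
      "c \<in> carrier C \<Longrightarrow> tensor_lift K C C C (\<lambda>x y. counit C x \<odot>\<^bsub>C\<^esub> y) (comult C c) = c"
    and counit_right:
      "c \<in> carrier C \<Longrightarrow> tensor_lift K C C C (\<lambda>x y. counit C y \<odot>\<^bsub>C\<^esub> x) (comult C c) = c"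

record ('k, 'c, 'v) comodule = "('k, 'v) module" +
  coact :: "'v \<Rightarrow> ('v \<times> 'c \<Rightarrow> 'k) set"

locale right_comodule = C: coalgebra K C + M: vectorspace K M
  for K :: "('k, 'n) ring_scheme" and C :: "('k, 'c, 'd) coalgebra_scheme"
    and M :: "('k, 'c, 'v) comodule" +
  assumes coact_linear: "coact M \<in> module_hom K M (tensor_space K M C)"
    and coact_coassoc:
      "m \<in> carrier M \<Longrightarrow>
        tensor_assoc K M C C
          (tensor_map K M C (tensor_space K M C) C (coact M) id (coact M m)) =
        tensor_map K M C M (tensor_space K C C) id (comult C) (coact M m)"
    and coact_counit:
      "m \<in> carrier M \<Longrightarrow> tensor_lift K M C M (\<lambda>x c. counit C c \<odot>\<^bsub>M\<^esub> x) (coact M m) = m"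

definition comodule_hom ::
  "('k, 'n) ring_scheme \<Rightarrow> ('k, 'c, 'd) coalgebra_scheme
    \<Rightarrow> ('k, 'c, 'v) comodule \<Rightarrow> ('k, 'c, 'v) comodule \<Rightarrow> ('v \<Rightarrow> 'v) set" where
  "comodule_hom K C M N =
    {f \<in> module_hom K M N \<inter> extensional (carrier M).
       \<forall>m\<in>carrier M. coact N (f m) = tensor_map K M C N C f id (coact M m)}"

definition comodule_category ::
  "('k, 'n) ring_scheme \<Rightarrow> ('k, 'c, 'd) coalgebra_scheme
    \<Rightarrow> (('k, 'c, 'v) comodule, 'v \<Rightarrow> 'v) category" where
  "comodule_category K C =
    \<lparr>Obj = {M. right_comodule K C M \<and> normalized K M \<and> coact M \<in> extensional (carrier M)},
     Hom = comodule_hom K C,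
     Ident = (\<lambda>M. \<lambda>m\<in>carrier M. m),
     Comp = (\<lambda>L M N g f. compose (carrier L) g f)\<rparr>"


section \<open>Algebras with enough idempotents\<close>

text \<open>The component \<open>one\<close> of the record plays no role: algebras need not have a unit.\<close>

locale assoc_algebra = A: vectorspace K A
  for K :: "('k, 'n) ring_scheme" and A :: "('k, 'a, 'b) module_scheme" +
  assumes mult_closed: "\<lbrakk>x \<in> carrier A; y \<in> carrier A\<rbrakk> \<Longrightarrow> x \<otimes>\<^bsub>A\<^esub> y \<in> carrier A"
    and mult_assoc:
      "\<lbrakk>x \<in> carrier A; y \<in> carrier A; z \<in> carrier A\<rbrakk>
        \<Longrightarrow> (x \<otimes>\<^bsub>A\<^esub> y) \<otimes>\<^bsub>A\<^esub> z = x \<otimes>\<^bsub>A\<^esub> (y \<otimes>\<^bsub>A\<^esub> z)"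
    and mult_l_distr:
      "\<lbrakk>x \<in> carrier A; y \<in> carrier A; z \<in> carrier A\<rbrakk>
        \<Longrightarrow> (x \<oplus>\<^bsub>A\<^esub> y) \<otimes>\<^bsub>A\<^esub> z = x \<otimes>\<^bsub>A\<^esub> z \<oplus>\<^bsub>A\<^esub> y \<otimes>\<^bsub>A\<^esub> z"
    and mult_r_distr:
      "\<lbrakk>x \<in> carrier A; y \<in> carrier A; z \<in> carrier A\<rbrakk>
        \<Longrightarrow> x \<otimes>\<^bsub>A\<^esub> (y \<oplus>\<^bsub>A\<^esub> z) = x \<otimes>\<^bsub>A\<^esub> y \<oplus>\<^bsub>A\<^esub> x \<otimes>\<^bsub>A\<^esub> z"
    and smult_mult_l:
      "\<lbrakk>c \<in> carrier K; x \<in> carrier A; y \<in> carrier A\<rbrakk>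
        \<Longrightarrow> (c \<odot>\<^bsub>A\<^esub> x) \<otimes>\<^bsub>A\<^esub> y = c \<odot>\<^bsub>A\<^esub> (x \<otimes>\<^bsub>A\<^esub> y)"
    and smult_mult_r:
      "\<lbrakk>c \<in> carrier K; x \<in> carrier A; y \<in> carrier A\<rbrakk>
        \<Longrightarrow> x \<otimes>\<^bsub>A\<^esub> (c \<odot>\<^bsub>A\<^esub> y) = c \<odot>\<^bsub>A\<^esub> (x \<otimes>\<^bsub>A\<^esub> y)"

locale enough_idempotents = assoc_algebra K A
  for K :: "('k, 'n) ring_scheme" and A :: "('k, 'a, 'b) module_scheme" +
  fixes R :: "'r set" and e :: "'r \<Rightarrow> 'a"
  assumes e_closed: "\<alpha> \<in> R \<Longrightarrow> e \<alpha> \<in> carrier A"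
    and e_idem: "\<alpha> \<in> R \<Longrightarrow> e \<alpha> \<otimes>\<^bsub>A\<^esub> e \<alpha> = e \<alpha>"
    and e_orth: "\<lbrakk>\<alpha> \<in> R; \<beta> \<in> R; \<alpha> \<noteq> \<beta>\<rbrakk> \<Longrightarrow> e \<alpha> \<otimes>\<^bsub>A\<^esub> e \<beta> = \<zero>\<^bsub>A\<^esub>"
    and left_decomposition: "internal_direct_sum A R (\<lambda>\<alpha>. {a \<otimes>\<^bsub>A\<^esub> e \<alpha> | a. a \<in> carrier A})"
    and right_decomposition: "internal_direct_sum A R (\<lambda>\<alpha>. {e \<alpha> \<otimes>\<^bsub>A\<^esub> a | a. a \<in> carrier A})"


section \<open>The finite dual\<close>

text \<open>Functionals on \<open>A\<close> are normalized to be \<open>undefined\<close> outside the carrier of \<open>A\<close>.\<close>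

definition dual_space ::
  "('k, 'n) ring_scheme \<Rightarrow> ('k, 'a, 'b) module_scheme \<Rightarrow> ('k, 'a \<Rightarrow> 'k) module" where
  "dual_space K A = (ring.func_space K (carrier A))
     \<lparr>carrier := module_hom K A (base_space K) \<inter> extensional (carrier A)\<rparr>"

definition two_sided_ideal ::
  "('k, 'n) ring_scheme \<Rightarrow> ('k, 'a, 'b) module_scheme \<Rightarrow> 'a set \<Rightarrow> bool" where
  "two_sided_ideal K A I \<longleftrightarrow> subspace K I A \<and>
     (\<forall>a\<in>carrier A. \<forall>x\<in>I. a \<otimes>\<^bsub>A\<^esub> x \<in> I \<and> x \<otimes>\<^bsub>A\<^esub> a \<in> I)"

definition finite_dual_space ::
  "('k, 'n) ring_scheme \<Rightarrow> ('k, 'a, 'b) module_scheme \<Rightarrow> ('k, 'a \<Rightarrow> 'k) module" where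
  "finite_dual_space K A = (dual_space K A)
     \<lparr>carrier := {f \<in> carrier (dual_space K A).
        \<exists>I. two_sided_ideal K A I \<and> vectorspace.fin_dim K (quotient_space A I) \<and>
            I \<subseteq> {x \<in> carrier A. f x = \<zero>\<^bsub>K\<^esub>}}\<rparr>"

definition finite_dual_comult ::
  "('k, 'n) ring_scheme \<Rightarrow> ('k, 'a, 'b) module_scheme
    \<Rightarrow> ('a \<Rightarrow> 'k) \<Rightarrow> (('a \<Rightarrow> 'k) \<times> ('a \<Rightarrow> 'k) \<Rightarrow> 'k) set" where
  "finite_dual_comult K A f =
    (let D = finite_dual_space K A in
      THE t. \<exists>(n::nat) u v. u \<in> {..<n} \<rightarrow> carrier D \<and> v \<in> {..<n} \<rightarrow> carrier D \<and>
        t = (\<Oplus>\<^bsub>tensor_space K D D\<^esub>i\<in>{..<n}. tensor K D D (u i) (v i)) \<and>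
        (\<forall>x\<in>carrier A. \<forall>y\<in>carrier A. f (x \<otimes>\<^bsub>A\<^esub> y) = (\<Oplus>\<^bsub>K\<^esub>i\<in>{..<n}. u i x \<otimes>\<^bsub>K\<^esub> v i y)))"

text \<open>
  \<open>finsum\<close> over an infinite index set is a dummy value, so the sum defining the counit is
  restricted to the (finite) set of indices with nonzero summand.
\<close>

definition finite_dual ::
  "('k, 'n) ring_scheme \<Rightarrow> ('k, 'a, 'b) module_scheme \<Rightarrow> 'r set \<Rightarrow> ('r \<Rightarrow> 'a)
    \<Rightarrow> ('k, 'a \<Rightarrow> 'k) coalgebra" where
  "finite_dual K A R e =
    (let D = finite_dual_space K A in
      \<lparr>carrier = carrier D, mult = mult D, one = one D, zero = zero D, add = add D,
       smult = smult D,
       comult = finite_dual_comult K A,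
       counit = (\<lambda>f. \<Oplus>\<^bsub>K\<^esub>\<alpha>\<in>{\<alpha>\<in>R. f (e \<alpha>) \<noteq> \<zero>\<^bsub>K\<^esub>}. f (e \<alpha>))\<rparr>)"


section \<open>Locally finite unital left modules\<close>

record ('k, 'a, 'v) lmodule = "('k, 'v) module" +
  act :: "'a \<Rightarrow> 'v \<Rightarrow> 'v"

locale left_module = A: assoc_algebra K A + M: vectorspace K M
  for K :: "('k, 'n) ring_scheme" and A :: "('k, 'a, 'b) module_scheme"
    and M :: "('k, 'a, 'v) lmodule" +
  assumes act_closed: "\<lbrakk>a \<in> carrier A; m \<in> carrier M\<rbrakk> \<Longrightarrow> act M a m \<in> carrier M"
    and act_add_l:
      "\<lbrakk>a \<in> carrier A; b \<in> carrier A; m \<in> carrier M\<rbrakk>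
        \<Longrightarrow> act M (a \<oplus>\<^bsub>A\<^esub> b) m = act M a m \<oplus>\<^bsub>M\<^esub> act M b m"
    and act_add_r:
      "\<lbrakk>a \<in> carrier A; m \<in> carrier M; m' \<in> carrier M\<rbrakk>
        \<Longrightarrow> act M a (m \<oplus>\<^bsub>M\<^esub> m') = act M a m \<oplus>\<^bsub>M\<^esub> act M a m'"
    and act_smult_l:
      "\<lbrakk>c \<in> carrier K; a \<in> carrier A; m \<in> carrier M\<rbrakk>
        \<Longrightarrow> act M (c \<odot>\<^bsub>A\<^esub> a) m = c \<odot>\<^bsub>M\<^esub> act M a m"
    and act_smult_r:
      "\<lbrakk>c \<in> carrier K; a \<in> carrier A; m \<in> carrier M\<rbrakk>
        \<Longrightarrow> act M a (c \<odot>\<^bsub>M\<^esub> m) = c \<odot>\<^bsub>M\<^esub> act M a m"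
    and act_mult:
      "\<lbrakk>a \<in> carrier A; b \<in> carrier A; m \<in> carrier M\<rbrakk>
        \<Longrightarrow> act M (a \<otimes>\<^bsub>A\<^esub> b) m = act M a (act M b m)"

definition lmodule_hom ::
  "('k, 'n) ring_scheme \<Rightarrow> ('k, 'a, 'b) module_scheme
    \<Rightarrow> ('k, 'a, 'v) lmodule \<Rightarrow> ('k, 'a, 'v) lmodule \<Rightarrow> ('v \<Rightarrow> 'v) set" where
  "lmodule_hom K A M N =
    {f \<in> module_hom K M N \<inter> extensional (carrier M).
       \<forall>a\<in>carrier A. \<forall>m\<in>carrier M. f (act M a m) = act N a (f m)}"

definition lmodule_category ::
  "('k, 'n) ring_scheme \<Rightarrow> ('k, 'a, 'b) module_scheme
    \<Rightarrow> (('k, 'a, 'v) lmodule, 'v \<Rightarrow> 'v) category" where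
  "lmodule_category K A =
    \<lparr>Obj = {M. left_module K A M \<and> normalized K M \<and>
              (\<forall>a m. \<not> (a \<in> carrier A \<and> m \<in> carrier M) \<longrightarrow> act M a m = undefined)},
     Hom = lmodule_hom K A,
     Ident = (\<lambda>M. \<lambda>m\<in>carrier M. m),
     Comp = (\<lambda>L M N g f. compose (carrier L) g f)\<rparr>"

definition unital_module ::
  "('k, 'n) ring_scheme \<Rightarrow> ('k, 'a, 'b) module_scheme \<Rightarrow> ('k, 'a, 'v) lmodule \<Rightarrow> bool" where
  "unital_module K A M \<longleftrightarrow>
     module.span K M {act M a m | a m. a \<in> carrier A \<and> m \<in> carrier M} = carrier M"

definition act_submodule ::
  "('k, 'n) ring_scheme \<Rightarrow> ('k, 'a, 'b) module_scheme \<Rightarrow> ('k, 'a, 'v) lmodule \<Rightarrow> 'v set \<Rightarrow> bool" where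
  "act_submodule K A M N \<longleftrightarrow> subspace K N M \<and> (\<forall>a\<in>carrier A. \<forall>m\<in>N. act M a m \<in> N)"

definition generated_submodule ::
  "('k, 'n) ring_scheme \<Rightarrow> ('k, 'a, 'b) module_scheme \<Rightarrow> ('k, 'a, 'v) lmodule \<Rightarrow> 'v \<Rightarrow> 'v set" where
  "generated_submodule K A M m = \<Inter>{N. act_submodule K A M N \<and> m \<in> N}"

definition locally_finite ::
  "('k, 'n) ring_scheme \<Rightarrow> ('k, 'a, 'b) module_scheme \<Rightarrow> ('k, 'a, 'v) lmodule \<Rightarrow> bool" where
  "locally_finite K A M \<longleftrightarrow>
     (\<forall>m\<in>carrier M. vectorspace.fin_dim K (M\<lparr>carrier := generated_submodule K A M m\<rparr>))"

definition LocFin_category ::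
  "('k, 'n) ring_scheme \<Rightarrow> ('k, 'a, 'b) module_scheme
    \<Rightarrow> (('k, 'a, 'v) lmodule, 'v \<Rightarrow> 'v) category" where
  "LocFin_category K A =
     full_subcategory (lmodule_category K A) (\<lambda>M. locally_finite K A M \<and> unital_module K A M)"

end

theory Submission
  imports Defs
begin

text \<open>
  For \<open>a \<in> A\<close> let \<open>ev\<^sub>a : M \<otimes> A\<^sup>0 \<rightarrow> M\<close> be \<open>m \<otimes> f \<mapsto> f(a) m\<close>. These maps jointly separate the points of
  \<open>M \<otimes> A\<^sup>0\<close>, and likewise the maps \<open>m \<otimes> f \<otimes> g \<mapsto> f(a) g(b) m\<close> separate those of \<open>M \<otimes> (A\<^sup>0 \<otimes> A\<^sup>0)\<close>, so
  a coaction \<open>\<rho>\<close> is determined by the action \<open>a m = ev\<^sub>a (\<rho> m)\<close>. Coassociativity becomes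
  \<open>(a b) m = a (b m)\<close>. Applying the counit to \<open>\<rho> m\<close> amounts to acting by \<open>\<Sum>\<^sub>\<alpha>\<^sub>\<in>\<^sub>F e\<^sub>\<alpha>\<close> for every sufficiently
  large finite \<open>F \<subseteq> R\<close>, so the counit axiom says that the module is unital. Finitely many tensors occur
  in \<open>\<rho> m\<close>, so \<open>A m\<close> is finite dimensional; conversely, the coefficients of the action on a finite
  dimensional submodule vanish on its annihilator and hence lie in \<open>A\<^sup>0\<close>. The coalgebra axioms for \<open>A\<^sup>0\<close>
  are the same facts for the module \<open>A\<^sup>0\<close> with \<open>(a f)(x) = f(x a)\<close>, whose coaction is the
  comultiplication.
\<close>

section \<open>Linear algebra\<close>

text \<open>Elements of a tensor product are cosets, and \<open>tensor_lift\<close> and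
  \<open>finite_dual_comult\<close> are definite descriptions, so nothing can be computed with them
  until the universal property is established. After that, equality of linear maps is tested on pure
  tensors (\<open>hom_eqI\<close>) and equality of tensors under all evaluations
  (\<open>ev_eqI\<close>). The second test makes the comultiplication and the reconstructed
  coactions well defined and linear, makes the functors inverse on the nose, and identifies the two
  kinds of morphisms as the same functions. In the absence of a unit, m need not lie in A m. The
  sums \<open>e_sum F\<close> act as local units: A = \<Oplus> A e_\<alpha> gives a e_F = a, used
  for the right counit axiom and for the finite support of elements of A^0, and A = \<Oplus>
  e_\<alpha> A gives e_F a = a, used for the left counit axiom and for unital modules. Finite
  dimension and finite codimension are both handled by finite sets of functionals, which restrict to
  subspaces, compose with linear maps and can be united.\<close>

lemma module_homI:
  assumes "\<And>v. v \<in> carrier V \<Longrightarrow> f v \<in> carrier W"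
    and "\<And>u v. \<lbrakk>u \<in> carrier V; v \<in> carrier V\<rbrakk> \<Longrightarrow> f (u \<oplus>\<^bsub>V\<^esub> v) = f u \<oplus>\<^bsub>W\<^esub> f v"
    and "\<And>c v. \<lbrakk>c \<in> carrier K; v \<in> carrier V\<rbrakk> \<Longrightarrow> f (c \<odot>\<^bsub>V\<^esub> v) = c \<odot>\<^bsub>W\<^esub> f v"
  shows "f \<in> module_hom K V W"
  using assms by (auto simp: module_hom_def)

lemma module_hom_mem: "\<lbrakk>f \<in> module_hom K V W; v \<in> carrier V\<rbrakk> \<Longrightarrow> f v \<in> carrier W"
  by (auto simp: module_hom_def)

lemma module_hom_comp:
  assumes "f \<in> module_hom K U V" "g \<in> module_hom K V W"
  shows "(\<lambda>x. g (f x)) \<in> module_hom K U W"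
  using assms by (auto simp: module_hom_def Pi_iff)

text \<open>The vector space axioms for V enter because g must agree with f also at sums and scalar
  multiples, which therefore have to stay in the carrier.\<close>

lemma module_hom_cong:
  assumes "f \<in> module_hom K V W" "vectorspace K V" "\<And>v. v \<in> carrier V \<Longrightarrow> g v = f v"
  shows "g \<in> module_hom K V W"
proof -
  interpret V: vectorspace K V by fact
  show ?thesis using assms(1,3) by (auto simp: module_hom_def Pi_iff)
qed

lemma vectorspace_field: "vectorspace K V \<Longrightarrow> field K"
  by (simp add: vectorspace_def)

lemma module_hom_zero:
  assumes "vectorspace K V" "vectorspace K W" "f \<in> module_hom K V W"
  shows "f \<zero>\<^bsub>V\<^esub> = \<zero>\<^bsub>W\<^esub>"
proof -
  interpret linear_map K V W f
    using assms by (auto simp: linear_map_def mod_hom_def mod_hom_axioms_def vectorspace_def)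
  show ?thesis by simp
qed

lemma module_hom_minus:
  assumes "vectorspace K V" "vectorspace K W" "f \<in> module_hom K V W"
    and "u \<in> carrier V" "v \<in> carrier V"
  shows "f (u \<ominus>\<^bsub>V\<^esub> v) = f u \<ominus>\<^bsub>W\<^esub> f v"
proof -
  interpret linear_map K V W f
    using assms by (auto simp: linear_map_def mod_hom_def mod_hom_axioms_def vectorspace_def)
  show ?thesis using assms by simp
qed

lemma module_hom_finsum:
  assumes "vectorspace K V" "vectorspace K W" "f \<in> module_hom K V W" "g \<in> I \<rightarrow> carrier V"
  shows "f (\<Oplus>\<^bsub>V\<^esub>i\<in>I. g i) = (\<Oplus>\<^bsub>W\<^esub>i\<in>I. f (g i))"
proof -
  interpret V: vectorspace K V by fact
  interpret W: vectorspace K W by fact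
  show ?thesis using assms(4)
  proof (induction I rule: infinite_finite_induct)
    case (infinite I)
    then show ?case
      using module_hom_zero[OF assms(1-3)] by (simp add: V.M.finsum_infinite W.M.finsum_infinite)
  next
    case empty
    then show ?case using module_hom_zero[OF assms(1-3)] by simp
  next
    case (insert i I)
    then have "f (g i \<oplus>\<^bsub>V\<^esub> (\<Oplus>\<^bsub>V\<^esub>i\<in>I. g i)) = f (g i) \<oplus>\<^bsub>W\<^esub> f (\<Oplus>\<^bsub>V\<^esub>i\<in>I. g i)"
      by (intro module_hom_add[OF assms(3)] V.M.finsum_closed) auto
    moreover have "(\<lambda>i. f (g i)) \<in> insert i I \<rightarrow> carrier W"
      using insert.prems module_hom_mem[OF assms(3)] by auto
    ultimately show ?case
      using insert by (simp add: V.M.finsum_insert W.M.finsum_insert Pi_iff)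
  qed
qed

lemma module_hom_plus:
  assumes "vectorspace K W" "f \<in> module_hom K V W" "g \<in> module_hom K V W"
  shows "(\<lambda>x. f x \<oplus>\<^bsub>W\<^esub> g x) \<in> module_hom K V W"
proof -
  interpret W: vectorspace K W by fact
  note [simp] = module_hom_mem[OF assms(2)] module_hom_mem[OF assms(3)]
    module_hom_add[OF assms(2)] module_hom_add[OF assms(3)]
    module_hom_smult[OF assms(2)] module_hom_smult[OF assms(3)]
  show ?thesis
    by (rule module_homI) (auto simp: W.M.a_ac W.smult_r_distr)
qed

lemma module_hom_scale:
  assumes "vectorspace K W" "f \<in> module_hom K V W" "c \<in> carrier K"
  shows "(\<lambda>x. c \<odot>\<^bsub>W\<^esub> f x) \<in> module_hom K V W"
proof -
  interpret W: vectorspace K W by fact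
  note [simp] = module_hom_mem[OF assms(2)] module_hom_add[OF assms(2)] module_hom_smult[OF assms(2)]
  show ?thesis using assms(3)
    by (intro module_homI) (auto simp: W.smult_r_distr W.smult_assoc1[symmetric] W.R.m_comm)
qed

lemma base_space_vectorspace: "field K \<Longrightarrow> vectorspace K (base_space K)"
proof -
  assume "field K"
  then interpret K: field K .
  have "\<exists>w\<in>carrier K. v \<oplus>\<^bsub>K\<^esub> w = \<zero>\<^bsub>K\<^esub>" if "v \<in> carrier K" for v
    using that K.add.inv_closed K.r_neg by blast
  then show ?thesis
    by (intro vs_criteria) (auto simp: base_space_def K.a_ac K.m_ac K.l_distr K.r_distr \<open>field K\<close>)
qed

lemma base_space_sel [simp]:
  "carrier (base_space K) = carrier K" "zero (base_space K) = zero K"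
  "add (base_space K) = add K" "smult (base_space K) = mult K"
  by (simp_all add: base_space_def)

text \<open>No law is assumed in Q: each is the image under the surjection p of the same law in V.
  It is applied to the projection onto a quotient, and to p = \<open>id\<close> for records of
  different types with the same operations.\<close>

lemma vectorspace_image:
  assumes "vectorspace K V" and p: "carrier Q = p ` carrier V" and z: "p \<zero>\<^bsub>V\<^esub> = \<zero>\<^bsub>Q\<^esub>"
    and a: "\<And>u v. \<lbrakk>u \<in> carrier V; v \<in> carrier V\<rbrakk> \<Longrightarrow> p (u \<oplus>\<^bsub>V\<^esub> v) = p u \<oplus>\<^bsub>Q\<^esub> p v"
    and s: "\<And>c v. \<lbrakk>c \<in> carrier K; v \<in> carrier V\<rbrakk> \<Longrightarrow> p (c \<odot>\<^bsub>V\<^esub> v) = c \<odot>\<^bsub>Q\<^esub> p v"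
  shows "vectorspace K Q" "p \<in> module_hom K V Q"
proof -
  interpret V: vectorspace K V by fact
  note sym = a[symmetric] s[symmetric] z[symmetric]
  have neg: "\<exists>w\<in>p ` carrier V. v \<oplus>\<^bsub>Q\<^esub> w = \<zero>\<^bsub>Q\<^esub>" if "v \<in> p ` carrier V" for v
  proof -
    from that obtain u where u: "u \<in> carrier V" "v = p u" by auto
    then have "v \<oplus>\<^bsub>Q\<^esub> p (\<ominus>\<^bsub>V\<^esub> u) = \<zero>\<^bsub>Q\<^esub>"
      using a[of u "\<ominus>\<^bsub>V\<^esub> u"] z by (simp add: V.M.r_neg)
    then show ?thesis using u by auto
  qed
  show "vectorspace K Q"
  proof (rule vs_criteria)
    show "field K" using assms(1) by (rule vectorspace_field)
  qed (use neg in \<open>auto simp: p sym V.M.a_ac V.smult_assoc1 V.smult_l_distr V.smult_r_distr\<close>)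
  show "p \<in> module_hom K V Q"
    by (rule module_homI) (auto simp: p a s)
qed

lemma subspaceI:
  assumes "vectorspace K V" "W \<subseteq> carrier V" "\<zero>\<^bsub>V\<^esub> \<in> W"
    and "\<And>u v. \<lbrakk>u \<in> W; v \<in> W\<rbrakk> \<Longrightarrow> u \<oplus>\<^bsub>V\<^esub> v \<in> W"
    and "\<And>c v. \<lbrakk>c \<in> carrier K; v \<in> W\<rbrakk> \<Longrightarrow> c \<odot>\<^bsub>V\<^esub> v \<in> W"
  shows "subspace K W V"
  using assms by (auto simp: subspace_def submodule_def vectorspace_def)

lemma subspaceD:
  assumes "subspace K W V"
  shows "vectorspace K V" "W \<subseteq> carrier V" "\<zero>\<^bsub>V\<^esub> \<in> W"
    and "\<And>u v. \<lbrakk>u \<in> W; v \<in> W\<rbrakk> \<Longrightarrow> u \<oplus>\<^bsub>V\<^esub> v \<in> W"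
    and "\<And>c v. \<lbrakk>c \<in> carrier K; v \<in> W\<rbrakk> \<Longrightarrow> c \<odot>\<^bsub>V\<^esub> v \<in> W"
  using assms by (auto simp: subspace_def submodule_def)

lemma subspace_vectorspace:
  assumes "subspace K W V"
  shows "vectorspace K (V\<lparr>carrier := W\<rparr>)"
  using vectorspace.subspace_is_vs[OF subspaceD(1)[OF assms] assms] .

lemma subspace_span:
  assumes "vectorspace K V" "S \<subseteq> carrier V"
  shows "subspace K (module.span K V S) V"
  using assms vectorspace.span_is_subspace by blast

lemma subspace_minus:
  assumes "subspace K W V" "u \<in> W" "v \<in> W"
  shows "u \<ominus>\<^bsub>V\<^esub> v \<in> W"
proof -
  interpret V: vectorspace K V using subspaceD[OF assms(1)] by simp
  have "v \<in> carrier V" using subspaceD(2)[OF assms(1)] assms by auto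
  then have "\<ominus>\<^bsub>V\<^esub> v = (\<ominus>\<^bsub>K\<^esub> \<one>\<^bsub>K\<^esub>) \<odot>\<^bsub>V\<^esub> v" by (simp add: V.smult_minus_1)
  then have "\<ominus>\<^bsub>V\<^esub> v \<in> W" using subspaceD(5)[OF assms(1), of "\<ominus>\<^bsub>K\<^esub> \<one>\<^bsub>K\<^esub>" v] assms(3) by simp
  then show ?thesis unfolding a_minus_def using subspaceD(4)[OF assms(1)] assms(2) by blast
qed

section \<open>Quotient spaces\<close>

context
  fixes K :: "('k, 'n) ring_scheme" and V :: "('k, 'v, 'm) module_scheme" and W :: "'v set"
  assumes W: "subspace K W V"
begin

lemma subspace_abelian_subgroup: "abelian_subgroup W V"
proof -
  interpret V: vectorspace K V using subspaceD[OF W] by simp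
  have "\<ominus>\<^bsub>V\<^esub> v \<in> W" if "v \<in> W" for v
    using subspace_minus[OF W subspaceD(3)[OF W] that] subspaceD(2)[OF W] that
    by (auto simp: a_minus_def subset_iff)
  then have "additive_subgroup W V"
    using subspaceD[OF W]
    by (intro additive_subgroupI subgroup.intro) (auto simp: a_inv_def[symmetric])
  then show ?thesis by (rule abelian_subgroupI3) (rule V.abelian_group_axioms)
qed

lemma quotient_space_carrier:
  "carrier (quotient_space V W) = (\<lambda>v. W +>\<^bsub>V\<^esub> v) ` carrier V"
  by (auto simp: quotient_space_def A_RCOSETS_def')

lemma quotient_space_eq_iff:
  assumes "u \<in> carrier V" "v \<in> carrier V"
  shows "W +>\<^bsub>V\<^esub> u = W +>\<^bsub>V\<^esub> v \<longleftrightarrow> u \<ominus>\<^bsub>V\<^esub> v \<in> W"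
proof -
  interpret abelian_subgroup W V by (rule subspace_abelian_subgroup)
  show ?thesis
    using a_rcos_module_minus a_repr_independence' a_repr_independenceD a_rcos_self assms
    by (metis abelian_subgroup.a_repr_independence' ring_def subspaceD(1) subspace_abelian_subgroup W a_rcos_module a_minus_def)
qed

lemma quotient_space_vectorspace: "vectorspace K (quotient_space V W)"
  and quotient_space_proj: "(\<lambda>v. W +>\<^bsub>V\<^esub> v) \<in> module_hom K V (quotient_space V W)"
proof -
  interpret V: vectorspace K V using subspaceD[OF W] by simp
  interpret abelian_subgroup W V by (rule subspace_abelian_subgroup)
  have W0: "W +>\<^bsub>V\<^esub> \<zero>\<^bsub>V\<^esub> = W" by (simp add: a_subset)
  \<comment> \<open>The union defining scalar multiplication runs over all representatives of the
    coset. All of them yield the same coset, so the union collapses to it.\<close>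
  have sm: "(\<Union>s\<in>W +>\<^bsub>V\<^esub> v. W +>\<^bsub>V\<^esub> (c \<odot>\<^bsub>V\<^esub> s)) = W +>\<^bsub>V\<^esub> (c \<odot>\<^bsub>V\<^esub> v)"
    if c: "c \<in> carrier K" and v: "v \<in> carrier V" for c v
  proof -
    have "W +>\<^bsub>V\<^esub> (c \<odot>\<^bsub>V\<^esub> s) = W +>\<^bsub>V\<^esub> (c \<odot>\<^bsub>V\<^esub> v)" if s: "s \<in> W +>\<^bsub>V\<^esub> v" for s
    proof -
      obtain w where w: "w \<in> W" "s = w \<oplus>\<^bsub>V\<^esub> v" using s by (auto simp: a_r_coset_def')
      then have wV: "w \<in> carrier V" using subspaceD(2)[OF W] by auto
      have "c \<odot>\<^bsub>V\<^esub> s \<ominus>\<^bsub>V\<^esub> c \<odot>\<^bsub>V\<^esub> v = c \<odot>\<^bsub>V\<^esub> w"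
        using w wV c v by (simp add: V.smult_r_distr a_minus_def V.M.a_assoc V.M.r_neg)
      then show ?thesis
        using w wV c v subspaceD(5)[OF W] by (subst quotient_space_eq_iff) auto
    qed
    moreover have "v \<in> W +>\<^bsub>V\<^esub> v" using v by (rule a_rcos_self)
    ultimately show ?thesis by blast
  qed
  note * = vectorspace_image[OF V.vectorspace_axioms quotient_space_carrier]
  show "vectorspace K (quotient_space V W)"
    by (rule *) (auto simp: quotient_space_def W0 a_rcos_sum sm)
  show "(\<lambda>v. W +>\<^bsub>V\<^esub> v) \<in> module_hom K V (quotient_space V W)"
    by (rule *) (auto simp: quotient_space_def W0 a_rcos_sum sm)
qed

end

text \<open>Subtraction in \<open>base_space K\<close> unfolds to subtraction in K, since both are
  built from the same carrier, zero and addition.\<close>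

lemma functional_minus:
  assumes "vectorspace K V" "f \<in> module_hom K V (base_space K)" "u \<in> carrier V" "v \<in> carrier V"
  shows "f (u \<ominus>\<^bsub>V\<^esub> v) = f u \<ominus>\<^bsub>K\<^esub> f v"
  using module_hom_minus[OF assms(1) base_space_vectorspace[OF vectorspace_field[OF assms(1)]] assms(2-4)]
  by (simp add: a_minus_def a_inv_def m_inv_def)

lemma span_least:
  assumes "subspace K N V" "S \<subseteq> N"
  shows "module.span K V S \<subseteq> N"
  using assms by (meson module.span_is_subset subspace_def vectorspace_def)

lemma span_superset:
  assumes "vectorspace K V" "S \<subseteq> carrier V"
  shows "S \<subseteq> module.span K V S"
  using assms by (meson module.in_own_span vectorspace_def)

lemma subspace_vimage:
  assumes "vectorspace K V" "vectorspace K W" "f \<in> module_hom K V W" "subspace K N W"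
  shows "subspace K {v \<in> carrier V. f v \<in> N} V"
proof -
  interpret V: vectorspace K V by fact
  show ?thesis
    using module_hom_zero[OF assms(1-3)] subspaceD[OF assms(4)]
      module_hom_add[OF assms(3)] module_hom_smult[OF assms(3)]
    by (intro subspaceI assms) auto
qed

lemma subspace_image:
  assumes "vectorspace K V" "vectorspace K W" "f \<in> module_hom K V W" "subspace K N V"
  shows "subspace K (f ` N) W"
proof (intro subspaceI assms(2))
  note N = subspaceD[OF assms(4)]
  show "f ` N \<subseteq> carrier W" using N module_hom_mem[OF assms(3)] by auto
  show "\<zero>\<^bsub>W\<^esub> \<in> f ` N" using N module_hom_zero[OF assms(1-3)] by (metis image_eqI)
  show "u \<oplus>\<^bsub>W\<^esub> v \<in> f ` N" if "u \<in> f ` N" "v \<in> f ` N" for u v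
  proof -
    from that obtain x y where "x \<in> N" "y \<in> N" "u = f x" "v = f y" by auto
    then show ?thesis
      using N module_hom_add[OF assms(3), of x y] by (metis image_eqI subsetD)
  qed
  show "c \<odot>\<^bsub>W\<^esub> v \<in> f ` N" if "c \<in> carrier K" "v \<in> f ` N" for c v
  proof -
    from that obtain y where "y \<in> N" "v = f y" by auto
    then show ?thesis
      using N module_hom_smult[OF assms(3) that(1), of y] that(1) by (metis image_eqI subsetD)
  qed
qed

lemma span_image:
  assumes "vectorspace K V" "vectorspace K W" "f \<in> module_hom K V W" "S \<subseteq> carrier V"
  shows "f ` module.span K V S = module.span K W (f ` S)"
proof
  have fS: "f ` S \<subseteq> carrier W" using assms(4) module_hom_mem[OF assms(3)] by auto
  show "module.span K W (f ` S) \<subseteq> f ` module.span K V S"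
    using span_superset[OF assms(1,4)]
    by (intro span_least subspace_image[OF assms(1-3)] subspace_span[OF assms(1,4)]) auto
  have "module.span K V S \<subseteq> {v \<in> carrier V. f v \<in> module.span K W (f ` S)}"
    using span_superset[OF assms(2) fS] assms(4)
    by (intro span_least subspace_vimage[OF assms(1-3)] subspace_span[OF assms(2) fS]) auto
  then show "f ` module.span K V S \<subseteq> module.span K W (f ` S)" by auto
qed

section \<open>Finite dimension and codimension through finitely many functionals\<close>

lemma fin_dim_iff:
  assumes "vectorspace K V"
  shows "vectorspace.fin_dim K V \<longleftrightarrow>
    (\<exists>Y. finite Y \<and> Y \<subseteq> carrier V \<and> module.span K V Y = carrier V)"
  using vectorspace.fin_dim_def[OF assms] by simp

lemma fin_dim_coordinates:
  assumes V: "vectorspace K V" and fd: "vectorspace.fin_dim K V"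
  obtains B c where "finite B" "B \<subseteq> carrier V"
    "\<And>b. b \<in> B \<Longrightarrow> c b \<in> module_hom K V (base_space K)"
    "\<And>v. v \<in> carrier V \<Longrightarrow> v = (\<Oplus>\<^bsub>V\<^esub>b\<in>B. c b v \<odot>\<^bsub>V\<^esub> b)"
proof -
  interpret V: vectorspace K V by fact
  obtain B where B: "finite B" "V.basis B" using V.finite_basis_exists[OF fd] by blast
  have BV: "B \<subseteq> carrier V" using B(2) by (simp add: V.basis_def)
  have ex1: "\<exists>!a. a \<in> B \<rightarrow>\<^sub>E carrier K \<and> V.lincomb a B = v" if "v \<in> carrier V" for v
    using V.basis_criterion[OF B(1) BV] B(2) that by blast
  define a where "a v = (THE a. a \<in> B \<rightarrow>\<^sub>E carrier K \<and> V.lincomb a B = v)" for v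
  have a: "a v \<in> B \<rightarrow>\<^sub>E carrier K" "V.lincomb (a v) B = v" if "v \<in> carrier V" for v
    using theI'[OF ex1[OF that]] by (auto simp: a_def)
  \<comment> \<open>Coefficients with respect to a basis are unique only among functions that are
    undefined outside B, hence the restriction. Linearity of the coordinates then follows from this
    uniqueness.\<close>
  have a_eq: "a v = restrict f B"
    if "v \<in> carrier V" "f \<in> B \<rightarrow> carrier K" "V.lincomb f B = v" for f v
  proof -
    have "V.lincomb (restrict f B) B = V.lincomb f B"
      using BV that(2) by (intro V.lincomb_cong) auto
    then have "restrict f B \<in> B \<rightarrow>\<^sub>E carrier K \<and> V.lincomb (restrict f B) B = v"
      using that(2,3) by auto
    then show ?thesis using ex1[OF that(1)] a[OF that(1)] by blast
  qed
  have "(\<lambda>v. a v b) \<in> module_hom K V (base_space K)" if b: "b \<in> B" for b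
  proof (rule module_homI)
    show "a v b \<in> carrier (base_space K)" if "v \<in> carrier V" for v
      using a(1)[OF that] b by auto
    show "a (u \<oplus>\<^bsub>V\<^esub> v) b = a u b \<oplus>\<^bsub>base_space K\<^esub> a v b" if u: "u \<in> carrier V" and v: "v \<in> carrier V" for u v
    proof -
      have p: "a u \<in> B \<rightarrow> carrier K" "a v \<in> B \<rightarrow> carrier K"
        using a(1)[OF u] a(1)[OF v] by auto
      have "a (u \<oplus>\<^bsub>V\<^esub> v) = restrict (\<lambda>b. a u b \<oplus>\<^bsub>K\<^esub> a v b) B"
        using p u v a by (intro a_eq) (auto simp: V.lincomb_sum[OF B(1) BV])
      then show ?thesis using b by simp
    qed
    show "a (k \<odot>\<^bsub>V\<^esub> v) b = k \<odot>\<^bsub>base_space K\<^esub> a v b" if k: "k \<in> carrier K" and v: "v \<in> carrier V" for k v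
    proof -
      have p: "a v \<in> B \<rightarrow> carrier K" using a(1)[OF v] by auto
      have "a (k \<odot>\<^bsub>V\<^esub> v) = restrict (\<lambda>b. k \<otimes>\<^bsub>K\<^esub> a v b) B"
        using p k v a by (intro a_eq) (auto simp: V.lincomb_smult[OF BV])
      then show ?thesis using b by simp
    qed
  qed
  moreover have "v = (\<Oplus>\<^bsub>V\<^esub>b\<in>B. a v b \<odot>\<^bsub>V\<^esub> b)" if "v \<in> carrier V" for v
    using a(2)[OF that] by (simp add: V.lincomb_def)
  ultimately show thesis using that[OF B(1) BV, of "\<lambda>b v. a v b"] by blast
qed

text \<open>The joint evaluation from V to K^G has a finite dimensional image, and Y is a set of
  preimages of generators of that image. Adding one functional g enlarges the image only if g does
  not vanish on the common kernel of G; then one vector of that kernel is added to Y.\<close>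

lemma finite_functionals_span:
  assumes V: "vectorspace K V" and "finite G" "G \<subseteq> module_hom K V (base_space K)"
  shows "\<exists>Y. finite Y \<and> Y \<subseteq> carrier V \<and>
    (\<forall>v\<in>carrier V. \<exists>y\<in>module.span K V Y. \<forall>g\<in>G. g v = g y)"
  using assms(2,3)
proof (induction G)
  case empty
  interpret V: vectorspace K V by fact
  show ?case using subspaceD(3)[OF subspace_span[OF V, of "{}"]] by (intro exI[of _ "{}"]) auto
next
  case (insert g G)
  interpret V: vectorspace K V by fact
  have gh: "g \<in> module_hom K V (base_space K)"
    and Gh: "\<And>h. h \<in> G \<Longrightarrow> h \<in> module_hom K V (base_space K)"
    using insert.prems by auto
  note gl = module_hom_mem[OF gh] module_hom_add[OF gh] module_hom_smult[OF gh]
  note Gl = module_hom_mem[OF Gh] module_hom_add[OF Gh] module_hom_smult[OF Gh]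
  obtain Y where Y: "finite Y" "Y \<subseteq> carrier V"
    and Yv: "\<And>v. v \<in> carrier V \<Longrightarrow> \<exists>y\<in>module.span K V Y. \<forall>g\<in>G. g v = g y"
    using insert by auto
  have YV: "y \<in> carrier V" if "y \<in> module.span K V Y" for y
    using that subspaceD(2)[OF subspace_span[OF V Y(2)]] by auto
  show ?case
  proof (cases "\<exists>z\<in>carrier V. (\<forall>h\<in>G. h z = \<zero>\<^bsub>K\<^esub>) \<and> g z \<noteq> \<zero>\<^bsub>K\<^esub>")
    case True
    then obtain z where z: "z \<in> carrier V" "\<And>h. h \<in> G \<Longrightarrow> h z = \<zero>\<^bsub>K\<^esub>" "g z \<noteq> \<zero>\<^bsub>K\<^esub>" by auto
    have Y': "insert z Y \<subseteq> carrier V" using Y z by auto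
    note sp = subspaceD[OF subspace_span[OF V Y']]
    have mono: "module.span K V Y \<subseteq> module.span K V (insert z Y)"
      by (rule V.span_is_monotone) auto
    have "\<exists>y\<in>module.span K V (insert z Y). \<forall>h\<in>insert g G. h v = h y" if v: "v \<in> carrier V" for v
    proof -
      obtain y where y: "y \<in> module.span K V Y" "\<And>h. h \<in> G \<Longrightarrow> h v = h y" using Yv[OF v] by blast
      note yV = YV[OF y(1)]
      \<comment> \<open>Adding s z to y leaves the values under G unchanged, as z lies in their
        common kernel, and s is the scalar that corrects the value under g from g(y) to
        g(v).\<close>
      define s where "s = (g v \<ominus>\<^bsub>K\<^esub> g y) \<otimes>\<^bsub>K\<^esub> inv\<^bsub>K\<^esub> (g z)"
      have c: "g v \<in> carrier K" "g y \<in> carrier K" "g z \<in> carrier K"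
        using gl v yV z by auto
      then have iz: "inv\<^bsub>K\<^esub> (g z) \<in> carrier K" "inv\<^bsub>K\<^esub> (g z) \<otimes>\<^bsub>K\<^esub> g z = \<one>\<^bsub>K\<^esub>"
        using z(3) V.field_Units by auto
      have s: "s \<in> carrier K" using c iz by (simp add: s_def)
      have "s \<otimes>\<^bsub>K\<^esub> g z = g v \<ominus>\<^bsub>K\<^esub> g y" using c iz by (simp add: s_def V.R.m_assoc)
      moreover have "g y \<oplus>\<^bsub>K\<^esub> (g v \<ominus>\<^bsub>K\<^esub> g y) = g v"
        using c by (simp add: a_minus_def V.R.a_ac V.R.r_neg V.R.r_neg1 V.R.r_neg2)
      ultimately have "g (y \<oplus>\<^bsub>V\<^esub> s \<odot>\<^bsub>V\<^esub> z) = g v" using gl yV s z(1) by simp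
      moreover have "h (y \<oplus>\<^bsub>V\<^esub> s \<odot>\<^bsub>V\<^esub> z) = h v" if "h \<in> G" for h
        using Gl[OF that] yV s z(1) z(2)[OF that] y(2)[OF that] v by simp
      moreover have "y \<oplus>\<^bsub>V\<^esub> s \<odot>\<^bsub>V\<^esub> z \<in> module.span K V (insert z Y)"
        using y(1) mono s span_superset[OF V Y'] by (intro sp(4) sp(5)) auto
      ultimately show ?thesis by (metis insert_iff)
    qed
    then show ?thesis using Y Y' by (intro exI[of _ "insert z Y"]) auto
  next
    case False
    \<comment> \<open>Here g vanishes on the common kernel of G, so the values under G already
      determine the value under g.\<close>
    have "g v = g y" if v: "v \<in> carrier V" and y: "y \<in> carrier V" "\<And>h. h \<in> G \<Longrightarrow> h v = h y" for v y
    proof -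
      have "h (v \<ominus>\<^bsub>V\<^esub> y) = \<zero>\<^bsub>K\<^esub>" if "h \<in> G" for h
        using functional_minus[OF V Gh[OF that] v y(1)] y(2)[OF that] Gl(1)[OF that y(1)]
        by simp
      then have "g (v \<ominus>\<^bsub>V\<^esub> y) = \<zero>\<^bsub>K\<^esub>" using False v y by auto
      moreover have "g (v \<ominus>\<^bsub>V\<^esub> y) = g v \<ominus>\<^bsub>K\<^esub> g y"
        by (rule functional_minus[OF V gh v y(1)])
      ultimately show ?thesis using gl(1)[OF v] gl(1)[OF y(1)] by simp
    qed
    then have "\<exists>y\<in>module.span K V Y. \<forall>h\<in>insert g G. h v = h y" if "v \<in> carrier V" for v
      using Yv[OF that] YV that by (metis insert_iff)
    then show ?thesis using Y by blast
  qed
qed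

text \<open>V embeds into K^G: a vector of \<open>span Y\<close> with the same values as v must be v
  itself.\<close>

lemma fin_dim_functionalsI:
  assumes V: "vectorspace K V" and "finite G" "G \<subseteq> module_hom K V (base_space K)"
    and sep: "\<And>u v. \<lbrakk>u \<in> carrier V; v \<in> carrier V; \<And>g. g \<in> G \<Longrightarrow> g u = g v\<rbrakk> \<Longrightarrow> u = v"
  shows "vectorspace.fin_dim K V"
proof -
  obtain Y where Y: "finite Y" "Y \<subseteq> carrier V"
    and Yv: "\<And>v. v \<in> carrier V \<Longrightarrow> \<exists>y\<in>module.span K V Y. \<forall>g\<in>G. g v = g y"
    using finite_functionals_span[OF assms(1-3)] by auto
  note sp = subspaceD(2)[OF subspace_span[OF V Y(2)]]
  have "carrier V \<subseteq> module.span K V Y"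
  proof
    fix v assume v: "v \<in> carrier V"
    then obtain y where "y \<in> module.span K V Y" "\<forall>g\<in>G. g v = g y" using Yv by blast
    then show "v \<in> module.span K V Y" using sep[of v y] v sp by auto
  qed
  then show ?thesis unfolding fin_dim_iff[OF V] using Y sp by blast
qed

text \<open>Coordinate functionals of \<open>span S\<close> still separate points after restriction
  to N, so no basis of N has to be extracted from S.\<close>

lemma fin_dim_subspace:
  assumes N: "subspace K N V" and S: "finite S" "S \<subseteq> carrier V" "N \<subseteq> module.span K V S"
  shows "vectorspace.fin_dim K (V\<lparr>carrier := N\<rparr>)"
proof -
  note V = subspaceD(1)[OF N]
  interpret V: vectorspace K V by fact
  let ?L = "V\<lparr>carrier := module.span K V S\<rparr>"
  note L = subspace_span[OF V S(2)]
  have "module.span K ?L S = module.span K V S"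
    using L span_superset[OF V S(2)] by (intro V.span_li_not_depend) auto
  then have "vectorspace.fin_dim K ?L"
    unfolding fin_dim_iff[OF subspace_vectorspace[OF L]]
    using S span_superset[OF V S(2)] by auto
  then obtain B c where B: "finite B" "B \<subseteq> carrier ?L"
    and c: "\<And>b. b \<in> B \<Longrightarrow> c b \<in> module_hom K ?L (base_space K)"
    and v: "\<And>v. v \<in> carrier ?L \<Longrightarrow> v = (\<Oplus>\<^bsub>?L\<^esub>b\<in>B. c b v \<odot>\<^bsub>?L\<^esub> b)"
    using fin_dim_coordinates[OF subspace_vectorspace[OF L]] by blast
  interpret L: vectorspace K ?L by (rule subspace_vectorspace[OF L])
  show ?thesis
  proof (rule fin_dim_functionalsI[OF subspace_vectorspace[OF N], of "c ` B"])
    have "c b \<in> module_hom K (V\<lparr>carrier := N\<rparr>) (base_space K)" if "b \<in> B" for b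
      using c[OF that] S(3) by (auto simp: module_hom_def Pi_iff subset_iff)
    then show "c ` B \<subseteq> module_hom K (V\<lparr>carrier := N\<rparr>) (base_space K)" by auto
    fix x y assume xy: "x \<in> carrier (V\<lparr>carrier := N\<rparr>)" "y \<in> carrier (V\<lparr>carrier := N\<rparr>)"
      "\<And>g. g \<in> c ` B \<Longrightarrow> g x = g y"
    then have "x \<in> carrier ?L" "y \<in> carrier ?L" using S(3) by auto
    moreover have "(\<Oplus>\<^bsub>?L\<^esub>b\<in>B. c b x \<odot>\<^bsub>?L\<^esub> b) = (\<Oplus>\<^bsub>?L\<^esub>b\<in>B. c b y \<odot>\<^bsub>?L\<^esub> b)"
    proof (rule L.M.finsum_cong')
      show "(\<lambda>b. c b y \<odot>\<^bsub>?L\<^esub> b) \<in> B \<rightarrow> carrier ?L"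
      proof
        fix b assume b: "b \<in> B"
        then have "c b y \<in> carrier K" using module_hom_mem[OF c[OF b] \<open>y \<in> carrier ?L\<close>] by simp
        then show "c b y \<odot>\<^bsub>?L\<^esub> b \<in> carrier ?L" using B(2) b by (intro L.smult_closed) auto
      qed
    qed (use xy(3)[OF imageI] in auto)
    ultimately show "x = y" using v[of x] v[of y] by (simp only:)
  qed (use B in auto)
qed

lemma fin_dim_subspace_coordinates:
  assumes N: "subspace K N V" and fd: "vectorspace.fin_dim K (V\<lparr>carrier := N\<rparr>)"
  obtains B c where "finite B" "B \<subseteq> N"
    "\<And>b. b \<in> B \<Longrightarrow> c b \<in> module_hom K (V\<lparr>carrier := N\<rparr>) (base_space K)"
    "\<And>v. v \<in> N \<Longrightarrow> v = (\<Oplus>\<^bsub>V\<^esub>b\<in>B. c b v \<odot>\<^bsub>V\<^esub> b)"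
proof -
  interpret V: vectorspace K V using subspaceD[OF N] by simp
  let ?N = "V\<lparr>carrier := N\<rparr>"
  obtain B c where B: "finite B" "B \<subseteq> N"
    and c: "\<And>b. b \<in> B \<Longrightarrow> c b \<in> module_hom K ?N (base_space K)"
    and v: "\<And>v. v \<in> N \<Longrightarrow> v = (\<Oplus>\<^bsub>?N\<^esub>b\<in>B. c b v \<odot>\<^bsub>?N\<^esub> b)"
    using fin_dim_coordinates[OF subspace_vectorspace[OF N] fd] by auto
  have "v = (\<Oplus>\<^bsub>V\<^esub>b\<in>B. c b v \<odot>\<^bsub>V\<^esub> b)" if vN: "v \<in> N" for v
  proof -
    have "c b v \<odot>\<^bsub>V\<^esub> b \<in> N" if b: "b \<in> B" for b
      using module_hom_mem[OF c[OF b], of v] vN B b subspaceD(5)[OF N] by auto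
    then have "(\<Oplus>\<^bsub>?N\<^esub>b\<in>B. c b v \<odot>\<^bsub>V\<^esub> b) = (\<Oplus>\<^bsub>V\<^esub>b\<in>B. c b v \<odot>\<^bsub>V\<^esub> b)"
      using N by (intro V.finsum_not_depend B) auto
    then show ?thesis using v[OF vN] by simp
  qed
  then show thesis using that B c by blast
qed

text \<open>This removes cosets from later arguments. In one direction the functionals are the
  coordinates of V/I composed with the projection. In the other, the set Y of
  \<open>finite_functionals_span\<close> generates V modulo the common kernel of G, hence modulo
  I.\<close>

lemma fin_codim_iff:
  assumes I: "subspace K I V"
  shows "vectorspace.fin_dim K (quotient_space V I) \<longleftrightarrow>
    (\<exists>G. finite G \<and> G \<subseteq> module_hom K V (base_space K) \<and>
      (\<forall>v\<in>carrier V. (\<forall>g\<in>G. g v = \<zero>\<^bsub>K\<^esub>) \<longrightarrow> v \<in> I))" (is "?L \<longleftrightarrow> ?R")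
proof
  note V = subspaceD(1)[OF I]
  note Q = quotient_space_vectorspace[OF I]
  note p = quotient_space_proj[OF I]
  interpret V: vectorspace K V by fact
  interpret Q: vectorspace K "quotient_space V I" by fact
  {
    assume ?L
    then obtain B c where B: "finite B" "B \<subseteq> carrier (quotient_space V I)"
      and c: "\<And>b. b \<in> B \<Longrightarrow> c b \<in> module_hom K (quotient_space V I) (base_space K)"
      and v: "\<And>v. v \<in> carrier (quotient_space V I) \<Longrightarrow>
        v = (\<Oplus>\<^bsub>quotient_space V I\<^esub>b\<in>B. c b v \<odot>\<^bsub>quotient_space V I\<^esub> b)"
      using fin_dim_coordinates[OF Q] by blast
    have vI: "v \<in> I" if vV: "v \<in> carrier V" and z: "\<And>b. b \<in> B \<Longrightarrow> c b (I +>\<^bsub>V\<^esub> v) = \<zero>\<^bsub>K\<^esub>" for v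
    proof -
      have "I +>\<^bsub>V\<^esub> v = (\<Oplus>\<^bsub>quotient_space V I\<^esub>b\<in>B. c b (I +>\<^bsub>V\<^esub> v) \<odot>\<^bsub>quotient_space V I\<^esub> b)"
        using v[OF module_hom_mem[OF p vV]] .
      also have "\<dots> = (\<Oplus>\<^bsub>quotient_space V I\<^esub>b\<in>B. \<zero>\<^bsub>quotient_space V I\<^esub>)"
        using z B(2) by (intro Q.M.finsum_cong') (auto simp: subset_iff)
      also have "\<dots> = I +>\<^bsub>V\<^esub> \<zero>\<^bsub>V\<^esub>"
        using module_hom_zero[OF V Q p] by (simp add: Q.M.finsum_zero)
      finally have "v \<ominus>\<^bsub>V\<^esub> \<zero>\<^bsub>V\<^esub> \<in> I" using quotient_space_eq_iff[OF I vV] by simp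
      then show ?thesis using vV using V.M.add.inv_one by (simp add: a_minus_def a_inv_def)
    qed
    show ?R
    proof (intro exI conjI ballI impI)
      show "finite ((\<lambda>b v. c b (I +>\<^bsub>V\<^esub> v)) ` B)" using B(1) by simp
      show "(\<lambda>b v. c b (I +>\<^bsub>V\<^esub> v)) ` B \<subseteq> module_hom K V (base_space K)"
        using module_hom_comp[OF p c] by blast
      show "v \<in> I" if "v \<in> carrier V" "\<forall>g\<in>(\<lambda>b v. c b (I +>\<^bsub>V\<^esub> v)) ` B. g v = \<zero>\<^bsub>K\<^esub>" for v
        by (rule vI[OF that(1)]) (use that(2) in auto)
    qed
  next
    assume ?R
    then obtain G where G: "finite G" "G \<subseteq> module_hom K V (base_space K)"
      and k': "\<forall>v\<in>carrier V. (\<forall>g\<in>G. g v = \<zero>\<^bsub>K\<^esub>) \<longrightarrow> v \<in> I" by (elim exE conjE)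
    have k: "v \<in> I" if "v \<in> carrier V" "\<And>g. g \<in> G \<Longrightarrow> g v = \<zero>\<^bsub>K\<^esub>" for v
      using k' that by simp
    obtain Y where Y: "finite Y" "Y \<subseteq> carrier V"
      and Yv: "\<And>v. v \<in> carrier V \<Longrightarrow> \<exists>y\<in>module.span K V Y. \<forall>g\<in>G. g v = g y"
      using finite_functionals_span[OF V G] by auto
    note sp = subspaceD(2)[OF subspace_span[OF V Y(2)]]
    have "I +>\<^bsub>V\<^esub> v \<in> (\<lambda>v. I +>\<^bsub>V\<^esub> v) ` module.span K V Y" if v: "v \<in> carrier V" for v
    proof -
      obtain y where y: "y \<in> module.span K V Y" "\<And>g. g \<in> G \<Longrightarrow> g v = g y" using Yv[OF v] by blast
      then have yV: "y \<in> carrier V" using sp by auto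
      have "v \<ominus>\<^bsub>V\<^esub> y \<in> I"
      proof (rule k)
        fix g assume g: "g \<in> G"
        then have gh: "g \<in> module_hom K V (base_space K)" using G by auto
        have "g v \<in> carrier K" using module_hom_mem[OF gh v] by simp
        then show "g (v \<ominus>\<^bsub>V\<^esub> y) = \<zero>\<^bsub>K\<^esub>"
          using functional_minus[OF V gh v yV] y(2)[OF g] by simp
      qed (use v yV in simp)
      then show ?thesis using quotient_space_eq_iff[OF I v yV] y(1) by blast
    qed
    then have "carrier (quotient_space V I) = (\<lambda>v. I +>\<^bsub>V\<^esub> v) ` module.span K V Y"
      using sp by (auto simp: quotient_space_carrier[OF I])
    then have "module.span K (quotient_space V I) ((\<lambda>v. I +>\<^bsub>V\<^esub> v) ` Y) = carrier (quotient_space V I)"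
      using span_image[OF V Q p Y(2)] by simp
    moreover have "(\<lambda>v. I +>\<^bsub>V\<^esub> v) ` Y \<subseteq> carrier (quotient_space V I)"
      using Y(2) module_hom_mem[OF p] by auto
    ultimately show ?L unfolding fin_dim_iff[OF Q] using Y(1) by blast
  }
qed

text \<open>Lifting a finite generating set of the quotient gives V = span Y + I, the form in which
  finite codimension is used for \<open>annihilator_fin_dim\<close> and
  \<open>finite_support\<close>.\<close>

lemma fin_codim_span:
  assumes I: "subspace K I V" and fd: "vectorspace.fin_dim K (quotient_space V I)"
  obtains Y where "finite Y" "Y \<subseteq> carrier V"
    "\<And>v. v \<in> carrier V \<Longrightarrow> \<exists>y\<in>module.span K V Y. v \<ominus>\<^bsub>V\<^esub> y \<in> I"
proof -
  note V = subspaceD(1)[OF I]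
  interpret V: vectorspace K V by fact
  note Q = quotient_space_vectorspace[OF I]
  note p = quotient_space_proj[OF I]
  obtain Z where Z: "finite Z" "Z \<subseteq> (\<lambda>v. I +>\<^bsub>V\<^esub> v) ` carrier V"
    "module.span K (quotient_space V I) Z = carrier (quotient_space V I)"
    using fd by (auto simp: fin_dim_iff[OF Q] quotient_space_carrier[OF I])
  obtain Y where Y: "Y \<subseteq> carrier V" "finite Y" "Z = (\<lambda>v. I +>\<^bsub>V\<^esub> v) ` Y"
    using finite_subset_image[OF Z(1,2)] by blast
  have "\<exists>y\<in>module.span K V Y. v \<ominus>\<^bsub>V\<^esub> y \<in> I" if v: "v \<in> carrier V" for v
  proof -
    have "I +>\<^bsub>V\<^esub> v \<in> (\<lambda>v. I +>\<^bsub>V\<^esub> v) ` module.span K V Y"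
      using Z(3) module_hom_mem[OF p v] span_image[OF V Q p Y(1)] Y(3) by simp
    then show ?thesis
      using quotient_space_eq_iff[OF I v] subspaceD(2)[OF subspace_span[OF V Y(1)]] by blast
  qed
  then show thesis using that Y by blast
qed

section \<open>Free spaces and tensor products\<close>

lemma free_space_sel:
  assumes "field K"
  shows "carrier (free_space K S) = {\<phi> \<in> S \<rightarrow>\<^sub>E carrier K. finite {s \<in> S. \<phi> s \<noteq> \<zero>\<^bsub>K\<^esub>}}"
    and "\<zero>\<^bsub>free_space K S\<^esub> = (\<lambda>s\<in>S. \<zero>\<^bsub>K\<^esub>)"
    and "\<phi> \<oplus>\<^bsub>free_space K S\<^esub> \<psi> = (\<lambda>s\<in>S. \<phi> s \<oplus>\<^bsub>K\<^esub> \<psi> s)"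
    and "c \<odot>\<^bsub>free_space K S\<^esub> \<phi> = (\<lambda>s\<in>S. c \<otimes>\<^bsub>K\<^esub> \<phi> s)"
proof -
  interpret field K by fact
  show "carrier (free_space K S) = {\<phi> \<in> S \<rightarrow>\<^sub>E carrier K. finite {s \<in> S. \<phi> s \<noteq> \<zero>\<^bsub>K\<^esub>}}"
    "\<zero>\<^bsub>free_space K S\<^esub> = (\<lambda>s\<in>S. \<zero>\<^bsub>K\<^esub>)"
    "\<phi> \<oplus>\<^bsub>free_space K S\<^esub> \<psi> = (\<lambda>s\<in>S. \<phi> s \<oplus>\<^bsub>K\<^esub> \<psi> s)"
    "c \<odot>\<^bsub>free_space K S\<^esub> \<phi> = (\<lambda>s\<in>S. c \<otimes>\<^bsub>K\<^esub> \<phi> s)"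
    by (simp_all add: free_space_def func_space_def)
qed

lemma func_space_vectorspace: "field K \<Longrightarrow> vectorspace K (ring.func_space K S)"
  by (metis base_space_vectorspace vectorspace.func_space_is_vs)

lemma free_space_vectorspace:
  assumes "field K"
  shows "vectorspace K (free_space K S)"
proof -
  interpret field K by fact
  let ?P = "{\<phi> \<in> S \<rightarrow>\<^sub>E carrier K. finite {s \<in> S. \<phi> s \<noteq> \<zero>\<^bsub>K\<^esub>}}"
  have "subspace K ?P (func_space S)"
  proof (rule subspaceI[OF func_space_vectorspace[OF assms]])
    fix \<phi> \<psi> assume p: "\<phi> \<in> ?P" "\<psi> \<in> ?P"
    have "{s \<in> S. \<phi> s \<oplus>\<^bsub>K\<^esub> \<psi> s \<noteq> \<zero>\<^bsub>K\<^esub>} \<subseteq> {s \<in> S. \<phi> s \<noteq> \<zero>\<^bsub>K\<^esub>} \<union> {s \<in> S. \<psi> s \<noteq> \<zero>\<^bsub>K\<^esub>}"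
      by auto
    then have "finite {s \<in> S. \<phi> s \<oplus>\<^bsub>K\<^esub> \<psi> s \<noteq> \<zero>\<^bsub>K\<^esub>}"
      using p by (auto intro: finite_subset)
    moreover have "{s \<in> S. (\<lambda>s\<in>S. \<phi> s \<oplus>\<^bsub>K\<^esub> \<psi> s) s \<noteq> \<zero>\<^bsub>K\<^esub>} = {s \<in> S. \<phi> s \<oplus>\<^bsub>K\<^esub> \<psi> s \<noteq> \<zero>\<^bsub>K\<^esub>}"
      by auto
    ultimately show "\<phi> \<oplus>\<^bsub>func_space S\<^esub> \<psi> \<in> ?P" using p by (auto simp: func_space_def PiE_iff)
  next
    fix c \<phi> assume p: "c \<in> carrier K" "\<phi> \<in> ?P"
    have "{s \<in> S. (\<lambda>s\<in>S. c \<otimes>\<^bsub>K\<^esub> \<phi> s) s \<noteq> \<zero>\<^bsub>K\<^esub>} \<subseteq> {s \<in> S. \<phi> s \<noteq> \<zero>\<^bsub>K\<^esub>}"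
      using p by auto
    from finite_subset[OF this] have "finite {s \<in> S. (\<lambda>s\<in>S. c \<otimes>\<^bsub>K\<^esub> \<phi> s) s \<noteq> \<zero>\<^bsub>K\<^esub>}"
      using p by blast
    then show "c \<odot>\<^bsub>func_space S\<^esub> \<phi> \<in> ?P" using p by (auto simp: func_space_def PiE_iff)
  next
    show "?P \<subseteq> carrier (func_space S)" by (simp add: func_space_def Collect_subset)
    show "\<zero>\<^bsub>func_space S\<^esub> \<in> ?P" by (auto simp: func_space_def)
  qed
  from subspace_vectorspace[OF this] show ?thesis by (simp add: free_space_def)
qed

lemma free_gen_closed:
  assumes "field K" "s \<in> S"
  shows "free_gen K S s \<in> carrier (free_space K S)"
proof -
  interpret field K by fact
  have "{t \<in> S. free_gen K S s t \<noteq> \<zero>\<^bsub>K\<^esub>} \<subseteq> {s}" by (auto simp: free_gen_def)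
  then have "finite {t \<in> S. free_gen K S s t \<noteq> \<zero>\<^bsub>K\<^esub>}" by (rule finite_subset) simp
  then show ?thesis by (auto simp: free_space_sel[OF assms(1)] free_gen_def PiE_iff)
qed

lemma free_space_finsum_apply:
  assumes "field K" "x \<in> X \<rightarrow> carrier (free_space K S)" "s \<in> S"
  shows "(\<Oplus>\<^bsub>free_space K S\<^esub>i\<in>X. x i) s = (\<Oplus>\<^bsub>K\<^esub>i\<in>X. x i s)"
proof -
  have "(\<lambda>\<phi>. \<phi> s) \<in> module_hom K (free_space K S) (base_space K)"
    using assms(3) by (intro module_homI) (auto simp: free_space_sel[OF assms(1)])
  from module_hom_finsum[OF free_space_vectorspace[OF assms(1)] base_space_vectorspace[OF assms(1)] this assms(2)]
  \<comment> \<open>A finite sum depends only on carrier, zero and addition, so the sum taken in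
    \<open>base_space K\<close> is the sum taken in K.\<close>
  show ?thesis by (simp add: finsum_def finprod_def)
qed

lemma free_space_expand:
  assumes K: "field K" and \<phi>: "\<phi> \<in> carrier (free_space K S)"
  shows "\<phi> = (\<Oplus>\<^bsub>free_space K S\<^esub>s\<in>{s \<in> S. \<phi> s \<noteq> \<zero>\<^bsub>K\<^esub>}. \<phi> s \<odot>\<^bsub>free_space K S\<^esub> free_gen K S s)"
    (is "\<phi> = ?R")
proof -
  interpret K: field K by fact
  interpret F: vectorspace K "free_space K S" by (rule free_space_vectorspace[OF K])
  let ?X = "{s \<in> S. \<phi> s \<noteq> \<zero>\<^bsub>K\<^esub>}"
  have p: "\<phi> \<in> S \<rightarrow>\<^sub>E carrier K" "finite ?X" using \<phi> by (auto simp: free_space_sel[OF K])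
  have c: "(\<lambda>s. \<phi> s \<odot>\<^bsub>free_space K S\<^esub> free_gen K S s) \<in> ?X \<rightarrow> carrier (free_space K S)"
    using p free_gen_closed[OF K] by (auto intro!: F.smult_closed)
  have "\<phi> t = ?R t" if t: "t \<in> S" for t
  proof -
    have "?R t = (\<Oplus>\<^bsub>K\<^esub>s\<in>?X. (\<phi> s \<odot>\<^bsub>free_space K S\<^esub> free_gen K S s) t)"
      by (rule free_space_finsum_apply[OF K c t])
    also have "\<dots> = (\<Oplus>\<^bsub>K\<^esub>s\<in>?X. if t = s then \<phi> s else \<zero>\<^bsub>K\<^esub>)"
      using PiE_mem[OF p(1)] t by (intro K.finsum_cong') (auto simp: free_space_sel[OF K] free_gen_def)
    also have "\<dots> = \<phi> t"
    proof (cases "\<phi> t = \<zero>\<^bsub>K\<^esub>")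
      case True
      then have "(\<Oplus>\<^bsub>K\<^esub>s\<in>?X. if t = s then \<phi> s else \<zero>\<^bsub>K\<^esub>) = (\<Oplus>\<^bsub>K\<^esub>s\<in>?X. \<zero>\<^bsub>K\<^esub>)"
        by (intro K.finsum_cong') auto
      then show ?thesis using True by (simp add: K.finsum_zero)
    next
      case False
      then show ?thesis using p t by (intro K.finsum_singleton) auto
    qed
    finally show ?thesis by simp
  qed
  moreover have "?R \<in> S \<rightarrow>\<^sub>E carrier K"
    using F.M.finsum_closed[OF c] by (simp add: free_space_sel[OF K])
  ultimately show ?thesis using p(1) by (intro extensionalityI[of _ S]) (auto simp: PiE_iff)
qed

text \<open>The linear extension of b from the generators to the free space. Only the support of
  \<phi> is summed over, because S may be infinite and \<open>finsum\<close> over an infinite set is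
  a dummy value.\<close>

definition lin_ext :: "('k, 'n) ring_scheme \<Rightarrow> ('k, 'u, 'm) module_scheme \<Rightarrow> 's set \<Rightarrow> ('s \<Rightarrow> 'u) \<Rightarrow> ('s \<Rightarrow> 'k) \<Rightarrow> 'u" where
  "lin_ext K U S b \<phi> = (\<Oplus>\<^bsub>U\<^esub>s\<in>{s \<in> S. \<phi> s \<noteq> \<zero>\<^bsub>K\<^esub>}. \<phi> s \<odot>\<^bsub>U\<^esub> b s)"

context
  fixes K :: "('k, 'n) ring_scheme" and U :: "('k, 'u, 'm) module_scheme"
    and S :: "'s set" and b :: "'s \<Rightarrow> 'u"
  assumes U: "vectorspace K U" and b: "b \<in> S \<rightarrow> carrier U"
begin

text \<open>Terms outside the support vanish. This allows a common finite index set for two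
  functions with different supports, as additivity requires.\<close>

lemma lin_ext_superset:
  assumes \<phi>: "\<phi> \<in> S \<rightarrow> carrier K" and X: "finite X" "X \<subseteq> S" "{s \<in> S. \<phi> s \<noteq> \<zero>\<^bsub>K\<^esub>} \<subseteq> X"
  shows "lin_ext K U S b \<phi> = (\<Oplus>\<^bsub>U\<^esub>s\<in>X. \<phi> s \<odot>\<^bsub>U\<^esub> b s)"
proof -
  interpret U: vectorspace K U by (rule U)
  show ?thesis unfolding lin_ext_def
    using assms b by (intro U.M.add.finprod_mono_neutral_cong_left) (auto simp: Pi_iff subset_iff)
qed

lemma lin_ext_hom: "lin_ext K U S b \<in> module_hom K (free_space K S) U"
proof -
  interpret U: vectorspace K U by (rule U)
  note K = vectorspace_field[OF U]
  note [simp] = free_space_sel[OF K]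
  show ?thesis
  proof (rule module_homI)
    fix \<phi> assume "\<phi> \<in> carrier (free_space K S)"
    then show "lin_ext K U S b \<phi> \<in> carrier U"
      unfolding lin_ext_def using b by (intro U.M.finsum_closed) auto
  next
    fix \<phi> \<psi> assume p: "\<phi> \<in> carrier (free_space K S)" "\<psi> \<in> carrier (free_space K S)"
    let ?X = "{s \<in> S. \<phi> s \<noteq> \<zero>\<^bsub>K\<^esub>} \<union> {s \<in> S. \<psi> s \<noteq> \<zero>\<^bsub>K\<^esub>}"
    have X: "finite ?X" "?X \<subseteq> S" using p by auto
    have m: "\<phi> \<in> S \<rightarrow> carrier K" "\<psi> \<in> S \<rightarrow> carrier K" using p by auto
    have "lin_ext K U S b (\<phi> \<oplus>\<^bsub>free_space K S\<^esub> \<psi>) =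
      (\<Oplus>\<^bsub>U\<^esub>s\<in>?X. (\<phi> \<oplus>\<^bsub>free_space K S\<^esub> \<psi>) s \<odot>\<^bsub>U\<^esub> b s)"
      using X m by (intro lin_ext_superset) auto
    also have "\<dots> = (\<Oplus>\<^bsub>U\<^esub>s\<in>?X. \<phi> s \<odot>\<^bsub>U\<^esub> b s \<oplus>\<^bsub>U\<^esub> \<psi> s \<odot>\<^bsub>U\<^esub> b s)"
      using b m by (intro U.M.finsum_cong') (auto simp: U.smult_l_distr Pi_iff)
    also have "\<dots> = (\<Oplus>\<^bsub>U\<^esub>s\<in>?X. \<phi> s \<odot>\<^bsub>U\<^esub> b s) \<oplus>\<^bsub>U\<^esub> (\<Oplus>\<^bsub>U\<^esub>s\<in>?X. \<psi> s \<odot>\<^bsub>U\<^esub> b s)"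
      using b m by (intro U.M.finsum_addf) auto
    also have "\<dots> = lin_ext K U S b \<phi> \<oplus>\<^bsub>U\<^esub> lin_ext K U S b \<psi>"
      using lin_ext_superset[OF m(1) X] lin_ext_superset[OF m(2) X] by simp
    finally show "lin_ext K U S b (\<phi> \<oplus>\<^bsub>free_space K S\<^esub> \<psi>) = lin_ext K U S b \<phi> \<oplus>\<^bsub>U\<^esub> lin_ext K U S b \<psi>" .
  next
    fix c \<phi> assume p: "c \<in> carrier K" "\<phi> \<in> carrier (free_space K S)"
    let ?X = "{s \<in> S. \<phi> s \<noteq> \<zero>\<^bsub>K\<^esub>}"
    have m: "\<phi> \<in> S \<rightarrow> carrier K" "finite ?X" using p by auto
    have "lin_ext K U S b (c \<odot>\<^bsub>free_space K S\<^esub> \<phi>) = (\<Oplus>\<^bsub>U\<^esub>s\<in>?X. (c \<odot>\<^bsub>free_space K S\<^esub> \<phi>) s \<odot>\<^bsub>U\<^esub> b s)"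
      using p by (intro lin_ext_superset) auto
    also have "\<dots> = (\<Oplus>\<^bsub>U\<^esub>s\<in>?X. c \<odot>\<^bsub>U\<^esub> (\<phi> s \<odot>\<^bsub>U\<^esub> b s))"
      using b m p(1) by (intro U.M.finsum_cong') (auto simp: U.smult_assoc1 Pi_iff)
    also have "\<dots> = c \<odot>\<^bsub>U\<^esub> lin_ext K U S b \<phi>"
      unfolding lin_ext_def using b m p(1) by (intro U.finsum_smult[symmetric]) auto
    finally show "lin_ext K U S b (c \<odot>\<^bsub>free_space K S\<^esub> \<phi>) = c \<odot>\<^bsub>U\<^esub> lin_ext K U S b \<phi>" .
  qed
qed

lemma lin_ext_gen:
  assumes "s \<in> S"
  shows "lin_ext K U S b (free_gen K S s) = b s"
proof -
  interpret U: vectorspace K U by (rule U)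
  have "lin_ext K U S b (free_gen K S s) = (\<Oplus>\<^bsub>U\<^esub>t\<in>{s}. free_gen K S s t \<odot>\<^bsub>U\<^esub> b t)"
    using assms by (intro lin_ext_superset) (auto simp: free_gen_def)
  also have "\<dots> = b s"
    using assms funcset_mem[OF b assms] by (simp add: free_gen_def U.M.finsum_insert)
  finally show ?thesis .
qed

end

section \<open>Bilinear maps and the universal property of the tensor product\<close>

definition bilin ::
  "('k, 'n) ring_scheme \<Rightarrow> ('k, 'v, 'm1) module_scheme \<Rightarrow> ('k, 'w, 'm2) module_scheme
    \<Rightarrow> ('k, 'u, 'm3) module_scheme \<Rightarrow> ('v \<Rightarrow> 'w \<Rightarrow> 'u) \<Rightarrow> bool" where
  "bilin K V W U b \<longleftrightarrow>
    (\<forall>w\<in>carrier W. (\<lambda>v. b v w) \<in> module_hom K V U) \<and>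
    (\<forall>v\<in>carrier V. b v \<in> module_hom K W U)"

lemma bilinI:
  assumes "\<And>w. w \<in> carrier W \<Longrightarrow> (\<lambda>v. b v w) \<in> module_hom K V U"
    and "\<And>v. v \<in> carrier V \<Longrightarrow> b v \<in> module_hom K W U"
  shows "bilin K V W U b"
  using assms by (simp add: bilin_def)

lemma bilinD:
  assumes "bilin K V W U b"
  shows "w \<in> carrier W \<Longrightarrow> (\<lambda>v. b v w) \<in> module_hom K V U"
    and "v \<in> carrier V \<Longrightarrow> b v \<in> module_hom K W U"
  using assms by (simp_all add: bilin_def)

locale vs_pair = V: vectorspace K V + W: vectorspace K W
  for K :: "('k, 'n) ring_scheme" and V :: "('k, 'v, 'm1) module_scheme"
    and W :: "('k, 'w, 'm2) module_scheme"
begin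

abbreviation "P \<equiv> carrier V \<times> carrier W"
abbreviation "F \<equiv> free_space K P"
abbreviation "T \<equiv> tensor_space K V W"
abbreviation "proj \<equiv> (\<lambda>\<phi>. tensor_relations K V W +>\<^bsub>F\<^esub> \<phi>)"

lemma field_K: "field K" by (rule V.field_axioms)

lemma F_vs: "vectorspace K F" by (rule free_space_vectorspace[OF field_K])

text \<open>The generating set that occurs inline in \<open>tensor_relations\<close>, named so that
  facts about spans can be applied to it.\<close>

definition relators :: "('v \<times> 'w \<Rightarrow> 'k) set" where
  "relators = (let F = free_space K (carrier V \<times> carrier W); g = free_gen K (carrier V \<times> carrier W) in
       ({g (v \<oplus>\<^bsub>V\<^esub> v', w) \<ominus>\<^bsub>F\<^esub> (g (v, w) \<oplus>\<^bsub>F\<^esub> g (v', w)) | v v' w.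
            v \<in> carrier V \<and> v' \<in> carrier V \<and> w \<in> carrier W} \<union>
        {g (v, w \<oplus>\<^bsub>W\<^esub> w') \<ominus>\<^bsub>F\<^esub> (g (v, w) \<oplus>\<^bsub>F\<^esub> g (v, w')) | v w w'.
            v \<in> carrier V \<and> w \<in> carrier W \<and> w' \<in> carrier W} \<union>
        {g (c \<odot>\<^bsub>V\<^esub> v, w) \<ominus>\<^bsub>F\<^esub> c \<odot>\<^bsub>F\<^esub> g (v, w) | c v w.
            c \<in> carrier K \<and> v \<in> carrier V \<and> w \<in> carrier W} \<union>
        {g (v, c \<odot>\<^bsub>W\<^esub> w) \<ominus>\<^bsub>F\<^esub> c \<odot>\<^bsub>F\<^esub> g (v, w) | c v w.
            c \<in> carrier K \<and> v \<in> carrier V \<and> w \<in> carrier W}))"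

lemma tensor_relations_eq: "tensor_relations K V W = module.span K F relators"
  by (simp add: tensor_relations_def relators_def Let_def)

lemma relators_closed: "relators \<subseteq> carrier F"
proof -
  interpret F: vectorspace K F by (rule F_vs)
  note [simp] = free_gen_closed[OF field_K]
  show ?thesis by (auto simp: relators_def Let_def)
qed

lemma relations_subspace: "subspace K (tensor_relations K V W) F"
  unfolding tensor_relations_eq by (rule subspace_span[OF F_vs relators_closed])

lemma T_vs: "vectorspace K T"
  unfolding tensor_space_def by (rule quotient_space_vectorspace[OF relations_subspace])

lemma proj_hom: "proj \<in> module_hom K F T"
  unfolding tensor_space_def by (rule quotient_space_proj[OF relations_subspace])

lemma T_carrier: "carrier T = proj ` carrier F"
  unfolding tensor_space_def by (rule quotient_space_carrier[OF relations_subspace])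

lemma proj_eqI:
  assumes "\<phi> \<in> carrier F" "\<psi> \<in> carrier F" "\<phi> \<ominus>\<^bsub>F\<^esub> \<psi> \<in> relators"
  shows "proj \<phi> = proj \<psi>"
proof -
  have "\<phi> \<ominus>\<^bsub>F\<^esub> \<psi> \<in> tensor_relations K V W"
    unfolding tensor_relations_eq using span_superset[OF F_vs relators_closed] assms(3) by auto
  then show ?thesis using quotient_space_eq_iff[OF relations_subspace assms(1,2)] by simp
qed

lemma tensor_proj: "tensor K V W v w = proj (free_gen K P (v, w))"
  by (simp add: tensor_def)

lemma tensor_bilin: "bilin K V W T (tensor K V W)"
proof -
  interpret F: vectorspace K F by (rule F_vs)
  note [simp] = free_gen_closed[OF field_K]
  note ph = module_hom_mem[OF proj_hom] module_hom_add[OF proj_hom, symmetric]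
    module_hom_smult[OF proj_hom, symmetric]
  have r: "free_gen K P (v \<oplus>\<^bsub>V\<^esub> v', w) \<ominus>\<^bsub>F\<^esub> (free_gen K P (v, w) \<oplus>\<^bsub>F\<^esub> free_gen K P (v', w)) \<in> relators"
    "free_gen K P (c \<odot>\<^bsub>V\<^esub> v, w) \<ominus>\<^bsub>F\<^esub> c \<odot>\<^bsub>F\<^esub> free_gen K P (v, w) \<in> relators"
    if "c \<in> carrier K" "v \<in> carrier V" "v' \<in> carrier V" "w \<in> carrier W" for c v v' w
    unfolding relators_def Let_def using that by blast+
  have r': "free_gen K P (v, w \<oplus>\<^bsub>W\<^esub> w') \<ominus>\<^bsub>F\<^esub> (free_gen K P (v, w) \<oplus>\<^bsub>F\<^esub> free_gen K P (v, w')) \<in> relators"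
    "free_gen K P (v, c \<odot>\<^bsub>W\<^esub> w) \<ominus>\<^bsub>F\<^esub> c \<odot>\<^bsub>F\<^esub> free_gen K P (v, w) \<in> relators"
    if "c \<in> carrier K" "v \<in> carrier V" "w \<in> carrier W" "w' \<in> carrier W" for c v w w'
    unfolding relators_def Let_def using that by blast+
  show ?thesis
    \<comment> \<open>Each law of bilinearity is one family of relators. The facts \<open>r\<close>
      and \<open>r'\<close> carry a scalar premise throughout; in the additive relations, where c
      does not occur, it is instantiated to one.\<close>
    by (intro bilinI module_homI; simp add: tensor_proj ph; rule proj_eqI)
       (simp_all add: r r' r(1)[OF V.R.one_closed] r'(1)[OF V.R.one_closed])
qed

lemma tensor_closed [simp]: "\<lbrakk>v \<in> carrier V; w \<in> carrier W\<rbrakk> \<Longrightarrow> tensor K V W v w \<in> carrier T"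
  using module_hom_mem[OF bilinD(2)[OF tensor_bilin]] .

text \<open>Presentations carry no coefficients and are indexed by an initial segment of the
  naturals, exactly as in the descriptions inside \<open>tensor_lift\<close> and
  \<open>finite_dual_comult\<close>.\<close>

lemma tensor_expand:
  assumes t: "t \<in> carrier T"
  obtains n :: nat and v w where "v \<in> {..<n} \<rightarrow> carrier V" "w \<in> {..<n} \<rightarrow> carrier W"
    "t = (\<Oplus>\<^bsub>T\<^esub>i\<in>{..<n}. tensor K V W (v i) (w i))"
proof -
  interpret F: vectorspace K F by (rule F_vs)
  interpret T: vectorspace K T by (rule T_vs)
  obtain \<phi> where \<phi>: "\<phi> \<in> carrier F" "t = proj \<phi>" using t by (auto simp: T_carrier)
  let ?X = "{s \<in> P. \<phi> s \<noteq> \<zero>\<^bsub>K\<^esub>}"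
  have p: "\<phi> \<in> P \<rightarrow> carrier K" "finite ?X" using \<phi>(1) by (auto simp: free_space_sel[OF field_K])
  have c: "(\<lambda>s. \<phi> s \<odot>\<^bsub>F\<^esub> free_gen K P s) \<in> ?X \<rightarrow> carrier F"
    using p by (auto intro!: F.smult_closed free_gen_closed[OF field_K])
  obtain h where h: "bij_betw h {..<card ?X} ?X"
    using ex_bij_betw_nat_finite[OF p(2)] by (auto simp: atLeast0LessThan)
  have hX: "h i \<in> ?X" if "i < card ?X" for i using h that by (auto simp: bij_betw_def)
  \<comment> \<open>The coefficient of a generator is absorbed into its first component.\<close>
  let ?v = "\<lambda>i. \<phi> (h i) \<odot>\<^bsub>V\<^esub> fst (h i)" and ?w = "\<lambda>i. snd (h i)"
  have "t = proj (\<Oplus>\<^bsub>F\<^esub>s\<in>?X. \<phi> s \<odot>\<^bsub>F\<^esub> free_gen K P s)"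
    using free_space_expand[OF field_K \<phi>(1)] \<phi>(2) by simp
  also have "\<dots> = (\<Oplus>\<^bsub>T\<^esub>s\<in>?X. proj (\<phi> s \<odot>\<^bsub>F\<^esub> free_gen K P s))"
    by (rule module_hom_finsum[OF F_vs T_vs proj_hom c])
  also have "\<dots> = (\<Oplus>\<^bsub>T\<^esub>s\<in>?X. tensor K V W (\<phi> s \<odot>\<^bsub>V\<^esub> fst s) (snd s))"
  proof (rule T.M.finsum_cong')
    show "(\<lambda>s. tensor K V W (\<phi> s \<odot>\<^bsub>V\<^esub> fst s) (snd s)) \<in> ?X \<rightarrow> carrier T"
      using p by (auto intro!: tensor_closed)
    fix s assume s: "s \<in> ?X"
    then have "proj (\<phi> s \<odot>\<^bsub>F\<^esub> free_gen K P s) = \<phi> s \<odot>\<^bsub>T\<^esub> tensor K V W (fst s) (snd s)"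
      using module_hom_smult[OF proj_hom _ free_gen_closed[OF field_K], of "\<phi> s" s] p
      by (auto simp: tensor_proj)
    also have "\<dots> = tensor K V W (\<phi> s \<odot>\<^bsub>V\<^esub> fst s) (snd s)"
      using module_hom_smult[OF bilinD(1)[OF tensor_bilin], of "snd s" "\<phi> s" "fst s"] s funcset_mem[OF p(1), of s]
      by auto
    finally show "proj (\<phi> s \<odot>\<^bsub>F\<^esub> free_gen K P s) = tensor K V W (\<phi> s \<odot>\<^bsub>V\<^esub> fst s) (snd s)" .
  qed simp
  also have "\<dots> = (\<Oplus>\<^bsub>T\<^esub>s\<in>h ` {..<card ?X}. tensor K V W (\<phi> s \<odot>\<^bsub>V\<^esub> fst s) (snd s))"
    using h by (simp add: bij_betw_def)
  also have "\<dots> = (\<Oplus>\<^bsub>T\<^esub>i\<in>{..<card ?X}. tensor K V W (?v i) (?w i))"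
    using h p hX by (intro T.M.finsum_reindex) (auto simp: bij_betw_def intro!: tensor_closed)
  finally have "t = (\<Oplus>\<^bsub>T\<^esub>i\<in>{..<card ?X}. tensor K V W (?v i) (?w i))" .
  moreover have "?v i \<in> carrier V" "?w i \<in> carrier W" if "i < card ?X" for i
    using hX[OF that] funcset_mem[OF p(1), of "h i"] by (auto simp: mem_Times_iff)
  ultimately show thesis by (intro that[of ?v "card ?X" ?w]) auto
qed

text \<open>Pure tensors generate the tensor product additively. Linear maps on tensor products are
  compared by this rule throughout.\<close>

lemma hom_eqI:
  assumes U: "vectorspace K U" and "f \<in> module_hom K T U" "g \<in> module_hom K T U"
    and eq: "\<And>v w. \<lbrakk>v \<in> carrier V; w \<in> carrier W\<rbrakk> \<Longrightarrow> f (tensor K V W v w) = g (tensor K V W v w)"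
    and t: "t \<in> carrier T"
  shows "f t = g t"
proof -
  interpret U: vectorspace K U by fact
  obtain n :: nat and v w where vw: "v \<in> {..<n} \<rightarrow> carrier V" "w \<in> {..<n} \<rightarrow> carrier W"
    and t: "t = (\<Oplus>\<^bsub>T\<^esub>i\<in>{..<n}. tensor K V W (v i) (w i))"
    using t by (rule tensor_expand)
  have c: "(\<lambda>i. tensor K V W (v i) (w i)) \<in> {..<n} \<rightarrow> carrier T"
    using vw by (auto simp: Pi_iff)
  have "f t = (\<Oplus>\<^bsub>U\<^esub>i\<in>{..<n}. f (tensor K V W (v i) (w i)))"
    unfolding t by (rule module_hom_finsum[OF T_vs U assms(2) c])
  also have "\<dots> = (\<Oplus>\<^bsub>U\<^esub>i\<in>{..<n}. g (tensor K V W (v i) (w i)))"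
    using vw by (intro U.M.finsum_cong') (auto simp: eq Pi_iff intro!: module_hom_mem[OF assms(3)] tensor_closed)
  also have "\<dots> = g t"
    unfolding t by (rule module_hom_finsum[OF T_vs U assms(3) c, symmetric])
  finally show ?thesis .
qed

context
  fixes U :: "('k, 'u, 'm3) module_scheme" and b :: "'v \<Rightarrow> 'w \<Rightarrow> 'u"
  assumes U: "vectorspace K U" and b: "bilin K V W U b"
begin

abbreviation (input) "ext \<equiv> lin_ext K U P (\<lambda>(v, w). b v w)"

lemma bP: "(\<lambda>(v, w). b v w) \<in> P \<rightarrow> carrier U"
  using module_hom_mem[OF bilinD(2)[OF b]] by auto

lemma ext_hom: "ext \<in> module_hom K F U"
  by (rule lin_ext_hom[OF U bP])

text \<open>The kernel of the linear extension is a subspace, and bilinearity of b says precisely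
  that it contains the relators.\<close>

lemma ext_relations:
  assumes "\<phi> \<in> tensor_relations K V W"
  shows "ext \<phi> = \<zero>\<^bsub>U\<^esub>"
proof -
  interpret F: vectorspace K F by (rule F_vs)
  interpret U: vectorspace K U by (rule U)
  have N: "subspace K {\<phi> \<in> carrier F. ext \<phi> \<in> {\<zero>\<^bsub>U\<^esub>}} F"
    by (rule subspace_vimage[OF F_vs U ext_hom]) (auto intro!: subspaceI[OF U])
  note e = module_hom_minus[OF F_vs U ext_hom] module_hom_add[OF ext_hom] module_hom_smult[OF ext_hom]
    lin_ext_gen[OF U bP] free_gen_closed[OF field_K] module_hom_mem[OF bilinD(2)[OF b]]
    module_hom_add[OF bilinD(1)[OF b]] module_hom_add[OF bilinD(2)[OF b]]
    module_hom_smult[OF bilinD(1)[OF b]] module_hom_smult[OF bilinD(2)[OF b]]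
  have "relators \<subseteq> {\<phi> \<in> carrier F. ext \<phi> \<in> {\<zero>\<^bsub>U\<^esub>}}"
    using relators_closed by (auto simp: relators_def Let_def e)
  from span_least[OF N this] show ?thesis using assms unfolding tensor_relations_eq by auto
qed

text \<open>A presentation of the coset of \<phi> lifts to a sum of generators in the free space
  that differs from \<phi> by a relation, on which the extension vanishes. Hence every presentation
  gives the same value, and the description in \<open>tensor_lift\<close> denotes it.\<close>

lemma tensor_lift_proj:
  assumes \<phi>: "\<phi> \<in> carrier F"
  shows "tensor_lift K V W U b (proj \<phi>) = ext \<phi>"
proof -
  interpret F: vectorspace K F by (rule F_vs)
  interpret U: vectorspace K U by (rule U)
  interpret T: vectorspace K T by (rule T_vs)
  have uniq: "(\<Oplus>\<^bsub>U\<^esub>i\<in>{..<n}. b (v i) (w i)) = ext \<phi>"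
    if v: "v \<in> {..<n} \<rightarrow> carrier V" and w: "w \<in> {..<n} \<rightarrow> carrier W"
      and t: "proj \<phi> = (\<Oplus>\<^bsub>T\<^esub>i\<in>{..<n}. tensor K V W (v i) (w i))" for n :: nat and v w
  proof -
    let ?\<psi> = "(\<Oplus>\<^bsub>F\<^esub>i\<in>{..<n}. free_gen K P (v i, w i))"
    have g: "(\<lambda>i. free_gen K P (v i, w i)) \<in> {..<n} \<rightarrow> carrier F"
      using v w by (auto intro!: free_gen_closed[OF field_K])
    then have \<psi>: "?\<psi> \<in> carrier F" by (rule F.M.finsum_closed)
    have "proj ?\<psi> = proj \<phi>"
      unfolding t tensor_proj by (rule module_hom_finsum[OF F_vs T_vs proj_hom g])
    then have "?\<psi> \<ominus>\<^bsub>F\<^esub> \<phi> \<in> tensor_relations K V W"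
      using quotient_space_eq_iff[OF relations_subspace \<psi> \<phi>] by simp
    from ext_relations[OF this] have "ext ?\<psi> = ext \<phi>"
      using module_hom_mem[OF ext_hom \<psi>] module_hom_mem[OF ext_hom \<phi>]
      by (simp add: module_hom_minus[OF F_vs U ext_hom \<psi> \<phi>])
    moreover have "ext ?\<psi> = (\<Oplus>\<^bsub>U\<^esub>i\<in>{..<n}. ext (free_gen K P (v i, w i)))"
      by (rule module_hom_finsum[OF F_vs U ext_hom g])
    moreover have "\<dots> = (\<Oplus>\<^bsub>U\<^esub>i\<in>{..<n}. b (v i) (w i))"
      using v w by (intro U.M.finsum_cong')
        (auto simp: lin_ext_gen[OF U bP] Pi_iff intro!: module_hom_mem[OF bilinD(2)[OF b]])
    ultimately show ?thesis by simp
  qed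
  have "proj \<phi> \<in> carrier T" using \<phi> by (simp add: T_carrier)
  then obtain n :: nat and v w where vw: "v \<in> {..<n} \<rightarrow> carrier V" "w \<in> {..<n} \<rightarrow> carrier W"
    "proj \<phi> = (\<Oplus>\<^bsub>T\<^esub>i\<in>{..<n}. tensor K V W (v i) (w i))" by (rule tensor_expand)
  show ?thesis unfolding tensor_lift_def
  proof (rule the_equality)
    show "\<exists>(n::nat) v w. v \<in> {..<n} \<rightarrow> carrier V \<and> w \<in> {..<n} \<rightarrow> carrier W \<and>
      proj \<phi> = (\<Oplus>\<^bsub>T\<^esub>i\<in>{..<n}. tensor K V W (v i) (w i)) \<and> ext \<phi> = (\<Oplus>\<^bsub>U\<^esub>i\<in>{..<n}. b (v i) (w i))"
      by (intro exI conjI) (rule vw, rule vw, rule vw, rule uniq[OF vw, symmetric])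
  qed (elim exE conjE, simp only: uniq)
qed

lemma tensor_lift_hom: "tensor_lift K V W U b \<in> module_hom K T U"
proof (rule module_homI)
  interpret F: vectorspace K F by (rule F_vs)
  note ph = module_hom_add[OF proj_hom, symmetric] module_hom_smult[OF proj_hom, symmetric]
  note eh = module_hom_add[OF ext_hom] module_hom_smult[OF ext_hom]
  show "tensor_lift K V W U b t \<in> carrier U" if "t \<in> carrier T" for t
    using that module_hom_mem[OF ext_hom] by (auto simp: T_carrier tensor_lift_proj)
  show "tensor_lift K V W U b (s \<oplus>\<^bsub>T\<^esub> t) = tensor_lift K V W U b s \<oplus>\<^bsub>U\<^esub> tensor_lift K V W U b t"
    if "s \<in> carrier T" "t \<in> carrier T" for s t
    using that by (auto simp: T_carrier tensor_lift_proj ph eh)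
  show "tensor_lift K V W U b (c \<odot>\<^bsub>T\<^esub> t) = c \<odot>\<^bsub>U\<^esub> tensor_lift K V W U b t"
    if "c \<in> carrier K" "t \<in> carrier T" for c t
    using that by (auto simp: T_carrier tensor_lift_proj ph eh)
qed

lemma tensor_lift_tensor:
  assumes "v \<in> carrier V" "w \<in> carrier W"
  shows "tensor_lift K V W U b (tensor K V W v w) = b v w"
  using assms by (simp add: tensor_proj tensor_lift_proj free_gen_closed[OF field_K] lin_ext_gen[OF U bP])

end

end

lemma vs_pairI: "\<lbrakk>vectorspace K V; vectorspace K W\<rbrakk> \<Longrightarrow> vs_pair K V W"
  by (simp add: vs_pair_def)

lemma bilin_comp:
  assumes "bilin K V W U b" "f \<in> module_hom K V' V" "g \<in> module_hom K W' W"
  shows "bilin K V' W' U (\<lambda>v w. b (f v) (g w))"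
proof (rule bilinI)
  show "(\<lambda>v. b (f v) (g w)) \<in> module_hom K V' U" if "w \<in> carrier W'" for w
    by (rule module_hom_comp[OF assms(2) bilinD(1)[OF assms(1) module_hom_mem[OF assms(3) that]]])
  show "(\<lambda>w. b (f v) (g w)) \<in> module_hom K W' U" if "v \<in> carrier V'" for v
    by (rule module_hom_comp[OF assms(3) bilinD(2)[OF assms(1) module_hom_mem[OF assms(2) that]]])
qed

text \<open>Lifting this bilinear map contracts the second tensor factor against g. The evaluations
  at elements of A and the map in the counit axiom for comodules are of this kind.\<close>

lemma functional_bilin:
  assumes "vectorspace K V" "g \<in> module_hom K W (base_space K)"
  shows "bilin K V W V (\<lambda>v w. g w \<odot>\<^bsub>V\<^esub> v)"
proof -
  interpret V: vectorspace K V by fact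
  note [simp] = module_hom_mem[OF assms(2), simplified] module_hom_add[OF assms(2), simplified]
    module_hom_smult[OF assms(2), simplified]
  show ?thesis
    by (intro bilinI module_homI)
      (auto simp: V.smult_l_distr V.smult_r_distr V.smult_assoc1[symmetric] V.R.m_comm)
qed

section \<open>Separating the points of a tensor product\<close>

context vs_pair
begin

text \<open>The last summand is distributed over the others by moving each c_i across. It is stated
  for an arbitrary bilinear b because the shortening must be performed both on the tensors and on
  their contractions.\<close>

lemma bilin_sum_absorb:
  assumes U: "vectorspace K U" and b: "bilin K V W U b"
    and v: "v \<in> {..n} \<rightarrow> carrier V" and w: "w \<in> {..n} \<rightarrow> carrier W" and c: "c \<in> {..<n} \<rightarrow> carrier K"
    and vn: "v n = (\<Oplus>\<^bsub>V\<^esub>i\<in>{..<n::nat}. c i \<odot>\<^bsub>V\<^esub> v i)"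
  shows "(\<Oplus>\<^bsub>U\<^esub>i\<in>{..<Suc n}. b (v i) (w i)) = (\<Oplus>\<^bsub>U\<^esub>i\<in>{..<n}. b (v i) (w i \<oplus>\<^bsub>W\<^esub> c i \<odot>\<^bsub>W\<^esub> w n))"
proof -
  interpret U: vectorspace K U by fact
  have V: "vectorspace K V" by (rule V.vectorspace_axioms)
  have cl: "v i \<in> carrier V" "w i \<in> carrier W" if "i \<le> n" for i using v w that by auto
  have ck: "c i \<in> carrier K" if "i < n" for i using c that by auto
  have bc: "b x y \<in> carrier U" if "x \<in> carrier V" "y \<in> carrier W" for x y
    using module_hom_mem[OF bilinD(2)[OF b]] that by blast
  have "b (v n) (w n) = (\<Oplus>\<^bsub>U\<^esub>i\<in>{..<n}. b (c i \<odot>\<^bsub>V\<^esub> v i) (w n))"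
    unfolding vn using cl ck
    by (intro module_hom_finsum[OF V U bilinD(1)[OF b]]) auto
  also have "\<dots> = (\<Oplus>\<^bsub>U\<^esub>i\<in>{..<n}. b (v i) (c i \<odot>\<^bsub>W\<^esub> w n))"
    using cl ck by (intro U.M.finsum_cong')
      (auto simp: module_hom_smult[OF bilinD(1)[OF b]] module_hom_smult[OF bilinD(2)[OF b]] bc)
  finally have 1: "b (v n) (w n) = (\<Oplus>\<^bsub>U\<^esub>i\<in>{..<n}. b (v i) (c i \<odot>\<^bsub>W\<^esub> w n))" .
  have "(\<Oplus>\<^bsub>U\<^esub>i\<in>{..<Suc n}. b (v i) (w i)) = b (v n) (w n) \<oplus>\<^bsub>U\<^esub> (\<Oplus>\<^bsub>U\<^esub>i\<in>{..<n}. b (v i) (w i))"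
    unfolding lessThan_Suc using cl by (intro U.M.finsum_insert) (auto simp: bc)
  also have "\<dots> = (\<Oplus>\<^bsub>U\<^esub>i\<in>{..<n}. b (v i) (c i \<odot>\<^bsub>W\<^esub> w n) \<oplus>\<^bsub>U\<^esub> b (v i) (w i))"
    unfolding 1 using cl ck by (intro U.M.finsum_addf[symmetric]) (auto simp: bc)
  also have "\<dots> = (\<Oplus>\<^bsub>U\<^esub>i\<in>{..<n}. b (v i) (w i \<oplus>\<^bsub>W\<^esub> c i \<odot>\<^bsub>W\<^esub> w n))"
    using cl ck by (intro U.M.finsum_cong') (auto simp: bc module_hom_add[OF bilinD(2)[OF b]] U.M.a_comm)
  finally show ?thesis .
qed

text \<open>
  Induction on the length of a presentation \<open>\<Sum>\<^sub>i v\<^sub>i \<otimes> w\<^sub>i\<close>: if the last \<open>v\<^sub>n\<close> is a combination of the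
  others, the presentation can be shortened; otherwise no functional in the family sees \<open>w\<^sub>n\<close>, so
  \<open>w\<^sub>n = 0\<close>.
\<close>

lemma tensor_separation_aux:
  assumes x: "\<And>s. s \<in> S \<Longrightarrow> x s \<in> module_hom K W (base_space K)"
    and sep: "\<And>w. \<lbrakk>w \<in> carrier W; \<And>s. s \<in> S \<Longrightarrow> x s w = \<zero>\<^bsub>K\<^esub>\<rbrakk> \<Longrightarrow> w = \<zero>\<^bsub>W\<^esub>"
    and "v \<in> {..<n::nat} \<rightarrow> carrier V" "w \<in> {..<n} \<rightarrow> carrier W"
    and "\<And>s. s \<in> S \<Longrightarrow> (\<Oplus>\<^bsub>V\<^esub>i\<in>{..<n}. x s (w i) \<odot>\<^bsub>V\<^esub> v i) = \<zero>\<^bsub>V\<^esub>"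
  shows "(\<Oplus>\<^bsub>T\<^esub>i\<in>{..<n}. tensor K V W (v i) (w i)) = \<zero>\<^bsub>T\<^esub>"
  using assms(3-5)
proof (induction n arbitrary: w)
  case 0
  interpret T: vectorspace K T by (rule T_vs)
  show ?case by (simp add: T.M.finsum_empty)
next
  case (Suc n)
  interpret T: vectorspace K T by (rule T_vs)
  have V: "vectorspace K V" by (rule V.vectorspace_axioms)
  have cl: "v i \<in> carrier V" "w i \<in> carrier W" if "i \<le> n" for i using Suc.prems(1,2) that by auto
  have xc: "x s u \<in> carrier K" if "s \<in> S" "u \<in> carrier W" for s u
    using module_hom_mem[OF x[OF that(1)] that(2)] by simp
  show ?case
  proof (cases "\<exists>c. c \<in> {..<n} \<rightarrow> carrier K \<and> v n = (\<Oplus>\<^bsub>V\<^esub>i\<in>{..<n}. c i \<odot>\<^bsub>V\<^esub> v i)")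
    case True
    then obtain c where c: "c \<in> {..<n} \<rightarrow> carrier K" "v n = (\<Oplus>\<^bsub>V\<^esub>i\<in>{..<n}. c i \<odot>\<^bsub>V\<^esub> v i)" by blast
    have vw: "v \<in> {..n} \<rightarrow> carrier V" "w \<in> {..n} \<rightarrow> carrier W" using cl by auto
    let ?w = "\<lambda>i. w i \<oplus>\<^bsub>W\<^esub> c i \<odot>\<^bsub>W\<^esub> w n"
    have "(\<Oplus>\<^bsub>V\<^esub>i\<in>{..<n}. x s (?w i) \<odot>\<^bsub>V\<^esub> v i) = \<zero>\<^bsub>V\<^esub>" if "s \<in> S" for s
      using bilin_sum_absorb[OF V functional_bilin[OF V x[OF that]] vw c] Suc.prems(3)[OF that] by simp
    moreover have "?w \<in> {..<n} \<rightarrow> carrier W" using cl c(1) by (auto simp: Pi_iff)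
    ultimately have "(\<Oplus>\<^bsub>T\<^esub>i\<in>{..<n}. tensor K V W (v i) (?w i)) = \<zero>\<^bsub>T\<^esub>"
      using cl by (intro Suc.IH) auto
    then show ?thesis using bilin_sum_absorb[OF T_vs tensor_bilin vw c] by simp
  next
    case False
    have ins: "(\<Oplus>\<^bsub>V\<^esub>i\<in>{..<Suc n}. x s (w i) \<odot>\<^bsub>V\<^esub> v i) =
      x s (w n) \<odot>\<^bsub>V\<^esub> v n \<oplus>\<^bsub>V\<^esub> (\<Oplus>\<^bsub>V\<^esub>i\<in>{..<n}. x s (w i) \<odot>\<^bsub>V\<^esub> v i)" if s: "s \<in> S" for s
      unfolding lessThan_Suc using cl xc[OF s] by (intro V.M.finsum_insert) auto
    have fc: "(\<lambda>i. x s (w i) \<odot>\<^bsub>V\<^esub> v i) \<in> {..<n} \<rightarrow> carrier V" if s: "s \<in> S" for s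
      using cl xc[OF s] by auto
    have zero: "x s (w n) = \<zero>\<^bsub>K\<^esub>" if s: "s \<in> S" for s
    proof (rule ccontr)
      assume nz: "x s (w n) \<noteq> \<zero>\<^bsub>K\<^esub>"
      let ?S = "\<Oplus>\<^bsub>V\<^esub>i\<in>{..<n}. x s (w i) \<odot>\<^bsub>V\<^esub> v i"
      \<comment> \<open>With k = -1 / x_s(w_n) the vanishing sum can be solved for v_n, which would
        make v_n a combination of the earlier vectors.\<close>
      define k where "k = \<ominus>\<^bsub>K\<^esub> (inv\<^bsub>K\<^esub> (x s (w n)))"
      have xn: "x s (w n) \<in> carrier K" using xc[OF s] cl by auto
      then have iv: "inv\<^bsub>K\<^esub> (x s (w n)) \<in> carrier K" "inv\<^bsub>K\<^esub> (x s (w n)) \<otimes>\<^bsub>K\<^esub> x s (w n) = \<one>\<^bsub>K\<^esub>"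
        using nz V.field_Units by auto
      have k: "k \<in> carrier K" using iv by (simp add: k_def)
      have Sc: "?S \<in> carrier V" by (rule V.M.finsum_closed[OF fc[OF s]])
      have "x s (w n) \<odot>\<^bsub>V\<^esub> v n = \<ominus>\<^bsub>V\<^esub> ?S"
        using ins[OF s] Suc.prems(3)[OF s] Sc xn cl by (intro V.M.minus_equality[symmetric]) auto
      then have "inv\<^bsub>K\<^esub> (x s (w n)) \<odot>\<^bsub>V\<^esub> (x s (w n) \<odot>\<^bsub>V\<^esub> v n) = inv\<^bsub>K\<^esub> (x s (w n)) \<odot>\<^bsub>V\<^esub> (\<ominus>\<^bsub>V\<^esub> ?S)"
        by simp
      then have "v n = k \<odot>\<^bsub>V\<^esub> ?S"
        using iv xn cl Sc by (simp add: V.smult_assoc1[symmetric] k_def V.smult_l_minus V.smult_r_minus)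
      also have "\<dots> = (\<Oplus>\<^bsub>V\<^esub>i\<in>{..<n}. k \<odot>\<^bsub>V\<^esub> (x s (w i) \<odot>\<^bsub>V\<^esub> v i))"
        by (rule V.finsum_smult[OF k fc[OF s]])
      also have "\<dots> = (\<Oplus>\<^bsub>V\<^esub>i\<in>{..<n}. (k \<otimes>\<^bsub>K\<^esub> x s (w i)) \<odot>\<^bsub>V\<^esub> v i)"
        using k cl xc[OF s] by (intro V.M.finsum_cong') (auto simp: V.smult_assoc1)
      finally have "v n = (\<Oplus>\<^bsub>V\<^esub>i\<in>{..<n}. (k \<otimes>\<^bsub>K\<^esub> x s (w i)) \<odot>\<^bsub>V\<^esub> v i)" .
      moreover have "(\<lambda>i. k \<otimes>\<^bsub>K\<^esub> x s (w i)) \<in> {..<n} \<rightarrow> carrier K" using k cl xc[OF s] by auto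
      ultimately show False using False by blast
    qed
    then have wn: "w n = \<zero>\<^bsub>W\<^esub>" using sep cl by blast
    have "(\<Oplus>\<^bsub>V\<^esub>i\<in>{..<n}. x s (w i) \<odot>\<^bsub>V\<^esub> v i) = \<zero>\<^bsub>V\<^esub>" if s: "s \<in> S" for s
      using ins[OF s] Suc.prems(3)[OF s] zero[OF s] cl V.M.finsum_closed[OF fc[OF s]] by simp
    then have IH: "(\<Oplus>\<^bsub>T\<^esub>i\<in>{..<n}. tensor K V W (v i) (w i)) = \<zero>\<^bsub>T\<^esub>"
      using cl by (intro Suc.IH) auto
    have "tensor K V W (v n) (w n) = \<zero>\<^bsub>T\<^esub>"
      unfolding wn using cl
      by (intro module_hom_zero[OF W.vectorspace_axioms T_vs bilinD(2)[OF tensor_bilin]]) auto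
    moreover have "(\<Oplus>\<^bsub>T\<^esub>i\<in>{..<Suc n}. tensor K V W (v i) (w i)) =
      tensor K V W (v n) (w n) \<oplus>\<^bsub>T\<^esub> (\<Oplus>\<^bsub>T\<^esub>i\<in>{..<n}. tensor K V W (v i) (w i))"
      unfolding lessThan_Suc using cl by (intro T.M.finsum_insert) auto
    ultimately show ?thesis using IH by simp
  qed
qed

text \<open>The previous induction is applied to a presentation of t - u. The index set S will be A
  for evaluations of one factor and A \<times> A for evaluations of two.\<close>

lemma tensor_separation:
  assumes x: "\<And>s. s \<in> S \<Longrightarrow> x s \<in> module_hom K W (base_space K)"
    and sep: "\<And>w. \<lbrakk>w \<in> carrier W; \<And>s. s \<in> S \<Longrightarrow> x s w = \<zero>\<^bsub>K\<^esub>\<rbrakk> \<Longrightarrow> w = \<zero>\<^bsub>W\<^esub>"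
    and t: "t \<in> carrier T" and u: "u \<in> carrier T"
    and eq: "\<And>s. s \<in> S \<Longrightarrow> tensor_lift K V W V (\<lambda>v w. x s w \<odot>\<^bsub>V\<^esub> v) t =
      tensor_lift K V W V (\<lambda>v w. x s w \<odot>\<^bsub>V\<^esub> v) u"
  shows "t = u"
proof -
  interpret T: vectorspace K T by (rule T_vs)
  have V: "vectorspace K V" by (rule V.vectorspace_axioms)
  have "t \<ominus>\<^bsub>T\<^esub> u \<in> carrier T" using t u by simp
  then obtain n :: nat and v w where vw: "v \<in> {..<n} \<rightarrow> carrier V" "w \<in> {..<n} \<rightarrow> carrier W"
    and d: "t \<ominus>\<^bsub>T\<^esub> u = (\<Oplus>\<^bsub>T\<^esub>i\<in>{..<n}. tensor K V W (v i) (w i))"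
    by (rule tensor_expand)
  have tc: "(\<lambda>i. tensor K V W (v i) (w i)) \<in> {..<n} \<rightarrow> carrier T" using vw by (auto simp: Pi_iff)
  have z: "\<And>s. s \<in> S \<Longrightarrow> (\<Oplus>\<^bsub>V\<^esub>i\<in>{..<n}. x s (w i) \<odot>\<^bsub>V\<^esub> v i) = \<zero>\<^bsub>V\<^esub>"
  proof -
    fix s assume s: "s \<in> S"
    let ?l = "tensor_lift K V W V (\<lambda>v w. x s w \<odot>\<^bsub>V\<^esub> v)"
    note b = functional_bilin[OF V x[OF s]]
    note h = tensor_lift_hom[OF V b]
    have "?l (t \<ominus>\<^bsub>T\<^esub> u) = (\<Oplus>\<^bsub>V\<^esub>i\<in>{..<n}. ?l (tensor K V W (v i) (w i)))"
      unfolding d by (rule module_hom_finsum[OF T_vs V h tc])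
    also have "\<dots> = (\<Oplus>\<^bsub>V\<^esub>i\<in>{..<n}. x s (w i) \<odot>\<^bsub>V\<^esub> v i)"
      using vw module_hom_mem[OF x[OF s]]
      by (intro V.M.finsum_cong') (auto simp: tensor_lift_tensor[OF V b] Pi_iff)
    finally have "(\<Oplus>\<^bsub>V\<^esub>i\<in>{..<n}. x s (w i) \<odot>\<^bsub>V\<^esub> v i) = ?l t \<ominus>\<^bsub>V\<^esub> ?l u"
      using module_hom_minus[OF T_vs V h t u] by simp
    also have "\<dots> = \<zero>\<^bsub>V\<^esub>" using eq[OF s] module_hom_mem[OF h u] module_hom_mem[OF h t] by simp
    finally show "(\<Oplus>\<^bsub>V\<^esub>i\<in>{..<n}. x s (w i) \<odot>\<^bsub>V\<^esub> v i) = \<zero>\<^bsub>V\<^esub>" .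
  qed
  have "t \<ominus>\<^bsub>T\<^esub> u = \<zero>\<^bsub>T\<^esub>"
    unfolding d
    by (rule tensor_separation_aux[where x = x and S = S], fact x, fact sep, fact vw(1), fact vw(2), fact z)
  then show "t = u" using t u by simp
qed

end

section \<open>The finite dual\<close>

lemma vectorspace_record_cong:
  assumes "vectorspace K V" "carrier W = carrier V" "zero W = zero V" "add W = add V" "smult W = smult V"
  shows "vectorspace K W"
  by (rule vectorspace_image(1)[OF assms(1), of W id]) (simp_all add: assms)

lemma tensor_relations_cong:
  assumes "carrier V' = carrier V" "add V' = add V" "smult V' = smult V"
    and "carrier W' = carrier W" "add W' = add W" "smult W' = smult W"
  shows "tensor_relations K V' W' = tensor_relations K V W"
  by (simp add: tensor_relations_def assms)

text \<open>Tensor spaces see only carrier, addition and scalar multiplication. This identifies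
  those over records of different types: \<open>finite_dual_space\<close> and the coalgebra
  \<open>finite_dual\<close>, or a comodule and the module made from it.\<close>

lemma tensor_space_cong:
  assumes "carrier V' = carrier V" "add V' = add V" "smult V' = smult V"
    and "carrier W' = carrier W" "add W' = add W" "smult W' = smult W"
  shows "tensor_space K V' W' = tensor_space K V W" "tensor K V' W' = tensor K V W"
  by (simp_all add: tensor_space_def tensor_def fun_eq_iff tensor_relations_cong[OF assms]
    assms(1) assms(4))

context enough_idempotents
begin

abbreviation C :: "('k, 'a \<Rightarrow> 'k) coalgebra" where "C \<equiv> finite_dual K A R e"

lemma A_vs: "vectorspace K A" by (rule A.vectorspace_axioms)
lemma field_K: "field K" by (rule A.field_axioms)
lemma base_vs: "vectorspace K (base_space K)" by (rule base_space_vectorspace[OF field_K])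

lemma C_sel:
  "carrier C = {f \<in> module_hom K A (base_space K) \<inter> extensional (carrier A).
     \<exists>I. two_sided_ideal K A I \<and> vectorspace.fin_dim K (quotient_space A I) \<and>
         I \<subseteq> {x \<in> carrier A. f x = \<zero>\<^bsub>K\<^esub>}}"
  "\<zero>\<^bsub>C\<^esub> = (\<lambda>x\<in>carrier A. \<zero>\<^bsub>K\<^esub>)"
  "f \<oplus>\<^bsub>C\<^esub> g = (\<lambda>x\<in>carrier A. f x \<oplus>\<^bsub>K\<^esub> g x)"
  "c \<odot>\<^bsub>C\<^esub> f = (\<lambda>x\<in>carrier A. c \<otimes>\<^bsub>K\<^esub> f x)"
  by (simp_all add: finite_dual_def finite_dual_space_def dual_space_def A.func_space_def Let_def)

lemma two_sided_idealD:
  assumes "two_sided_ideal K A I"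
  shows "subspace K I A" "I \<subseteq> carrier A" "\<And>a x. \<lbrakk>a \<in> carrier A; x \<in> I\<rbrakk> \<Longrightarrow> a \<otimes>\<^bsub>A\<^esub> x \<in> I"
    "\<And>a x. \<lbrakk>a \<in> carrier A; x \<in> I\<rbrakk> \<Longrightarrow> x \<otimes>\<^bsub>A\<^esub> a \<in> I"
  using assms by (auto simp: two_sided_ideal_def dest: subspaceD(2))

lemma C_memI:
  assumes "f \<in> module_hom K A (base_space K)" "f \<in> extensional (carrier A)"
    and "two_sided_ideal K A I" "vectorspace.fin_dim K (quotient_space A I)"
    and "\<And>x. x \<in> I \<Longrightarrow> f x = \<zero>\<^bsub>K\<^esub>"
  shows "f \<in> carrier C"
  using assms two_sided_idealD(2)[OF assms(3)] by (auto simp: C_sel)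

lemma C_memE:
  assumes "f \<in> carrier C"
  obtains I where "two_sided_ideal K A I" "vectorspace.fin_dim K (quotient_space A I)"
    "\<forall>x\<in>I. f x = \<zero>\<^bsub>K\<^esub>"
proof -
  from assms obtain I where I: "two_sided_ideal K A I" "vectorspace.fin_dim K (quotient_space A I)"
    "I \<subseteq> {x \<in> carrier A. f x = \<zero>\<^bsub>K\<^esub>}" by (auto simp: C_sel(1))
  show thesis by (rule that[OF I(1,2)]) (use I(3) in auto)
qed

lemma C_hom: "f \<in> carrier C \<Longrightarrow> f \<in> module_hom K A (base_space K)"
  by (simp add: C_sel)

lemma C_apply [simp]:
  assumes "f \<in> carrier C"
  shows "x \<in> carrier A \<Longrightarrow> f x \<in> carrier K"
    "\<lbrakk>x \<in> carrier A; y \<in> carrier A\<rbrakk> \<Longrightarrow> f (x \<oplus>\<^bsub>A\<^esub> y) = f x \<oplus>\<^bsub>K\<^esub> f y"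
    "\<lbrakk>c \<in> carrier K; x \<in> carrier A\<rbrakk> \<Longrightarrow> f (c \<odot>\<^bsub>A\<^esub> x) = c \<otimes>\<^bsub>K\<^esub> f x"
  using module_hom_mem[OF C_hom[OF assms]] module_hom_add[OF C_hom[OF assms]]
    module_hom_smult[OF C_hom[OF assms]] by auto

lemma C_eqI:
  assumes "f \<in> carrier C" "g \<in> carrier C" "\<And>x. x \<in> carrier A \<Longrightarrow> f x = g x"
  shows "f = g"
  using assms by (intro extensionalityI[of f "carrier A" g]) (auto simp: C_sel)

text \<open>If I and J contain the common kernels of finite sets G and H of functionals, the
  intersection contains that of G \<union> H. This is needed for the sum of two elements of A^0,
  whose kernels contain different ideals.\<close>

lemma ideal_Int:
  assumes I: "two_sided_ideal K A I" "vectorspace.fin_dim K (quotient_space A I)"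
    and J: "two_sided_ideal K A J" "vectorspace.fin_dim K (quotient_space A J)"
  shows "two_sided_ideal K A (I \<inter> J)" "vectorspace.fin_dim K (quotient_space A (I \<inter> J))"
proof -
  note Is = two_sided_idealD[OF I(1)] and Js = two_sided_idealD[OF J(1)]
  have s: "subspace K (I \<inter> J) A"
    using subspaceD[OF Is(1)] subspaceD[OF Js(1)] by (intro subspaceI) auto
  show "two_sided_ideal K A (I \<inter> J)"
    using s Is Js by (auto simp: two_sided_ideal_def)
  obtain G where G: "finite G" "G \<subseteq> module_hom K A (base_space K)"
    and GI: "\<forall>v\<in>carrier A. (\<forall>g\<in>G. g v = \<zero>\<^bsub>K\<^esub>) \<longrightarrow> v \<in> I"
    using I(2) unfolding fin_codim_iff[OF Is(1)] by (elim exE conjE)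
  obtain H where H: "finite H" "H \<subseteq> module_hom K A (base_space K)"
    and HJ: "\<forall>v\<in>carrier A. (\<forall>g\<in>H. g v = \<zero>\<^bsub>K\<^esub>) \<longrightarrow> v \<in> J"
    using J(2) unfolding fin_codim_iff[OF Js(1)] by (elim exE conjE)
  show "vectorspace.fin_dim K (quotient_space A (I \<inter> J))"
    unfolding fin_codim_iff[OF s]
  proof (intro exI conjI ballI impI)
    show "finite (G \<union> H)" "G \<union> H \<subseteq> module_hom K A (base_space K)" using G H by auto
    show "v \<in> I \<inter> J" if "v \<in> carrier A" "\<forall>g\<in>G \<union> H. g v = \<zero>\<^bsub>K\<^esub>" for v
      using GI HJ that by simp
  qed
qed

lemma ideal_carrier:
  "two_sided_ideal K A (carrier A)" "vectorspace.fin_dim K (quotient_space A (carrier A))"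
proof -
  have s: "subspace K (carrier A) A" by (rule subspaceI[OF A_vs]) auto
  then show "two_sided_ideal K A (carrier A)" by (simp add: two_sided_ideal_def mult_closed)
  show "vectorspace.fin_dim K (quotient_space A (carrier A))"
    unfolding fin_codim_iff[OF s] by (intro exI[of _ "{}"]) auto
qed

lemma C_closed:
  shows "\<zero>\<^bsub>C\<^esub> \<in> carrier C"
    and "\<lbrakk>f \<in> carrier C; g \<in> carrier C\<rbrakk> \<Longrightarrow> f \<oplus>\<^bsub>C\<^esub> g \<in> carrier C"
    and "\<lbrakk>c \<in> carrier K; f \<in> carrier C\<rbrakk> \<Longrightarrow> c \<odot>\<^bsub>C\<^esub> f \<in> carrier C"
proof -
  show "\<zero>\<^bsub>C\<^esub> \<in> carrier C"
  proof (rule C_memI[OF _ _ ideal_carrier])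
    show "\<zero>\<^bsub>C\<^esub> \<in> module_hom K A (base_space K)" by (rule module_homI) (auto simp: C_sel)
  qed (auto simp: C_sel)
  show "f \<oplus>\<^bsub>C\<^esub> g \<in> carrier C" if f: "f \<in> carrier C" and g: "g \<in> carrier C"
  proof -
    obtain I where I: "two_sided_ideal K A I" "vectorspace.fin_dim K (quotient_space A I)"
      "\<forall>x\<in>I. f x = \<zero>\<^bsub>K\<^esub>" using f by (rule C_memE)
    obtain J where J: "two_sided_ideal K A J" "vectorspace.fin_dim K (quotient_space A J)"
      "\<forall>x\<in>J. g x = \<zero>\<^bsub>K\<^esub>" using g by (rule C_memE)
    show ?thesis
    proof (rule C_memI[OF _ _ ideal_Int[OF I(1,2) J(1,2)]])
      show "f \<oplus>\<^bsub>C\<^esub> g \<in> module_hom K A (base_space K)"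
        by (rule module_hom_cong[OF module_hom_plus[OF base_vs C_hom[OF f] C_hom[OF g]] A_vs]) (simp add: C_sel(3))
      show "(f \<oplus>\<^bsub>C\<^esub> g) x = \<zero>\<^bsub>K\<^esub>" if "x \<in> I \<inter> J" for x
        using that I(3) J(3) two_sided_idealD(2)[OF I(1)] by (auto simp: C_sel(3))
    qed (simp add: C_sel(3))
  qed
  show "c \<odot>\<^bsub>C\<^esub> f \<in> carrier C" if c: "c \<in> carrier K" and f: "f \<in> carrier C"
  proof -
    obtain I where I: "two_sided_ideal K A I" "vectorspace.fin_dim K (quotient_space A I)"
      "\<forall>x\<in>I. f x = \<zero>\<^bsub>K\<^esub>" using f by (rule C_memE)
    show ?thesis
    proof (rule C_memI[OF _ _ I(1,2)])
      show "c \<odot>\<^bsub>C\<^esub> f \<in> module_hom K A (base_space K)"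
        by (rule module_hom_cong[OF module_hom_scale[OF base_vs C_hom[OF f] c] A_vs]) (simp add: C_sel(4))
      show "(c \<odot>\<^bsub>C\<^esub> f) x = \<zero>\<^bsub>K\<^esub>" if "x \<in> I" for x
        using that I(3) c two_sided_idealD(2)[OF I(1)] by (auto simp: C_sel(4))
    qed (simp add: C_sel(4))
  qed
qed

lemma C_vs: "vectorspace K C"
proof -
  have "subspace K (carrier C) (A.func_space (carrier A))"
  proof (rule subspaceI[OF func_space_vectorspace[OF field_K]])
    show "carrier C \<subseteq> carrier (A.func_space (carrier A))"
    proof
      fix f assume f: "f \<in> carrier C"
      then have "f \<in> extensional (carrier A)" by (simp add: C_sel(1))
      then have "f \<in> carrier A \<rightarrow>\<^sub>E carrier K" using C_apply(1)[OF f] by (simp add: PiE_iff)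
      then show "f \<in> carrier (A.func_space (carrier A))" by (simp add: A.func_space_def)
    qed
  qed (use C_closed in \<open>simp_all add: A.func_space_def C_sel(2-4)\<close>)
  from subspace_vectorspace[OF this] show ?thesis
    by (rule vectorspace_record_cong)
      (simp_all add: A.func_space_def C_sel(2) finite_dual_def finite_dual_space_def dual_space_def Let_def)
qed

section \<open>Evaluating the second tensor factor\<close>

lemma eval_hom: "a \<in> carrier A \<Longrightarrow> (\<lambda>f. f a) \<in> module_hom K C (base_space K)"
  by (rule module_homI) (auto simp: C_sel(2-4))

definition ev :: "('k, 'v, 'm) module_scheme \<Rightarrow> 'a \<Rightarrow> ('v \<times> ('a \<Rightarrow> 'k) \<Rightarrow> 'k) set \<Rightarrow> 'v" where
  "ev M a = tensor_lift K M C M (\<lambda>m f. f a \<odot>\<^bsub>M\<^esub> m)"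

lemma pair_C: "vectorspace K M \<Longrightarrow> vs_pair K M C"
  by (rule vs_pairI[OF _ C_vs])

lemma ev_hom:
  assumes "vectorspace K M" "a \<in> carrier A"
  shows "ev M a \<in> module_hom K (tensor_space K M C) M"
  unfolding ev_def
  by (rule vs_pair.tensor_lift_hom[OF pair_C[OF assms(1)] assms(1) functional_bilin[OF assms(1) eval_hom[OF assms(2)]]])

lemma ev_tensor:
  assumes "vectorspace K M" "a \<in> carrier A" "m \<in> carrier M" "f \<in> carrier C"
  shows "ev M a (tensor K M C m f) = f a \<odot>\<^bsub>M\<^esub> m"
  unfolding ev_def
  by (rule vs_pair.tensor_lift_tensor[OF pair_C[OF assms(1)] assms(1) functional_bilin[OF assms(1) eval_hom[OF assms(2)]] assms(3,4)])

text \<open>Elements of A^0 are functions on A, so the functionals f \<mapsto> f(a) separate them;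
  \<open>tensor_separation\<close> carries this over to the tensor product.\<close>

lemma ev_eqI:
  assumes M: "vectorspace K M" and "t \<in> carrier (tensor_space K M C)" "u \<in> carrier (tensor_space K M C)"
    and "\<And>a. a \<in> carrier A \<Longrightarrow> ev M a t = ev M a u"
  shows "t = u"
proof (rule vs_pair.tensor_separation[OF pair_C[OF M], where S = "carrier A" and x = "\<lambda>a f. f a"])
  show "w = \<zero>\<^bsub>C\<^esub>" if "w \<in> carrier C" "\<And>s. s \<in> carrier A \<Longrightarrow> w s = \<zero>\<^bsub>K\<^esub>" for w
    using that by (intro C_eqI C_closed) (auto simp: C_sel(2))
qed (use assms eval_hom in \<open>auto simp: ev_def\<close>)

lemma ev_hom_arg:
  assumes M: "vectorspace K M" and t: "t \<in> carrier (tensor_space K M C)"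
  shows "(\<lambda>a. ev M a t) \<in> module_hom K A M"
proof (rule module_homI)
  interpret M: vectorspace K M by fact
  note eq = vs_pair.hom_eqI[OF pair_C[OF M] M _ _ _ t]
  show "ev M a t \<in> carrier M" if "a \<in> carrier A" for a
    by (rule module_hom_mem[OF ev_hom[OF M that] t])
  show "ev M (a \<oplus>\<^bsub>A\<^esub> b) t = ev M a t \<oplus>\<^bsub>M\<^esub> ev M b t" if a: "a \<in> carrier A" and b: "b \<in> carrier A" for a b
    by (rule eq[OF ev_hom[OF M] module_hom_plus[OF M ev_hom[OF M a] ev_hom[OF M b]]])
      (auto simp: ev_tensor[OF M] a b M.smult_l_distr)
  show "ev M (c \<odot>\<^bsub>A\<^esub> a) t = c \<odot>\<^bsub>M\<^esub> ev M a t" if c: "c \<in> carrier K" and a: "a \<in> carrier A" for c a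
    by (rule eq[OF ev_hom[OF M] module_hom_scale[OF M ev_hom[OF M a] c]])
      (auto simp: ev_tensor[OF M] a c M.smult_assoc1)
qed

text \<open>The axioms of a left module stated for a bare function, so that they apply equally to
  the \<open>act\<close> field of a module, to the action derived from a coaction and to the action
  of A on A^0.\<close>

definition is_action :: "('k, 'v, 'm) module_scheme \<Rightarrow> ('a \<Rightarrow> 'v \<Rightarrow> 'v) \<Rightarrow> bool" where
  "is_action M \<alpha> \<longleftrightarrow> bilin K A M M \<alpha> \<and>
    (\<forall>a\<in>carrier A. \<forall>b\<in>carrier A. \<forall>m\<in>carrier M. \<alpha> (a \<otimes>\<^bsub>A\<^esub> b) m = \<alpha> a (\<alpha> b m))"

lemma is_actionD:
  assumes "is_action M \<alpha>"
  shows "bilin K A M M \<alpha>"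
    and "\<lbrakk>a \<in> carrier A; b \<in> carrier A; m \<in> carrier M\<rbrakk> \<Longrightarrow> \<alpha> (a \<otimes>\<^bsub>A\<^esub> b) m = \<alpha> a (\<alpha> b m)"
    and "\<lbrakk>a \<in> carrier A; m \<in> carrier M\<rbrakk> \<Longrightarrow> \<alpha> a m \<in> carrier M"
  using assms module_hom_mem[OF bilinD(2)] by (auto simp: is_action_def)

text \<open>
  In coordinates on \<open>N\<close>, the action has coefficients \<open>f\<^sub>b\<close> that vanish on the annihilator of \<open>N\<close>;
  this is a two-sided ideal of finite codimension, so \<open>f\<^sub>b \<in> A\<^sup>0\<close> and \<open>m \<mapsto> \<Sum>\<^sub>b b \<otimes> f\<^sub>b\<close> is the coaction.
\<close>

lemma coaction_exists:
  assumes M: "vectorspace K M" and act: "is_action M \<alpha>"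
    and N: "subspace K N M" and fd: "vectorspace.fin_dim K (M\<lparr>carrier := N\<rparr>)"
    and stable: "\<And>a n. \<lbrakk>a \<in> carrier A; n \<in> N\<rbrakk> \<Longrightarrow> \<alpha> a n \<in> N" and m: "m \<in> N"
  shows "\<exists>t\<in>carrier (tensor_space K M C). \<forall>a\<in>carrier A. ev M a t = \<alpha> a m"
proof -
  interpret M: vectorspace K M by fact
  note N' = subspaceD[OF N]
  note bil = is_actionD(1)[OF act]
  obtain B c where B: "finite B" "B \<subseteq> N"
    and c: "\<And>b. b \<in> B \<Longrightarrow> c b \<in> module_hom K (M\<lparr>carrier := N\<rparr>) (base_space K)"
    and exp: "\<And>v. v \<in> N \<Longrightarrow> v = (\<Oplus>\<^bsub>M\<^esub>b\<in>B. c b v \<odot>\<^bsub>M\<^esub> b)"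
    by (rule fin_dim_subspace_coordinates[OF N fd]) blast
  have BM: "b \<in> carrier M" if "b \<in> B" for b using B N' that by auto
  have ck: "c b n \<in> carrier K" if "b \<in> B" "n \<in> N" for b n
    using module_hom_mem[OF c[OF that(1)], of n] that by simp
  define I where "I = {a \<in> carrier A. \<forall>n\<in>N. \<alpha> a n = \<zero>\<^bsub>M\<^esub>}"
  have \<alpha>N: "(\<lambda>a. \<alpha> a n) \<in> module_hom K A (M\<lparr>carrier := N\<rparr>)" if "n \<in> N" for n
    using bilinD(1)[OF bil, of n] that N'(2) stable by (auto simp: module_hom_def)
  have \<alpha>0: "\<alpha> a \<zero>\<^bsub>M\<^esub> = \<zero>\<^bsub>M\<^esub>" if "a \<in> carrier A" for a
    by (rule module_hom_zero[OF M M bilinD(2)[OF bil that]])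
  have \<alpha>l: "\<alpha> (a \<oplus>\<^bsub>A\<^esub> b) n = \<alpha> a n \<oplus>\<^bsub>M\<^esub> \<alpha> b n" "\<alpha> (k \<odot>\<^bsub>A\<^esub> a) n = k \<odot>\<^bsub>M\<^esub> \<alpha> a n"
    if "a \<in> carrier A" "b \<in> carrier A" "n \<in> N" "k \<in> carrier K" for a b n k
    using module_hom_add[OF bilinD(1)[OF bil]] module_hom_smult[OF bilinD(1)[OF bil]] that N'(2)
    by (auto simp: subset_iff)
  have Is: "subspace K I A"
  proof (rule subspaceI[OF A_vs])
    show "\<zero>\<^bsub>A\<^esub> \<in> I"
      using module_hom_zero[OF A_vs M bilinD(1)[OF bil]] N'(2) by (auto simp: I_def)
  qed (auto simp: I_def \<alpha>l \<alpha>l(1)[OF _ _ _ A.R.zero_closed] \<alpha>l(2)[OF _ A.M.zero_closed])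
  have I: "two_sided_ideal K A I"
    unfolding two_sided_ideal_def
  proof (intro conjI ballI Is)
    fix a x assume a: "a \<in> carrier A" and x: "x \<in> I"
    then have xA: "x \<in> carrier A" by (simp add: I_def)
    \<comment> \<open>The element a x kills N because x does; for x a it is the stability of N under
      a that keeps a n in N.\<close>
    have "\<alpha> (a \<otimes>\<^bsub>A\<^esub> x) n = \<zero>\<^bsub>M\<^esub>" "\<alpha> (x \<otimes>\<^bsub>A\<^esub> a) n = \<zero>\<^bsub>M\<^esub>" if n: "n \<in> N" for n
      using is_actionD(2)[OF act] a x xA n N'(2) stable[OF a n] \<alpha>0[OF a] by (auto simp: I_def)
    then show "a \<otimes>\<^bsub>A\<^esub> x \<in> I" "x \<otimes>\<^bsub>A\<^esub> a \<in> I"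
      using a xA by (auto simp: I_def mult_closed)
  qed
  \<comment> \<open>These are the matrix coefficients of the action on N. If all of them vanish at
    a, then a kills the finite set B, which generates N.\<close>
  let ?G = "(\<lambda>(b, b') a. c b (\<alpha> a b')) ` (B \<times> B)"
  have Ifd: "vectorspace.fin_dim K (quotient_space A I)"
    unfolding fin_codim_iff[OF Is]
  proof (intro exI conjI ballI impI)
    show "finite ?G" using B by simp
    show "?G \<subseteq> module_hom K A (base_space K)"
    proof
      fix g assume "g \<in> ?G"
      then obtain b b' where b: "b \<in> B" "b' \<in> B" "g = (\<lambda>a. c b (\<alpha> a b'))" by auto
      then show "g \<in> module_hom K A (base_space K)"
        using module_hom_comp[OF \<alpha>N c[OF b(1)], of b'] B(2) by blast
    qed
    fix a assume a: "a \<in> carrier A" and z: "\<forall>g\<in>?G. g a = \<zero>\<^bsub>K\<^esub>"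
    have ab: "\<alpha> a b' = \<zero>\<^bsub>M\<^esub>" if b': "b' \<in> B" for b'
    proof -
      have "\<alpha> a b' = (\<Oplus>\<^bsub>M\<^esub>b\<in>B. c b (\<alpha> a b') \<odot>\<^bsub>M\<^esub> b)"
        using B b' by (intro exp stable a) auto
      also have "\<dots> = (\<Oplus>\<^bsub>M\<^esub>b\<in>B. \<zero>\<^bsub>M\<^esub>)"
        using z b' BM by (intro M.M.finsum_cong') auto
      finally show ?thesis by (simp add: M.M.finsum_zero)
    qed
    have "\<alpha> a n = \<zero>\<^bsub>M\<^esub>" if n: "n \<in> N" for n
    proof -
      have "\<alpha> a n = \<alpha> a (\<Oplus>\<^bsub>M\<^esub>b\<in>B. c b n \<odot>\<^bsub>M\<^esub> b)" using exp[OF n] by simp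
      also have "\<dots> = (\<Oplus>\<^bsub>M\<^esub>b\<in>B. \<alpha> a (c b n \<odot>\<^bsub>M\<^esub> b))"
        using BM ck n by (intro module_hom_finsum[OF M M bilinD(2)[OF bil a]]) auto
      also have "\<dots> = (\<Oplus>\<^bsub>M\<^esub>b\<in>B. \<zero>\<^bsub>M\<^esub>)"
        using BM ck n ab by (intro M.M.finsum_cong') (auto simp: module_hom_smult[OF bilinD(2)[OF bil a]])
      finally show ?thesis by (simp add: M.M.finsum_zero)
    qed
    then show "a \<in> I" using a by (simp add: I_def)
  qed
  define f where "f b = (\<lambda>a\<in>carrier A. c b (\<alpha> a m))" for b
  have f: "f b \<in> carrier C" if b: "b \<in> B" for b
  proof (rule C_memI[OF _ _ I Ifd])
    show "f b \<in> module_hom K A (base_space K)"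
      by (rule module_hom_cong[OF module_hom_comp[OF \<alpha>N[OF m] c[OF b]] A_vs]) (simp add: f_def)
    show "f b x = \<zero>\<^bsub>K\<^esub>" if "x \<in> I" for x
      using that m module_hom_zero[OF subspace_vectorspace[OF N] base_vs c[OF b]]
      by (simp add: I_def f_def)
  qed (simp add: f_def)
  interpret P: vs_pair K M C by (rule pair_C[OF M])
  have tc: "(\<lambda>b. tensor K M C b (f b)) \<in> B \<rightarrow> carrier (tensor_space K M C)"
    using f BM by auto
  interpret T: vectorspace K "tensor_space K M C" by (rule P.T_vs)
  let ?t = "\<Oplus>\<^bsub>tensor_space K M C\<^esub>b\<in>B. tensor K M C b (f b)"
  have "ev M a ?t = \<alpha> a m" if a: "a \<in> carrier A" for a
  proof -
    have "ev M a ?t = (\<Oplus>\<^bsub>M\<^esub>b\<in>B. ev M a (tensor K M C b (f b)))"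
      by (rule module_hom_finsum[OF P.T_vs M ev_hom[OF M a] tc])
    also have "\<dots> = (\<Oplus>\<^bsub>M\<^esub>b\<in>B. c b (\<alpha> a m) \<odot>\<^bsub>M\<^esub> b)"
      using f BM a stable[OF a m] ck by (intro M.M.finsum_cong') (auto simp: ev_tensor[OF M a] f_def)
    also have "\<dots> = \<alpha> a m" using exp[OF stable[OF a m]] by simp
    finally show ?thesis .
  qed
  moreover have "?t \<in> carrier (tensor_space K M C)" by (rule T.M.finsum_closed[OF tc])
  ultimately show ?thesis by blast
qed

end

section \<open>Comultiplication and coassociativity\<close>

lemma bilin_swap: "bilin K V W U b \<Longrightarrow> bilin K W V U (\<lambda>w v. b v w)"
  by (simp add: bilin_def)

lemma id_hom: "vectorspace K V \<Longrightarrow> id \<in> module_hom K V V"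
  by (rule module_homI) auto

section \<open>Tensor products of maps and the associativity isomorphism\<close>

context vs_pair
begin

context
  fixes V' :: "('k, 'v2, 'm3) module_scheme" and W' :: "('k, 'w2, 'm4) module_scheme"
    and f :: "'v \<Rightarrow> 'v2" and g :: "'w \<Rightarrow> 'w2"
  assumes V': "vectorspace K V'" and W': "vectorspace K W'"
    and f: "f \<in> module_hom K V V'" and g: "g \<in> module_hom K W W'"
begin

lemma tensor_map_bilin: "bilin K V W (tensor_space K V' W') (\<lambda>v w. tensor K V' W' (f v) (g w))"
  by (rule bilin_comp[OF vs_pair.tensor_bilin[OF vs_pairI[OF V' W']] f g])

lemma tensor_map_hom: "tensor_map K V W V' W' f g \<in> module_hom K T (tensor_space K V' W')"
  unfolding tensor_map_def
  by (rule tensor_lift_hom[OF vs_pair.T_vs[OF vs_pairI[OF V' W']] tensor_map_bilin])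

lemma tensor_map_tensor:
  assumes "v \<in> carrier V" "w \<in> carrier W"
  shows "tensor_map K V W V' W' f g (tensor K V W v w) = tensor K V' W' (f v) (g w)"
  unfolding tensor_map_def
  by (rule tensor_lift_tensor[OF vs_pair.T_vs[OF vs_pairI[OF V' W']] tensor_map_bilin assms])

end

end

context
  fixes K :: "('k, 'n) ring_scheme" and U :: "('k, 'u, 'm1) module_scheme"
    and V :: "('k, 'v, 'm2) module_scheme" and W :: "('k, 'w, 'm3) module_scheme"
  assumes U: "vectorspace K U" and V: "vectorspace K V" and W: "vectorspace K W"
begin

abbreviation (input) "assoc_target \<equiv> tensor_space K U (tensor_space K V W)"
abbreviation (input) "assoc_inner w \<equiv> tensor_lift K U V assoc_target
  (\<lambda>u v. tensor K U (tensor_space K V W) u (tensor K V W v w))"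

lemma assoc_target_vs: "vectorspace K assoc_target"
  by (intro vs_pair.T_vs vs_pairI U V W)

lemma assoc_inner_bilin:
  assumes "w \<in> carrier W"
  shows "bilin K U V assoc_target (\<lambda>u v. tensor K U (tensor_space K V W) u (tensor K V W v w))"
  using bilin_comp[OF vs_pair.tensor_bilin[OF vs_pairI[OF U vs_pair.T_vs[OF vs_pairI[OF V W]]]]
      id_hom[OF U] bilinD(1)[OF vs_pair.tensor_bilin[OF vs_pairI[OF V W]] assms]]
  by simp

lemma assoc_inner_hom:
  "w \<in> carrier W \<Longrightarrow> assoc_inner w \<in> module_hom K (tensor_space K U V) assoc_target"
  by (rule vs_pair.tensor_lift_hom[OF vs_pairI[OF U V] assoc_target_vs assoc_inner_bilin])

lemma assoc_inner_tensor:
  "\<lbrakk>u \<in> carrier U; v \<in> carrier V; w \<in> carrier W\<rbrakk> \<Longrightarrow>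
    assoc_inner w (tensor K U V u v) = tensor K U (tensor_space K V W) u (tensor K V W v w)"
  by (rule vs_pair.tensor_lift_tensor[OF vs_pairI[OF U V] assoc_target_vs assoc_inner_bilin])

text \<open>The outer lift in \<open>tensor_assoc\<close> requires the inner one to be linear also
  in w. For fixed t this is an identity of linear maps in t, so it is checked on pure
  tensors.\<close>

lemma assoc_bilin: "bilin K (tensor_space K U V) W assoc_target (\<lambda>t w. assoc_inner w t)"
proof (rule bilinI)
  show "(\<lambda>t. assoc_inner w t) \<in> module_hom K (tensor_space K U V) assoc_target" if "w \<in> carrier W" for w
    by (rule assoc_inner_hom[OF that])
  interpret W: vectorspace K W by (rule W)
  interpret VW: vs_pair K V W by (rule vs_pairI[OF V W])
  interpret UVW: vs_pair K U "tensor_space K V W" by (rule vs_pairI[OF U VW.T_vs])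
  note eq = vs_pair.hom_eqI[OF vs_pairI[OF U V] assoc_target_vs]
  note lin = module_hom_add[OF bilinD(2)[OF VW.tensor_bilin]] module_hom_smult[OF bilinD(2)[OF VW.tensor_bilin]]
    module_hom_add[OF bilinD(2)[OF UVW.tensor_bilin]] module_hom_smult[OF bilinD(2)[OF UVW.tensor_bilin]]
  show "(\<lambda>w. assoc_inner w t) \<in> module_hom K W assoc_target" if t: "t \<in> carrier (tensor_space K U V)" for t
  proof (rule module_homI)
    show "assoc_inner w t \<in> carrier assoc_target" if "w \<in> carrier W" for w
      by (rule module_hom_mem[OF assoc_inner_hom[OF that] t])
    show "assoc_inner (w \<oplus>\<^bsub>W\<^esub> w') t = assoc_inner w t \<oplus>\<^bsub>assoc_target\<^esub> assoc_inner w' t"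
      if w: "w \<in> carrier W" "w' \<in> carrier W" for w w'
      by (rule eq[OF assoc_inner_hom module_hom_plus[OF assoc_target_vs assoc_inner_hom assoc_inner_hom] _ t])
        (simp_all add: w assoc_inner_tensor lin)
    show "assoc_inner (c \<odot>\<^bsub>W\<^esub> w) t = c \<odot>\<^bsub>assoc_target\<^esub> assoc_inner w t"
      if w: "c \<in> carrier K" "w \<in> carrier W" for c w
      by (rule eq[OF assoc_inner_hom module_hom_scale[OF assoc_target_vs assoc_inner_hom] _ t])
        (simp_all add: w assoc_inner_tensor lin)
  qed
qed

lemma tensor_assoc_hom:
  "tensor_assoc K U V W \<in> module_hom K (tensor_space K (tensor_space K U V) W) assoc_target"
  unfolding tensor_assoc_def Let_def
  by (rule vs_pair.tensor_lift_hom[OF vs_pairI[OF vs_pair.T_vs[OF vs_pairI[OF U V]] W] assoc_target_vs assoc_bilin])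

text \<open>The first factor t is arbitrary rather than pure, since in the coassociativity law it is
  the value of a coaction.\<close>

lemma tensor_assoc_tensor:
  assumes "t \<in> carrier (tensor_space K U V)" "w \<in> carrier W"
  shows "tensor_assoc K U V W (tensor K (tensor_space K U V) W t w) = assoc_inner w t"
  unfolding tensor_assoc_def Let_def
  by (rule vs_pair.tensor_lift_tensor[OF vs_pairI[OF vs_pair.T_vs[OF vs_pairI[OF U V]] W] assoc_target_vs assoc_bilin assms])

end

section \<open>The regular action and the comultiplication\<close>

context enough_idempotents
begin

definition reg :: "'a \<Rightarrow> ('a \<Rightarrow> 'k) \<Rightarrow> 'a \<Rightarrow> 'k" where
  "reg a f = (\<lambda>x\<in>carrier A. f (x \<otimes>\<^bsub>A\<^esub> a))"

lemma mult_bilin: "bilin K A A A (mult A)"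
  by (intro bilinI module_homI)
    (auto simp: mult_closed mult_l_distr mult_r_distr smult_mult_l smult_mult_r)

lemma reg_kills:
  assumes "two_sided_ideal K A I" "\<forall>x\<in>I. f x = \<zero>\<^bsub>K\<^esub>" "a \<in> carrier A" "x \<in> I"
  shows "reg a f x = \<zero>\<^bsub>K\<^esub>"
  using assms two_sided_idealD(2,4)[OF assms(1)] by (auto simp: reg_def)

lemma reg_closed:
  assumes a: "a \<in> carrier A" and f: "f \<in> carrier C"
  shows "reg a f \<in> carrier C"
proof -
  obtain I where I: "two_sided_ideal K A I" "vectorspace.fin_dim K (quotient_space A I)"
    "\<forall>x\<in>I. f x = \<zero>\<^bsub>K\<^esub>" using f by (rule C_memE)
  show ?thesis
  proof (rule C_memI[OF _ _ I(1,2)])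
    show "reg a f \<in> module_hom K A (base_space K)"
      by (rule module_hom_cong[OF module_hom_comp[OF bilinD(1)[OF mult_bilin a] C_hom[OF f]] A_vs])
        (simp add: reg_def)
  qed (use reg_kills[OF I(1,3) a] in \<open>simp_all add: reg_def\<close>)
qed

lemma reg_action: "is_action C reg"
  unfolding is_action_def
proof (intro conjI ballI bilinI module_homI)
  fix a b f assume [simp]: "a \<in> carrier A" "b \<in> carrier A" "f \<in> carrier C"
  show "reg (a \<otimes>\<^bsub>A\<^esub> b) f = reg a (reg b f)"
    by (rule C_eqI) (simp_all add: reg_closed mult_closed, simp add: reg_def mult_closed mult_assoc)
  show "reg (a \<oplus>\<^bsub>A\<^esub> b) f = reg a f \<oplus>\<^bsub>C\<^esub> reg b f"
    by (rule C_eqI) (simp_all add: reg_closed C_closed, simp add: reg_def C_sel(3) mult_closed mult_r_distr)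
next
  fix c a f assume [simp]: "c \<in> carrier K" "a \<in> carrier A" "f \<in> carrier C"
  show "reg (c \<odot>\<^bsub>A\<^esub> a) f = c \<odot>\<^bsub>C\<^esub> reg a f"
    by (rule C_eqI) (simp_all add: reg_closed C_closed, simp add: reg_def C_sel(4) mult_closed smult_mult_r)
  show "reg a (c \<odot>\<^bsub>C\<^esub> f) = c \<odot>\<^bsub>C\<^esub> reg a f"
    by (rule C_eqI) (simp_all add: reg_closed C_closed, simp add: reg_def C_sel(4) mult_closed)
next
  fix a f g assume [simp]: "a \<in> carrier A" "f \<in> carrier C" "g \<in> carrier C"
  show "reg a (f \<oplus>\<^bsub>C\<^esub> g) = reg a f \<oplus>\<^bsub>C\<^esub> reg a g"
    by (rule C_eqI) (simp_all add: reg_closed C_closed, simp add: reg_def C_sel(3) mult_closed)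
qed (simp_all add: reg_closed)

text \<open>N is the dual of A/I. Since A = span Y + I, an element of N is determined by its values
  on the finite set Y, so evaluations at Y separate N. For an ideal I on which f vanishes, N is a
  stable subspace containing f, to which \<open>coaction_exists\<close> applies.\<close>

lemma annihilator_fin_dim:
  assumes I: "two_sided_ideal K A I" "vectorspace.fin_dim K (quotient_space A I)"
  defines "N \<equiv> {g \<in> carrier C. \<forall>x\<in>I. g x = \<zero>\<^bsub>K\<^esub>}"
  shows "subspace K N C" "vectorspace.fin_dim K (C\<lparr>carrier := N\<rparr>)"
proof -
  have IA: "x \<in> carrier A" if "x \<in> I" for x using two_sided_idealD(2)[OF I(1)] that by auto
  show s: "subspace K N C"
    by (rule subspaceI[OF C_vs]) (auto simp: N_def C_closed IA, auto simp: C_sel(2-4) IA)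
  obtain Y where Y: "finite Y" "Y \<subseteq> carrier A"
    and Yv: "\<And>v. v \<in> carrier A \<Longrightarrow> \<exists>y\<in>module.span K A Y. v \<ominus>\<^bsub>A\<^esub> y \<in> I"
    by (rule fin_codim_span[OF two_sided_idealD(1)[OF I(1)] I(2)]) blast
  note sp = subspaceD(2)[OF subspace_span[OF A_vs Y(2)]]
  show "vectorspace.fin_dim K (C\<lparr>carrier := N\<rparr>)"
  proof (rule fin_dim_functionalsI[OF subspace_vectorspace[OF s]])
    show "finite ((\<lambda>y g. g y) ` Y)" using Y by simp
    show "(\<lambda>y g. g y) ` Y \<subseteq> module_hom K (C\<lparr>carrier := N\<rparr>) (base_space K)"
      using Y eval_hom by (auto simp: module_hom_def N_def)
    fix f g assume fg: "f \<in> carrier (C\<lparr>carrier := N\<rparr>)" "g \<in> carrier (C\<lparr>carrier := N\<rparr>)"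
      and eq: "\<And>h. h \<in> (\<lambda>y g. g y) ` Y \<Longrightarrow> h f = h g"
    have f: "f \<in> carrier C" "\<And>x. x \<in> I \<Longrightarrow> f x = \<zero>\<^bsub>K\<^esub>"
      and g: "g \<in> carrier C" "\<And>x. x \<in> I \<Longrightarrow> g x = \<zero>\<^bsub>K\<^esub>" using fg by (auto simp: N_def)
    \<comment> \<open>The set where f and g agree is a subspace containing Y; since both vanish on
      I, agreement passes from \<open>span Y\<close> to all of A.\<close>
    have "subspace K {v \<in> carrier A. f v = g v} A"
      using module_hom_zero[OF A_vs base_vs C_hom[OF f(1)]] module_hom_zero[OF A_vs base_vs C_hom[OF g(1)]]
      by (intro subspaceI[OF A_vs]) (auto simp: f g)
    moreover have "Y \<subseteq> {v \<in> carrier A. f v = g v}" using Y eq by auto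
    ultimately have span: "module.span K A Y \<subseteq> {v \<in> carrier A. f v = g v}" by (rule span_least)
    show "f = g"
    proof (rule C_eqI[OF f(1) g(1)])
      fix v assume v: "v \<in> carrier A"
      obtain y where y: "y \<in> module.span K A Y" "v \<ominus>\<^bsub>A\<^esub> y \<in> I" using Yv[OF v] by blast
      then have yA: "y \<in> carrier A" using sp by auto
      have "f v \<ominus>\<^bsub>K\<^esub> f y = \<zero>\<^bsub>K\<^esub>" "g v \<ominus>\<^bsub>K\<^esub> g y = \<zero>\<^bsub>K\<^esub>"
        using f(2)[OF y(2)] g(2)[OF y(2)] functional_minus[OF A_vs C_hom[OF f(1)] v yA]
          functional_minus[OF A_vs C_hom[OF g(1)] v yA] by simp_all
      then have "f v = f y" "g v = g y" using f(1) g(1) v yA by simp_all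
      moreover have "f y = g y" using span y(1) by auto
      ultimately show "f v = g v" by simp
    qed
  qed
qed

lemma comult_exists:
  assumes f: "f \<in> carrier C"
  shows "\<exists>t\<in>carrier (tensor_space K C C). \<forall>a\<in>carrier A. ev C a t = reg a f"
proof -
  obtain I where I: "two_sided_ideal K A I" "vectorspace.fin_dim K (quotient_space A I)"
    "\<forall>x\<in>I. f x = \<zero>\<^bsub>K\<^esub>" using f by (rule C_memE)
  show ?thesis
    by (rule coaction_exists[OF C_vs reg_action annihilator_fin_dim[OF I(1,2)]])
      (use f I(3) in \<open>auto simp: reg_closed reg_kills[OF I(1)]\<close>)
qed

text \<open>Contracting the second factor at y and evaluating the result at x yields the right-hand
  side of the identity f(xy) = \<Sum> u_i(x) v_i(y) that defines the comultiplication.\<close>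

lemma ev_presentation:
  assumes u: "u \<in> {..<n::nat} \<rightarrow> carrier C" and v: "v \<in> {..<n} \<rightarrow> carrier C"
    and x: "x \<in> carrier A" and y: "y \<in> carrier A"
  shows "ev C y (\<Oplus>\<^bsub>tensor_space K C C\<^esub>i\<in>{..<n}. tensor K C C (u i) (v i)) x =
    (\<Oplus>\<^bsub>K\<^esub>i\<in>{..<n}. u i x \<otimes>\<^bsub>K\<^esub> v i y)"
proof -
  interpret C: vectorspace K C by (rule C_vs)
  interpret P: vs_pair K C C by (rule pair_C[OF C_vs])
  have uv: "u i \<in> carrier C" "v i \<in> carrier C" if "i < n" for i using u v that by auto
  have 1: "ev C y (\<Oplus>\<^bsub>tensor_space K C C\<^esub>i\<in>{..<n}. tensor K C C (u i) (v i)) =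
      (\<Oplus>\<^bsub>C\<^esub>i\<in>{..<n}. ev C y (tensor K C C (u i) (v i)))"
    using uv by (intro module_hom_finsum[OF P.T_vs C_vs ev_hom[OF C_vs y]]) auto
  have "ev C y (\<Oplus>\<^bsub>tensor_space K C C\<^esub>i\<in>{..<n}. tensor K C C (u i) (v i)) x =
    (\<Oplus>\<^bsub>base_space K\<^esub>i\<in>{..<n}. ev C y (tensor K C C (u i) (v i)) x)"
    unfolding 1 using uv by (intro module_hom_finsum[OF C_vs base_vs eval_hom[OF x]])
      (auto intro!: module_hom_mem[OF ev_hom[OF C_vs y]])
  also have "\<dots> = (\<Oplus>\<^bsub>K\<^esub>i\<in>{..<n}. ev C y (tensor K C C (u i) (v i)) x)"
    by (simp add: finsum_def finprod_def)
  also have "\<dots> = (\<Oplus>\<^bsub>K\<^esub>i\<in>{..<n}. u i x \<otimes>\<^bsub>K\<^esub> v i y)"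
    using uv x y by (intro A.R.finsum_cong') (auto simp: ev_tensor[OF C_vs y] C_sel(4) A.R.m_comm)
  finally show ?thesis .
qed

text \<open>By \<open>ev_presentation\<close> the defining identity says that evaluation at y sends
  the tensor to \<open>reg y f\<close>. Expanding t gives a presentation with this property, and
  \<open>ev_eqI\<close> excludes any other tensor, so the description denotes t.\<close>

lemma comult_unique:
  assumes f: "f \<in> carrier C" and t: "t \<in> carrier (tensor_space K C C)"
    and ev: "\<And>a. a \<in> carrier A \<Longrightarrow> ev C a t = reg a f"
  shows "comult C f = t"
proof -
  interpret P: vs_pair K C C by (rule pair_C[OF C_vs])
  \<comment> \<open>The comultiplication is defined over this record, which lacks the coalgebra
    fields; its tensor space is the same as that of C.\<close>
  let ?D = "finite_dual_space K A"
  have D: "carrier ?D = carrier C" "add ?D = add C" "smult ?D = smult C"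
    by (simp_all add: finite_dual_def Let_def)
  note T = tensor_space_cong[OF D D]
  have "comult C f = finite_dual_comult K A f" by (simp add: finite_dual_def Let_def)
  also have "\<dots> = t" unfolding finite_dual_comult_def Let_def D(1) T
  proof (rule the_equality)
    obtain n :: nat and u v where uv: "u \<in> {..<n} \<rightarrow> carrier C" "v \<in> {..<n} \<rightarrow> carrier C"
      and teq: "t = (\<Oplus>\<^bsub>tensor_space K C C\<^esub>i\<in>{..<n}. tensor K C C (u i) (v i))"
      using t by (rule P.tensor_expand)
    show "\<exists>(n::nat) u v. u \<in> {..<n} \<rightarrow> carrier C \<and> v \<in> {..<n} \<rightarrow> carrier C \<and>
        t = (\<Oplus>\<^bsub>tensor_space K C C\<^esub>i\<in>{..<n}. tensor K C C (u i) (v i)) \<and>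
        (\<forall>x\<in>carrier A. \<forall>y\<in>carrier A. f (x \<otimes>\<^bsub>A\<^esub> y) = (\<Oplus>\<^bsub>K\<^esub>i\<in>{..<n}. u i x \<otimes>\<^bsub>K\<^esub> v i y))"
    proof (intro exI conjI ballI)
      fix x y assume xy: "x \<in> carrier A" "y \<in> carrier A"
      then show "f (x \<otimes>\<^bsub>A\<^esub> y) = (\<Oplus>\<^bsub>K\<^esub>i\<in>{..<n}. u i x \<otimes>\<^bsub>K\<^esub> v i y)"
        using ev_presentation[OF uv xy] ev[OF xy(2)] teq by (simp add: reg_def)
    qed (fact uv teq)+
  next
    fix s assume "\<exists>(n::nat) u v. u \<in> {..<n} \<rightarrow> carrier C \<and> v \<in> {..<n} \<rightarrow> carrier C \<and>
        s = (\<Oplus>\<^bsub>tensor_space K C C\<^esub>i\<in>{..<n}. tensor K C C (u i) (v i)) \<and>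
        (\<forall>x\<in>carrier A. \<forall>y\<in>carrier A. f (x \<otimes>\<^bsub>A\<^esub> y) = (\<Oplus>\<^bsub>K\<^esub>i\<in>{..<n}. u i x \<otimes>\<^bsub>K\<^esub> v i y))"
    then obtain n :: nat and u v where uv: "u \<in> {..<n} \<rightarrow> carrier C" "v \<in> {..<n} \<rightarrow> carrier C"
      and s: "s = (\<Oplus>\<^bsub>tensor_space K C C\<^esub>i\<in>{..<n}. tensor K C C (u i) (v i))"
      and fxy: "\<forall>x\<in>carrier A. \<forall>y\<in>carrier A. f (x \<otimes>\<^bsub>A\<^esub> y) = (\<Oplus>\<^bsub>K\<^esub>i\<in>{..<n}. u i x \<otimes>\<^bsub>K\<^esub> v i y)"
      by (elim exE conjE)
    interpret T: vectorspace K "tensor_space K C C" by (rule P.T_vs)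
    have sT: "s \<in> carrier (tensor_space K C C)"
      unfolding s using uv by (intro T.M.finsum_closed) (auto simp: Pi_iff)
    show "s = t"
    proof (rule ev_eqI[OF C_vs sT t])
      fix y assume y: "y \<in> carrier A"
      show "ev C y s = ev C y t"
        unfolding ev[OF y]
      proof (rule C_eqI[OF module_hom_mem[OF ev_hom[OF C_vs y] sT] reg_closed[OF y f]])
        fix x assume x: "x \<in> carrier A"
        show "ev C y s x = reg y f x"
          using ev_presentation[OF uv x y] fxy x y by (simp add: s reg_def)
      qed
    qed
  qed
  finally show ?thesis .
qed

lemma comult_closed: "f \<in> carrier C \<Longrightarrow> comult C f \<in> carrier (tensor_space K C C)"
  and ev_comult: "\<lbrakk>f \<in> carrier C; a \<in> carrier A\<rbrakk> \<Longrightarrow> ev C a (comult C f) = reg a f"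
  using comult_exists comult_unique by metis+

text \<open>Linearity of \<rho> may be tested after each evaluation, where it becomes linearity of m
  \<mapsto> \<alpha> a m. It serves both for the comultiplication and for coactions built from
  modules.\<close>

lemma coaction_hom:
  assumes M: "vectorspace K M" and act: "bilin K A M M \<alpha>"
    and \<rho>: "\<And>m. m \<in> carrier M \<Longrightarrow> \<rho> m \<in> carrier (tensor_space K M C)"
    and ev: "\<And>m a. \<lbrakk>m \<in> carrier M; a \<in> carrier A\<rbrakk> \<Longrightarrow> ev M a (\<rho> m) = \<alpha> a m"
  shows "\<rho> \<in> module_hom K M (tensor_space K M C)"
proof -
  interpret M: vectorspace K M by fact
  interpret P: vs_pair K M C by (rule pair_C[OF M])
  interpret T: vectorspace K "tensor_space K M C" by (rule P.T_vs)
  note lin = module_hom_add[OF bilinD(2)[OF act]] module_hom_smult[OF bilinD(2)[OF act]]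
    module_hom_add[OF ev_hom[OF M]] module_hom_smult[OF ev_hom[OF M]]
  show ?thesis
  proof (rule module_homI)
    show "\<rho> (u \<oplus>\<^bsub>M\<^esub> v) = \<rho> u \<oplus>\<^bsub>tensor_space K M C\<^esub> \<rho> v" if "u \<in> carrier M" "v \<in> carrier M" for u v
      using that by (intro ev_eqI[OF M]) (auto simp: \<rho> ev lin)
    show "\<rho> (c \<odot>\<^bsub>M\<^esub> v) = c \<odot>\<^bsub>tensor_space K M C\<^esub> \<rho> v" if "c \<in> carrier K" "v \<in> carrier M" for c v
      using that by (intro ev_eqI[OF M]) (auto simp: \<rho> ev lin)
  qed (rule \<rho>)
qed

lemma comult_hom: "comult C \<in> module_hom K C (tensor_space K C C)"
  by (rule coaction_hom[OF C_vs is_actionD(1)[OF reg_action] comult_closed ev_comult])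

section \<open>Coassociativity through double evaluation\<close>

definition ev2 :: "('k, 'v, 'm) module_scheme \<Rightarrow> 'a \<Rightarrow> 'a \<Rightarrow> _ \<Rightarrow> 'v" where
  "ev2 M a b = tensor_lift K M (tensor_space K C C) M (\<lambda>m t. ev C b t a \<odot>\<^bsub>M\<^esub> m)"

lemma CC_vs: "vectorspace K (tensor_space K C C)"
  by (rule vs_pair.T_vs[OF pair_C[OF C_vs]])

lemma ev_eval_hom:
  "\<lbrakk>a \<in> carrier A; b \<in> carrier A\<rbrakk> \<Longrightarrow> (\<lambda>t. ev C b t a) \<in> module_hom K (tensor_space K C C) (base_space K)"
  by (rule module_hom_comp[OF ev_hom[OF C_vs] eval_hom])

context
  fixes M :: "('k, 'v, 'm) module_scheme"
  assumes M: "vectorspace K M"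
begin

lemma ev2_hom:
  "\<lbrakk>a \<in> carrier A; b \<in> carrier A\<rbrakk> \<Longrightarrow> ev2 M a b \<in> module_hom K (tensor_space K M (tensor_space K C C)) M"
  unfolding ev2_def
  by (rule vs_pair.tensor_lift_hom[OF vs_pairI[OF M CC_vs] M functional_bilin[OF M ev_eval_hom]])

lemma ev2_tensor:
  "\<lbrakk>a \<in> carrier A; b \<in> carrier A; m \<in> carrier M; t \<in> carrier (tensor_space K C C)\<rbrakk> \<Longrightarrow>
    ev2 M a b (tensor K M (tensor_space K C C) m t) = ev C b t a \<odot>\<^bsub>M\<^esub> m"
  unfolding ev2_def
  by (rule vs_pair.tensor_lift_tensor[OF vs_pairI[OF M CC_vs] M functional_bilin[OF M ev_eval_hom]])

text \<open>Separation is used twice: if (ev_b w)(a) = 0 for all a and b, then each ev_b w vanishes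
  as a function on A, so w = 0. Thus these functionals separate the second factor, as
  \<open>tensor_separation\<close> requires.\<close>

lemma ev2_eqI:
  assumes "t \<in> carrier (tensor_space K M (tensor_space K C C))"
    "u \<in> carrier (tensor_space K M (tensor_space K C C))"
    and "\<And>a b. \<lbrakk>a \<in> carrier A; b \<in> carrier A\<rbrakk> \<Longrightarrow> ev2 M a b t = ev2 M a b u"
  shows "t = u"
proof (rule vs_pair.tensor_separation[OF vs_pairI[OF M CC_vs], where S = "carrier A \<times> carrier A"
      and x = "\<lambda>(a, b) t. ev C b t a"])
  interpret T: vectorspace K "tensor_space K C C" by (rule CC_vs)
  show "w = \<zero>\<^bsub>tensor_space K C C\<^esub>" if w: "w \<in> carrier (tensor_space K C C)"
    and z: "\<And>s. s \<in> carrier A \<times> carrier A \<Longrightarrow> (case s of (a, b) \<Rightarrow> \<lambda>t. ev C b t a) w = \<zero>\<^bsub>K\<^esub>" for w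
  proof (rule ev_eqI[OF C_vs w T.M.zero_closed])
    fix b assume b: "b \<in> carrier A"
    have "ev C b w = \<zero>\<^bsub>C\<^esub>"
      using z b by (intro C_eqI C_closed module_hom_mem[OF ev_hom[OF C_vs b] w]) (auto simp: C_sel(2))
    then show "ev C b w = ev C b \<zero>\<^bsub>tensor_space K C C\<^esub>"
      using module_hom_zero[OF CC_vs C_vs ev_hom[OF C_vs b]] by simp
  qed
qed (use assms in \<open>auto simp: ev2_def ev_eval_hom\<close>)

text \<open>On m \<otimes> f both sides are f(ab) m: evaluating the comultiplication of f at b gives
  \<open>reg b f\<close>, whose value at a is f(ab).\<close>

lemma comult_side:
  assumes t: "t \<in> carrier (tensor_space K M C)" and a: "a \<in> carrier A" and b: "b \<in> carrier A"
  shows "ev2 M a b (tensor_map K M C M (tensor_space K C C) id (comult C) t) = ev M (a \<otimes>\<^bsub>A\<^esub> b) t"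
proof -
  interpret P: vs_pair K M C by (rule pair_C[OF M])
  note h = P.tensor_map_hom[OF M CC_vs id_hom[OF M] comult_hom]
  note ab = mult_closed[OF a b]
  show ?thesis
    by (rule P.hom_eqI[OF M module_hom_comp[OF h ev2_hom[OF a b]] ev_hom[OF M ab] _ t])
      (simp add: P.tensor_map_tensor[OF M CC_vs id_hom[OF M] comult_hom] ev2_tensor a b comult_closed
        ev_tensor[OF M ab] ev_comult, simp add: reg_def a)
qed

text \<open>On m \<otimes> f both sides are f(b) ev_a(\<rho> m). After reassociation f is the last
  factor, so evaluation at b turns it into a scalar, and linearity of \<rho> moves this scalar
  inside.\<close>

lemma coaction_side:
  assumes \<rho>: "\<rho> \<in> module_hom K M (tensor_space K M C)"
    and t: "t \<in> carrier (tensor_space K M C)" and a: "a \<in> carrier A" and b: "b \<in> carrier A"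
  shows "ev2 M a b (tensor_assoc K M C C (tensor_map K M C (tensor_space K M C) C \<rho> id t)) =
    ev M a (\<rho> (ev M b t))"
proof -
  interpret M: vectorspace K M by (rule M)
  interpret P: vs_pair K M C by (rule pair_C[OF M])
  interpret CC: vs_pair K C C by (rule pair_C[OF C_vs])
  note inner_hom = assoc_inner_hom[OF M C_vs C_vs]
  \<comment> \<open>Stated for an arbitrary s in the tensor product of M and C, so that it can be
    used at s = \<rho> m, which need not be a pure tensor.\<close>
  have inner: "ev2 M a b (tensor_lift K M C (tensor_space K M (tensor_space K C C))
      (\<lambda>u v. tensor K M (tensor_space K C C) u (tensor K C C v f)) s) = f b \<odot>\<^bsub>M\<^esub> ev M a s"
    if f: "f \<in> carrier C" and s: "s \<in> carrier (tensor_space K M C)" for f s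
    by (rule P.hom_eqI[OF M module_hom_comp[OF inner_hom[OF f] ev2_hom[OF a b]]
          module_hom_scale[OF M ev_hom[OF M a]] _ s])
      (use f a b in \<open>simp_all add: assoc_inner_tensor[OF M C_vs C_vs] ev2_tensor ev_tensor[OF C_vs b]
          ev_tensor[OF M a] C_sel(4) M.smult_assoc1\<close>)
  note map_hom = P.tensor_map_hom[OF P.T_vs C_vs \<rho> id_hom[OF C_vs]]
  note h = module_hom_comp[OF module_hom_comp[OF map_hom tensor_assoc_hom[OF M C_vs C_vs]] ev2_hom[OF a b]]
  note k = module_hom_comp[OF module_hom_comp[OF ev_hom[OF M b] \<rho>] ev_hom[OF M a]]
  show ?thesis
  proof (rule P.hom_eqI[OF M h k _ t])
    fix m f assume m: "m \<in> carrier M" and f: "f \<in> carrier C"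
    note \<rho>m = module_hom_mem[OF \<rho> m]
    have "ev2 M a b (tensor_assoc K M C C (tensor_map K M C (tensor_space K M C) C \<rho> id (tensor K M C m f))) =
      f b \<odot>\<^bsub>M\<^esub> ev M a (\<rho> m)"
      by (simp add: P.tensor_map_tensor[OF P.T_vs C_vs \<rho> id_hom[OF C_vs] m f]
          tensor_assoc_tensor[OF M C_vs C_vs \<rho>m f] inner[OF f \<rho>m])
    also have "\<dots> = ev M a (\<rho> (f b \<odot>\<^bsub>M\<^esub> m))"
      using f b m by (simp add: module_hom_smult[OF \<rho>] module_hom_smult[OF ev_hom[OF M a]] \<rho>m)
    also have "\<dots> = ev M a (\<rho> (ev M b (tensor K M C m f)))"
      using m f b by (simp add: ev_tensor[OF M])
    finally show "ev2 M a b (tensor_assoc K M C C (tensor_map K M C (tensor_space K M C) C \<rho> id (tensor K M C m f))) =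
      ev M a (\<rho> (ev M b (tensor K M C m f)))" .
  qed
qed

text \<open>Double evaluations separate the two sides of the coassociativity law. The equivalence is
  read from left to right for a given comodule, and from right to left for A^0 and for coactions
  built from modules.\<close>

lemma coassoc_iff:
  assumes \<rho>: "\<rho> \<in> module_hom K M (tensor_space K M C)" and m: "m \<in> carrier M"
  shows "tensor_assoc K M C C (tensor_map K M C (tensor_space K M C) C \<rho> id (\<rho> m)) =
      tensor_map K M C M (tensor_space K C C) id (comult C) (\<rho> m) \<longleftrightarrow>
    (\<forall>a\<in>carrier A. \<forall>b\<in>carrier A. ev M (a \<otimes>\<^bsub>A\<^esub> b) (\<rho> m) = ev M a (\<rho> (ev M b (\<rho> m))))"
    (is "?l = ?r \<longleftrightarrow> ?R")
proof -
  interpret P: vs_pair K M C by (rule pair_C[OF M])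
  note \<rho>m = module_hom_mem[OF \<rho> m]
  have "?l \<in> carrier (tensor_space K M (tensor_space K C C))"
    by (intro module_hom_mem[OF tensor_assoc_hom[OF M C_vs C_vs]]
        module_hom_mem[OF P.tensor_map_hom[OF P.T_vs C_vs \<rho> id_hom[OF C_vs]]] \<rho>m)
  moreover have "?r \<in> carrier (tensor_space K M (tensor_space K C C))"
    by (intro module_hom_mem[OF P.tensor_map_hom[OF M CC_vs id_hom[OF M] comult_hom]] \<rho>m)
  ultimately have "?l = ?r \<longleftrightarrow> (\<forall>a\<in>carrier A. \<forall>b\<in>carrier A. ev2 M a b ?l = ev2 M a b ?r)"
    using ev2_eqI[of ?l ?r] by metis
  then show ?thesis
    by (simp add: comult_side[OF \<rho>m] coaction_side[OF \<rho> \<rho>m] eq_commute)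
qed

end

end

section \<open>Local units and the counit\<close>

context enough_idempotents
begin

definition e_sum :: "'r set \<Rightarrow> 'a" where
  "e_sum F = (\<Oplus>\<^bsub>A\<^esub>\<alpha>\<in>F. e \<alpha>)"

text \<open>The idempotent that works depends on the element at hand. Phrased with a filter,
  finitely many such demands combine into one by \<open>eventually_conj\<close> and
  \<open>eventually_ball_finite\<close>.\<close>

abbreviation large :: "('r set \<Rightarrow> bool) \<Rightarrow> bool" where
  "large Q \<equiv> eventually Q (finite_subsets_at_top R)"

lemma largeI:
  assumes "finite X" "X \<subseteq> R" "\<And>F. \<lbrakk>finite F; X \<subseteq> F; F \<subseteq> R\<rbrakk> \<Longrightarrow> Q F"
  shows "large Q"
  unfolding eventually_finite_subsets_at_top using assms by blast

lemma large_subsets: "large (\<lambda>F. finite F \<and> F \<subseteq> R)"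
  by (rule largeI[of "{}"]) auto

lemma large_obtain:
  assumes "large Q"
  obtains F where "finite F" "F \<subseteq> R" "Q F"
  using eventually_happens[OF eventually_conj[OF large_subsets assms]] by auto

lemma e_sum_closed [simp]: "F \<subseteq> R \<Longrightarrow> e_sum F \<in> carrier A"
  unfolding e_sum_def using e_closed by (intro A.M.finsum_closed) auto

lemma mult_zero [simp]:
  assumes "a \<in> carrier A"
  shows "a \<otimes>\<^bsub>A\<^esub> \<zero>\<^bsub>A\<^esub> = \<zero>\<^bsub>A\<^esub>" "\<zero>\<^bsub>A\<^esub> \<otimes>\<^bsub>A\<^esub> a = \<zero>\<^bsub>A\<^esub>"
  using module_hom_zero[OF A_vs A_vs bilinD(2)[OF mult_bilin assms]]
    module_hom_zero[OF A_vs A_vs bilinD(1)[OF mult_bilin assms]] by simp_all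

lemma e_mult_e_sum:
  assumes "finite F" "F \<subseteq> R" "\<alpha> \<in> F"
  shows "e \<alpha> \<otimes>\<^bsub>A\<^esub> e_sum F = e \<alpha>" "e_sum F \<otimes>\<^bsub>A\<^esub> e \<alpha> = e \<alpha>"
proof -
  have eA: "e \<beta> \<in> carrier A" if "\<beta> \<in> F" for \<beta> using e_closed assms that by auto
  have \<alpha>: "\<alpha> \<in> R" using assms by auto
  have "e \<alpha> \<otimes>\<^bsub>A\<^esub> e_sum F = (\<Oplus>\<^bsub>A\<^esub>\<beta>\<in>F. e \<alpha> \<otimes>\<^bsub>A\<^esub> e \<beta>)"
    unfolding e_sum_def using eA assms
    by (intro module_hom_finsum[OF A_vs A_vs bilinD(2)[OF mult_bilin]]) auto
  also have "\<dots> = (\<Oplus>\<^bsub>A\<^esub>\<beta>\<in>F. if \<alpha> = \<beta> then e \<beta> else \<zero>\<^bsub>A\<^esub>)"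
    using eA assms \<alpha> by (intro A.M.finsum_cong') (auto simp: e_idem e_orth subset_iff)
  also have "\<dots> = e \<alpha>" using eA assms by (intro A.M.finsum_singleton) auto
  finally show "e \<alpha> \<otimes>\<^bsub>A\<^esub> e_sum F = e \<alpha>" .
  have "e_sum F \<otimes>\<^bsub>A\<^esub> e \<alpha> = (\<Oplus>\<^bsub>A\<^esub>\<beta>\<in>F. e \<beta> \<otimes>\<^bsub>A\<^esub> e \<alpha>)"
    unfolding e_sum_def using eA assms
    by (intro module_hom_finsum[OF A_vs A_vs bilinD(1)[OF mult_bilin]]) auto
  also have "\<dots> = (\<Oplus>\<^bsub>A\<^esub>\<beta>\<in>F. if \<alpha> = \<beta> then e \<beta> else \<zero>\<^bsub>A\<^esub>)"
    using eA assms \<alpha> by (intro A.M.finsum_cong') (auto simp: e_idem e_orth subset_iff)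
  also have "\<dots> = e \<alpha>" using eA assms by (intro A.M.finsum_singleton) auto
  finally show "e_sum F \<otimes>\<^bsub>A\<^esub> e \<alpha> = e \<alpha>" .
qed

lemma e_sum_mult_e_outside:
  assumes "F \<subseteq> R" "\<alpha> \<in> R" "\<alpha> \<notin> F"
  shows "e_sum F \<otimes>\<^bsub>A\<^esub> e \<alpha> = \<zero>\<^bsub>A\<^esub>"
proof -
  have "e_sum F \<otimes>\<^bsub>A\<^esub> e \<alpha> = (\<Oplus>\<^bsub>A\<^esub>\<beta>\<in>F. e \<beta> \<otimes>\<^bsub>A\<^esub> e \<alpha>)"
    unfolding e_sum_def using assms e_closed
    by (intro module_hom_finsum[OF A_vs A_vs bilinD(1)[OF mult_bilin]]) auto
  also have "\<dots> = (\<Oplus>\<^bsub>A\<^esub>\<beta>\<in>F. \<zero>\<^bsub>A\<^esub>)"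
    using assms by (intro A.M.finsum_cong') (auto intro!: e_orth)
  finally show ?thesis by (simp add: A.M.finsum_zero)
qed

lemma internal_direct_sumE:
  assumes "internal_direct_sum A R S" "a \<in> carrier A"
  obtains x X where "finite X" "X \<subseteq> R" "\<And>\<alpha>. \<alpha> \<in> X \<Longrightarrow> x \<alpha> \<in> S \<alpha>" "\<And>\<alpha>. \<alpha> \<in> X \<Longrightarrow> x \<alpha> \<in> carrier A"
    "a = (\<Oplus>\<^bsub>A\<^esub>\<alpha>\<in>X. x \<alpha>)"
proof -
  have S: "\<forall>\<alpha>\<in>R. S \<alpha> \<subseteq> carrier A" using assms(1) by (simp add: internal_direct_sum_def)
  obtain x where x: "x \<in> (\<Pi>\<^sub>E \<alpha>\<in>R. S \<alpha>)" "finite {\<alpha>\<in>R. x \<alpha> \<noteq> \<zero>\<^bsub>A\<^esub>}"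
    "a = (\<Oplus>\<^bsub>A\<^esub>\<alpha>\<in>{\<alpha>\<in>R. x \<alpha> \<noteq> \<zero>\<^bsub>A\<^esub>}. x \<alpha>)"
    using assms unfolding internal_direct_sum_def by (meson ex1_implies_ex)
  show thesis
    by (rule that[OF x(2) _ _ _ x(3)]) (use x(1) S in auto)
qed

text \<open>Write a as a finite sum of elements b e_\<alpha>. Once F contains the indices that
  occur, e_\<alpha> e_F = e_\<alpha> by orthogonality and idempotence.\<close>

lemma mult_e_sum_large:
  assumes a: "a \<in> carrier A"
  shows "large (\<lambda>F. a \<otimes>\<^bsub>A\<^esub> e_sum F = a)"
proof -
  obtain x X where X: "finite X" "X \<subseteq> R"
    and xe: "\<And>\<alpha>. \<alpha> \<in> X \<Longrightarrow> x \<alpha> \<in> {b \<otimes>\<^bsub>A\<^esub> e \<alpha> | b. b \<in> carrier A}"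
    and xA: "\<And>\<alpha>. \<alpha> \<in> X \<Longrightarrow> x \<alpha> \<in> carrier A" and aeq: "a = (\<Oplus>\<^bsub>A\<^esub>\<alpha>\<in>X. x \<alpha>)"
    by (rule internal_direct_sumE[OF left_decomposition a]) blast
  show ?thesis
  proof (rule largeI[OF X])
    fix F assume F: "finite F" "X \<subseteq> F" "F \<subseteq> R"
    have x: "x \<alpha> \<otimes>\<^bsub>A\<^esub> e_sum F = x \<alpha>" if \<alpha>: "\<alpha> \<in> X" for \<alpha>
    proof -
      obtain b where b: "b \<in> carrier A" "x \<alpha> = b \<otimes>\<^bsub>A\<^esub> e \<alpha>" using xe[OF \<alpha>] by blast
      have "\<alpha> \<in> F" "e \<alpha> \<in> carrier A" using \<alpha> F e_closed by auto
      then show ?thesis using b F e_mult_e_sum(1)[of F \<alpha>] by (simp add: mult_assoc)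
    qed
    have "a \<otimes>\<^bsub>A\<^esub> e_sum F = (\<Oplus>\<^bsub>A\<^esub>\<alpha>\<in>X. x \<alpha> \<otimes>\<^bsub>A\<^esub> e_sum F)"
      unfolding aeq using xA F
      by (intro module_hom_finsum[OF A_vs A_vs bilinD(1)[OF mult_bilin]]) auto
    also have "\<dots> = a"
      unfolding aeq using xA by (intro A.M.finsum_cong') (auto simp: x)
    finally show "a \<otimes>\<^bsub>A\<^esub> e_sum F = a" .
  qed
qed

lemma e_sum_mult_large:
  assumes a: "a \<in> carrier A"
  shows "large (\<lambda>F. e_sum F \<otimes>\<^bsub>A\<^esub> a = a)"
proof -
  obtain x X where X: "finite X" "X \<subseteq> R"
    and xe: "\<And>\<alpha>. \<alpha> \<in> X \<Longrightarrow> x \<alpha> \<in> {e \<alpha> \<otimes>\<^bsub>A\<^esub> b | b. b \<in> carrier A}"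
    and xA: "\<And>\<alpha>. \<alpha> \<in> X \<Longrightarrow> x \<alpha> \<in> carrier A" and aeq: "a = (\<Oplus>\<^bsub>A\<^esub>\<alpha>\<in>X. x \<alpha>)"
    by (rule internal_direct_sumE[OF right_decomposition a]) blast
  show ?thesis
  proof (rule largeI[OF X])
    fix F assume F: "finite F" "X \<subseteq> F" "F \<subseteq> R"
    have x: "e_sum F \<otimes>\<^bsub>A\<^esub> x \<alpha> = x \<alpha>" if \<alpha>: "\<alpha> \<in> X" for \<alpha>
    proof -
      obtain b where b: "b \<in> carrier A" "x \<alpha> = e \<alpha> \<otimes>\<^bsub>A\<^esub> b" using xe[OF \<alpha>] by blast
      have "\<alpha> \<in> F" "e \<alpha> \<in> carrier A" using \<alpha> F e_closed by auto
      then show ?thesis using b F e_mult_e_sum(2)[of F \<alpha>] by (simp add: mult_assoc[symmetric])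
    qed
    have "e_sum F \<otimes>\<^bsub>A\<^esub> a = (\<Oplus>\<^bsub>A\<^esub>\<alpha>\<in>X. e_sum F \<otimes>\<^bsub>A\<^esub> x \<alpha>)"
      unfolding aeq using xA F
      by (intro module_hom_finsum[OF A_vs A_vs bilinD(2)[OF mult_bilin]]) auto
    also have "\<dots> = a"
      unfolding aeq using xA by (intro A.M.finsum_cong') (auto simp: x)
    finally show "e_sum F \<otimes>\<^bsub>A\<^esub> a = a" .
  qed
qed

text \<open>
  If \<open>A = span Y + I\<close> with \<open>Y\<close> finite, then all but finitely many \<open>e \<alpha>\<close> annihilate \<open>Y\<close> from the
  right; writing such an \<open>e \<alpha>\<close> as \<open>y + i\<close> gives \<open>e \<alpha> = e \<alpha> e \<alpha> = i e \<alpha> \<in> I\<close>.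
\<close>

lemma finite_support:
  assumes f: "f \<in> carrier C"
  shows "finite {\<alpha> \<in> R. f (e \<alpha>) \<noteq> \<zero>\<^bsub>K\<^esub>}"
proof -
  obtain I where I: "two_sided_ideal K A I" "vectorspace.fin_dim K (quotient_space A I)"
    "\<forall>x\<in>I. f x = \<zero>\<^bsub>K\<^esub>" using f by (rule C_memE)
  obtain Y where Y: "finite Y" "Y \<subseteq> carrier A"
    and Yv: "\<And>v. v \<in> carrier A \<Longrightarrow> \<exists>y\<in>module.span K A Y. v \<ominus>\<^bsub>A\<^esub> y \<in> I"
    by (rule fin_codim_span[OF two_sided_idealD(1)[OF I(1)] I(2)]) blast
  \<comment> \<open>One finite F serves all of Y; for \<alpha> outside F, y e_\<alpha> = y (e_F
    e_\<alpha>) = 0.\<close>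
  have "large (\<lambda>F. \<forall>y\<in>Y. y \<otimes>\<^bsub>A\<^esub> e_sum F = y)"
    using Y mult_e_sum_large by (intro eventually_ball_finite) auto
  then obtain F where F: "finite F" "F \<subseteq> R" "\<forall>y\<in>Y. y \<otimes>\<^bsub>A\<^esub> e_sum F = y" by (rule large_obtain)
  have "f (e \<alpha>) = \<zero>\<^bsub>K\<^esub>" if \<alpha>: "\<alpha> \<in> R" "\<alpha> \<notin> F" for \<alpha>
  proof -
    have e\<alpha>: "e \<alpha> \<in> carrier A" using e_closed \<alpha> by auto
    note h = bilinD(1)[OF mult_bilin e\<alpha>]
    have "y \<otimes>\<^bsub>A\<^esub> e \<alpha> = \<zero>\<^bsub>A\<^esub>" if y: "y \<in> Y" for y
    proof -
      have yA: "y \<in> carrier A" using y Y by auto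
      have "y \<otimes>\<^bsub>A\<^esub> e \<alpha> = (y \<otimes>\<^bsub>A\<^esub> e_sum F) \<otimes>\<^bsub>A\<^esub> e \<alpha>" using F(3) y by simp
      also have "\<dots> = y \<otimes>\<^bsub>A\<^esub> (e_sum F \<otimes>\<^bsub>A\<^esub> e \<alpha>)" using yA e\<alpha> F(2) by (intro mult_assoc) auto
      also have "\<dots> = \<zero>\<^bsub>A\<^esub>" using e_sum_mult_e_outside[OF F(2) \<alpha>] yA by simp
      finally show ?thesis .
    qed
    then have "Y \<subseteq> {v \<in> carrier A. v \<otimes>\<^bsub>A\<^esub> e \<alpha> \<in> {\<zero>\<^bsub>A\<^esub>}}" using Y by auto
    moreover have "subspace K {v \<in> carrier A. v \<otimes>\<^bsub>A\<^esub> e \<alpha> \<in> {\<zero>\<^bsub>A\<^esub>}} A"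
      by (rule subspace_vimage[OF A_vs A_vs h]) (auto intro!: subspaceI[OF A_vs])
    ultimately have sp: "module.span K A Y \<subseteq> {v \<in> carrier A. v \<otimes>\<^bsub>A\<^esub> e \<alpha> \<in> {\<zero>\<^bsub>A\<^esub>}}"
      by (intro span_least)
    obtain y where y: "y \<in> module.span K A Y" "e \<alpha> \<ominus>\<^bsub>A\<^esub> y \<in> I" using Yv[OF e\<alpha>] by blast
    then have yA: "y \<in> carrier A" "y \<otimes>\<^bsub>A\<^esub> e \<alpha> = \<zero>\<^bsub>A\<^esub>" using sp by auto
    have "(e \<alpha> \<ominus>\<^bsub>A\<^esub> y) \<otimes>\<^bsub>A\<^esub> e \<alpha> = e \<alpha> \<ominus>\<^bsub>A\<^esub> \<zero>\<^bsub>A\<^esub>"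
      using module_hom_minus[OF A_vs A_vs h e\<alpha> yA(1)] yA(2) e_idem[OF \<alpha>(1)] by simp
    also have "\<dots> = e \<alpha>" using e\<alpha> A.M.add.inv_one by (simp add: a_minus_def a_inv_def)
    finally have "e \<alpha> \<in> I" using two_sided_idealD(4)[OF I(1) e\<alpha> y(2)] by simp
    then show ?thesis using I(3) by simp
  qed
  then have "{\<alpha> \<in> R. f (e \<alpha>) \<noteq> \<zero>\<^bsub>K\<^esub>} \<subseteq> F" by auto
  then show ?thesis using F(1) by (rule finite_subset)
qed

text \<open>Enlarging the support to F adds only zero terms, and linearity of f collects the sum
  into f(e_F). How large F must be depends on f, so the counit is an evaluation only
  eventually.\<close>

lemma counit_large:
  assumes f: "f \<in> carrier C"
  shows "large (\<lambda>F. counit C f = f (e_sum F))"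
proof (rule largeI[OF finite_support[OF f]])
  let ?S = "{\<alpha> \<in> R. f (e \<alpha>) \<noteq> \<zero>\<^bsub>K\<^esub>}"
  fix F assume F: "finite F" "?S \<subseteq> F" "F \<subseteq> R"
  have "f (e_sum F) = (\<Oplus>\<^bsub>base_space K\<^esub>\<alpha>\<in>F. f (e \<alpha>))"
    unfolding e_sum_def using F e_closed
    by (intro module_hom_finsum[OF A_vs base_vs C_hom[OF f]]) auto
  also have "\<dots> = (\<Oplus>\<^bsub>K\<^esub>\<alpha>\<in>F. f (e \<alpha>))" by (simp add: finsum_def finprod_def)
  also have "\<dots> = (\<Oplus>\<^bsub>K\<^esub>\<alpha>\<in>?S. f (e \<alpha>))"
    using F e_closed f by (intro A.R.add.finprod_mono_neutral_cong_right) auto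
  also have "\<dots> = counit C f" by (simp add: finite_dual_def Let_def)
  finally show "counit C f = f (e_sum F)" by simp
qed auto

text \<open>For each law a single F is chosen at which the counits of all elements involved are
  evaluations; there the law is pointwise.\<close>

lemma counit_hom: "counit C \<in> module_hom K C (base_space K)"
proof (rule module_homI)
  show "counit C f \<in> carrier (base_space K)" if f: "f \<in> carrier C" for f
    using counit_large[OF f] by (rule large_obtain) (use f in auto)
  show "counit C (f \<oplus>\<^bsub>C\<^esub> g) = counit C f \<oplus>\<^bsub>base_space K\<^esub> counit C g"
    if f: "f \<in> carrier C" and g: "g \<in> carrier C" for f g
    using eventually_conj[OF counit_large[OF C_closed(2)[OF f g]]
      eventually_conj[OF counit_large[OF f] counit_large[OF g]]]
    by (rule large_obtain) (use f g in \<open>auto simp: C_sel(3)\<close>)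
  show "counit C (c \<odot>\<^bsub>C\<^esub> f) = c \<odot>\<^bsub>base_space K\<^esub> counit C f"
    if c: "c \<in> carrier K" and f: "f \<in> carrier C" for c f
    using eventually_conj[OF counit_large[OF C_closed(3)[OF c f]] counit_large[OF f]]
    by (rule large_obtain) (use f c in \<open>auto simp: C_sel(4)\<close>)
qed

text \<open>A presentation of t involves finitely many elements of A^0, so one F turns all of their
  counits into evaluations at e_F.\<close>

lemma counit_lift_large:
  assumes M: "vectorspace K M" and t: "t \<in> carrier (tensor_space K M C)"
  shows "large (\<lambda>F. tensor_lift K M C M (\<lambda>x c. counit C c \<odot>\<^bsub>M\<^esub> x) t = ev M (e_sum F) t)"
proof -
  interpret M: vectorspace K M by fact
  interpret P: vs_pair K M C by (rule pair_C[OF M])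
  note b = functional_bilin[OF M counit_hom]
  obtain n :: nat and v w where vw: "v \<in> {..<n} \<rightarrow> carrier M" "w \<in> {..<n} \<rightarrow> carrier C"
    and teq: "t = (\<Oplus>\<^bsub>tensor_space K M C\<^esub>i\<in>{..<n}. tensor K M C (v i) (w i))"
    using t by (rule P.tensor_expand)
  have c: "v i \<in> carrier M" "w i \<in> carrier C" if "i < n" for i using vw that by auto
  have tc: "(\<lambda>i. tensor K M C (v i) (w i)) \<in> {..<n} \<rightarrow> carrier (tensor_space K M C)" using c by auto
  have "large (\<lambda>F. (finite F \<and> F \<subseteq> R) \<and> (\<forall>i\<in>{..<n}. counit C (w i) = w i (e_sum F)))"
    using counit_large c large_subsets by (intro eventually_conj eventually_ball_finite) auto
  then show ?thesis
  proof (rule eventually_mono)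
    fix F assume F: "(finite F \<and> F \<subseteq> R) \<and> (\<forall>i\<in>{..<n}. counit C (w i) = w i (e_sum F))"
    then have e: "e_sum F \<in> carrier A" by simp
    have "tensor_lift K M C M (\<lambda>x c. counit C c \<odot>\<^bsub>M\<^esub> x) t =
      (\<Oplus>\<^bsub>M\<^esub>i\<in>{..<n}. tensor_lift K M C M (\<lambda>x c. counit C c \<odot>\<^bsub>M\<^esub> x) (tensor K M C (v i) (w i)))"
      unfolding teq by (rule module_hom_finsum[OF P.T_vs M P.tensor_lift_hom[OF M b] tc])
    also have "\<dots> = (\<Oplus>\<^bsub>M\<^esub>i\<in>{..<n}. ev M (e_sum F) (tensor K M C (v i) (w i)))"
      using c F e by (intro M.M.finsum_cong')
        (auto simp: P.tensor_lift_tensor[OF M b] ev_tensor[OF M e])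
    also have "\<dots> = ev M (e_sum F) t"
      unfolding teq by (rule module_hom_finsum[OF P.T_vs M ev_hom[OF M e] tc, symmetric])
    finally show "tensor_lift K M C M (\<lambda>x c. counit C c \<odot>\<^bsub>M\<^esub> x) t = ev M (e_sum F) t" .
  qed
qed

text \<open>Here the counit falls on the first factor, while \<open>ev\<close> contracts the second,
  so the result is tested at y. On u \<otimes> v both sides become u(e_F) v(y).\<close>

lemma counit_left_lift_large:
  assumes t: "t \<in> carrier (tensor_space K C C)" and y: "y \<in> carrier A"
  shows "large (\<lambda>F. tensor_lift K C C C (\<lambda>c x. counit C c \<odot>\<^bsub>C\<^esub> x) t y = ev C y t (e_sum F))"
proof -
  interpret C: vectorspace K C by (rule C_vs)
  interpret P: vs_pair K C C by (rule pair_C[OF C_vs])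
  note b = bilin_swap[OF functional_bilin[OF C_vs counit_hom]]
  note l = module_hom_comp[OF P.tensor_lift_hom[OF C_vs b] eval_hom[OF y]]
  obtain n :: nat and v w where vw: "v \<in> {..<n} \<rightarrow> carrier C" "w \<in> {..<n} \<rightarrow> carrier C"
    and teq: "t = (\<Oplus>\<^bsub>tensor_space K C C\<^esub>i\<in>{..<n}. tensor K C C (v i) (w i))"
    using t by (rule P.tensor_expand)
  have c: "v i \<in> carrier C" "w i \<in> carrier C" if "i < n" for i using vw that by auto
  have tc: "(\<lambda>i. tensor K C C (v i) (w i)) \<in> {..<n} \<rightarrow> carrier (tensor_space K C C)" using c by auto
  interpret B: vectorspace K "base_space K" by (rule base_vs)
  have "large (\<lambda>F. (finite F \<and> F \<subseteq> R) \<and> (\<forall>i\<in>{..<n}. counit C (v i) = v i (e_sum F)))"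
    using counit_large c large_subsets by (intro eventually_conj eventually_ball_finite) auto
  then show ?thesis
  proof (rule eventually_mono)
    fix F assume F: "(finite F \<and> F \<subseteq> R) \<and> (\<forall>i\<in>{..<n}. counit C (v i) = v i (e_sum F))"
    then have e: "e_sum F \<in> carrier A" by simp
    have "tensor_lift K C C C (\<lambda>c x. counit C c \<odot>\<^bsub>C\<^esub> x) t y =
      (\<Oplus>\<^bsub>base_space K\<^esub>i\<in>{..<n}. tensor_lift K C C C (\<lambda>c x. counit C c \<odot>\<^bsub>C\<^esub> x) (tensor K C C (v i) (w i)) y)"
      unfolding teq by (rule module_hom_finsum[OF P.T_vs base_vs l tc])
    also have "\<dots> = (\<Oplus>\<^bsub>base_space K\<^esub>i\<in>{..<n}. ev C y (tensor K C C (v i) (w i)) (e_sum F))"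
    proof (rule B.M.finsum_cong')
      show "(\<lambda>i. ev C y (tensor K C C (v i) (w i)) (e_sum F)) \<in> {..<n} \<rightarrow> carrier (base_space K)"
        using c y e by (auto simp: ev_tensor[OF C_vs y] C_closed)
      fix i assume i: "i \<in> {..<n}"
      then have "tensor_lift K C C C (\<lambda>c x. counit C c \<odot>\<^bsub>C\<^esub> x) (tensor K C C (v i) (w i)) =
          counit C (v i) \<odot>\<^bsub>C\<^esub> w i"
        using c by (intro P.tensor_lift_tensor[OF C_vs b]) auto
      then show "tensor_lift K C C C (\<lambda>c x. counit C c \<odot>\<^bsub>C\<^esub> x) (tensor K C C (v i) (w i)) y =
          ev C y (tensor K C C (v i) (w i)) (e_sum F)"
        using i c F e y by (simp add: ev_tensor[OF C_vs y] C_sel(4) A.R.m_comm)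
    qed simp
    also have "\<dots> = ev C y t (e_sum F)"
      unfolding teq by (rule module_hom_finsum[OF P.T_vs base_vs ev_eval_hom[OF e y] tc, symmetric])
    finally show "tensor_lift K C C C (\<lambda>c x. counit C c \<odot>\<^bsub>C\<^esub> x) t y = ev C y t (e_sum F)" .
  qed
qed

text \<open>Coassociativity is the action law of \<open>reg\<close>. At a point y the left counit
  axiom reads f(e_F y) = f(y) and the right one f(y e_F) = f(y); F may depend on y because
  functionals are compared pointwise.\<close>

lemma C_coalgebra: "coalgebra K C"
proof (intro coalgebra.intro coalgebra_axioms.intro)
  interpret P: vs_pair K C C by (rule pair_C[OF C_vs])
  show "vectorspace K C" by (rule C_vs)
  show "comult C \<in> module_hom K C (tensor_space K C C)" by (rule comult_hom)
  show "counit C \<in> module_hom K C (base_space K)" by (rule counit_hom)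
  fix f assume f: "f \<in> carrier C"
  note \<Delta> = comult_closed[OF f]
  show "tensor_assoc K C C C (tensor_map K C C (tensor_space K C C) C (comult C) id (comult C f)) =
    tensor_map K C C C (tensor_space K C C) id (comult C) (comult C f)"
    unfolding coassoc_iff[OF C_vs comult_hom f]
    using f is_actionD(2)[OF reg_action] by (simp add: ev_comult mult_closed reg_closed)
  show "tensor_lift K C C C (\<lambda>x y. counit C x \<odot>\<^bsub>C\<^esub> y) (comult C f) = f" (is "?l = f")
  proof (rule C_eqI[OF _ f])
    show "?l \<in> carrier C"
      by (rule module_hom_mem[OF P.tensor_lift_hom[OF C_vs bilin_swap[OF functional_bilin[OF C_vs counit_hom]]] \<Delta>])
    fix y assume y: "y \<in> carrier A"
    obtain F where "F \<subseteq> R" "?l y = ev C y (comult C f) (e_sum F)" "e_sum F \<otimes>\<^bsub>A\<^esub> y = y"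
      using eventually_conj[OF counit_left_lift_large[OF \<Delta> y] e_sum_mult_large[OF y]]
      by (rule large_obtain) auto
    then show "?l y = f y" using y by (simp add: ev_comult[OF f y] reg_def)
  qed
  show "tensor_lift K C C C (\<lambda>x y. counit C y \<odot>\<^bsub>C\<^esub> x) (comult C f) = f" (is "?l = f")
  proof (rule C_eqI[OF _ f])
    show "?l \<in> carrier C"
      by (rule module_hom_mem[OF P.tensor_lift_hom[OF C_vs functional_bilin[OF C_vs counit_hom]] \<Delta>])
    fix y assume y: "y \<in> carrier A"
    obtain F where "F \<subseteq> R" "?l = ev C (e_sum F) (comult C f)" "y \<otimes>\<^bsub>A\<^esub> e_sum F = y"
      using eventually_conj[OF counit_lift_large[OF C_vs \<Delta>] mult_e_sum_large[OF y]]
      by (rule large_obtain) auto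
    then show "?l y = f y" using y by (simp add: ev_comult[OF f] reg_def)
  qed
qed

end

section \<open>The two functors\<close>

lemma subspace_finsum:
  assumes N: "subspace K N V" and g: "\<And>i. i \<in> I \<Longrightarrow> g i \<in> N"
  shows "(\<Oplus>\<^bsub>V\<^esub>i\<in>I. g i) \<in> N"
proof -
  interpret V: vectorspace K V using subspaceD[OF N] by simp
  show ?thesis using g
  proof (induction I rule: infinite_finite_induct)
    case (infinite I)
    then show ?case using subspaceD(3)[OF N] by (simp add: V.M.finsum_infinite)
  next
    case empty
    then show ?case using subspaceD(3)[OF N] by simp
  next
    case (insert i I)
    have "g \<in> I \<rightarrow> carrier V" "g i \<in> carrier V" using insert.prems subspaceD(2)[OF N] by auto
    then show ?case using insert subspaceD(4)[OF N] by (simp add: V.M.finsum_insert)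
  qed
qed

text \<open>Morphisms in both categories are functions on carriers. That they are extensional makes
  the identity laws hold as equalities of functions.\<close>

lemma concrete_category:
  fixes X :: "('k, 'v, 'm) module_scheme set"
  assumes fn: "\<And>M N f. \<lbrakk>M \<in> X; N \<in> X; f \<in> H M N\<rbrakk> \<Longrightarrow> f \<in> carrier M \<rightarrow> carrier N \<and> f \<in> extensional (carrier M)"
    and ident: "\<And>M. M \<in> X \<Longrightarrow> (\<lambda>m\<in>carrier M. m) \<in> H M M"
    and comp: "\<And>L M N f g. \<lbrakk>L \<in> X; M \<in> X; N \<in> X; f \<in> H L M; g \<in> H M N\<rbrakk> \<Longrightarrow> compose (carrier L) g f \<in> H L N"
  shows "category \<lparr>Obj = X, Hom = H, Ident = (\<lambda>M. \<lambda>m\<in>carrier M. m),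
    Comp = (\<lambda>L M N g f. compose (carrier L) g f)\<rparr>"
proof (unfold_locales, simp_all add: ident comp)
  fix M N f assume "M \<in> X" "N \<in> X" "f \<in> H M N"
  from fn[OF this] have f: "f \<in> carrier M \<rightarrow> carrier N" "f \<in> extensional (carrier M)" by auto
  show "compose (carrier M) f (\<lambda>m\<in>carrier M. m) = f"
    using f(2) by (auto simp: compose_def fun_eq_iff extensional_def)
  show "compose (carrier M) (\<lambda>m\<in>carrier N. m) f = f"
    using f by (auto simp: compose_def fun_eq_iff extensional_def Pi_iff)
next
  fix L M N P f g h
  assume "L \<in> X" "M \<in> X" "N \<in> X" "P \<in> X" "f \<in> H L M" "g \<in> H M N" "h \<in> H N P"
  then show "compose (carrier L) (compose (carrier M) h g) f = compose (carrier L) h (compose (carrier L) g f)"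
    using fn[of L M f] by (auto simp: compose_def fun_eq_iff Pi_iff)
qed

lemma lmodule_hom_ident:
  assumes "vectorspace K M" "\<And>a m. \<lbrakk>a \<in> carrier A; m \<in> carrier M\<rbrakk> \<Longrightarrow> act M a m \<in> carrier M"
  shows "(\<lambda>m\<in>carrier M. m) \<in> lmodule_hom K A M M"
proof -
  have "(\<lambda>m\<in>carrier M. m) \<in> module_hom K M M"
    by (rule module_hom_cong[OF id_hom[OF assms(1)] assms(1)]) simp
  then show ?thesis using assms(2) by (simp add: lmodule_hom_def)
qed

lemma lmodule_hom_compose:
  assumes "vectorspace K L" "f \<in> lmodule_hom K A L M" "g \<in> lmodule_hom K A M N"
    and "\<And>a m. \<lbrakk>a \<in> carrier A; m \<in> carrier L\<rbrakk> \<Longrightarrow> act L a m \<in> carrier L"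
  shows "compose (carrier L) g f \<in> lmodule_hom K A L N"
proof -
  have f: "f \<in> module_hom K L M" and g: "g \<in> module_hom K M N"
    using assms by (auto simp: lmodule_hom_def)
  have "compose (carrier L) g f \<in> module_hom K L N"
    by (rule module_hom_cong[OF module_hom_comp[OF f g] assms(1)]) (simp add: compose_def)
  then show ?thesis
    using assms(2-4) module_hom_mem[OF f] by (auto simp: lmodule_hom_def compose_def)
qed

context enough_idempotents
begin

text \<open>Passing between comodules and modules changes the type of the record but not its vector
  space, so the evaluations must be identified explicitly.\<close>

lemma ev_cong:
  assumes "carrier M' = carrier M" "zero M' = zero M" "add M' = add M" "smult M' = smult M"
  shows "ev M' = ev M"
  unfolding ev_def tensor_lift_def
  by (simp add: fun_eq_iff assms tensor_space_cong[of M' M C C] finsum_def finprod_def)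

lemma left_module_iff: "left_module K A M \<longleftrightarrow> vectorspace K M \<and> is_action M (act M)"
proof
  assume "left_module K A M"
  then interpret M: left_module K A M .
  show "vectorspace K M \<and> is_action M (act M)"
    unfolding is_action_def
    by (intro conjI bilinI module_homI ballI)
      (auto simp: M.act_closed M.act_add_l M.act_add_r M.act_smult_l M.act_smult_r M.act_mult
        M.M.vectorspace_axioms)
next
  assume "vectorspace K M \<and> is_action M (act M)"
  then have M: "vectorspace K M" and act: "is_action M (act M)" by auto
  note b = is_actionD(1)[OF act]
  show "left_module K A M"
    by (intro left_module.intro left_module_axioms.intro assoc_algebra_axioms M)
      (auto simp: is_actionD(2,3)[OF act] module_hom_add[OF bilinD(1)[OF b]] module_hom_smult[OF bilinD(1)[OF b]]
        module_hom_add[OF bilinD(2)[OF b]] module_hom_smult[OF bilinD(2)[OF b]])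
qed

lemma is_action_cong:
  assumes "is_action M \<alpha>" "vectorspace K M"
    and "\<And>a m. \<lbrakk>a \<in> carrier A; m \<in> carrier M\<rbrakk> \<Longrightarrow> \<beta> a m = \<alpha> a m"
    and "carrier N = carrier M" "add N = add M" "smult N = smult M"
  shows "is_action N \<beta>"
proof -
  interpret M: vectorspace K M by fact
  note b = is_actionD(1)[OF assms(1)]
  show ?thesis
    unfolding is_action_def
    by (intro conjI bilinI module_homI ballI)
      (auto simp: assms(3-6) is_actionD(2,3)[OF assms(1)] mult_closed
        module_hom_add[OF bilinD(1)[OF b]] module_hom_smult[OF bilinD(1)[OF b]]
        module_hom_add[OF bilinD(2)[OF b]] module_hom_smult[OF bilinD(2)[OF b]])
qed

text \<open>Outside the carriers the action is \<open>undefined\<close>, matching the normalization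
  of objects of \<open>lmodule_category\<close>, so that a round trip returns the same
  record.\<close>

definition to_lmodule :: "('k, 'a \<Rightarrow> 'k, 'v) comodule \<Rightarrow> ('k, 'a, 'v) lmodule" where
  "to_lmodule M = \<lparr>carrier = carrier M, mult = mult M, one = one M, zero = zero M, add = add M,
     smult = smult M,
     act = (\<lambda>a m. if a \<in> carrier A \<and> m \<in> carrier M then ev M a (coact M m) else undefined)\<rparr>"

text \<open>The described tensor is unique by \<open>ev_eqI\<close>. It exists for locally finite N,
  by \<open>coaction_exists\<close> for the submodule generated by m.\<close>

definition to_comodule :: "('k, 'a, 'v) lmodule \<Rightarrow> ('k, 'a \<Rightarrow> 'k, 'v) comodule" where
  "to_comodule N = \<lparr>carrier = carrier N, mult = mult N, one = one N, zero = zero N, add = add N,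
     smult = smult N,
     coact = (\<lambda>m\<in>carrier N. THE t. t \<in> carrier (tensor_space K N C) \<and>
       (\<forall>a\<in>carrier A. ev N a t = act N a m))\<rparr>"

lemma to_lmodule_sel [simp]:
  "carrier (to_lmodule M) = carrier M" "mult (to_lmodule M) = mult M" "one (to_lmodule M) = one M"
  "zero (to_lmodule M) = zero M" "add (to_lmodule M) = add M" "smult (to_lmodule M) = smult M"
  by (simp_all add: to_lmodule_def)

lemma act_to_lmodule:
  "\<lbrakk>a \<in> carrier A; m \<in> carrier M\<rbrakk> \<Longrightarrow> act (to_lmodule M) a m = ev M a (coact M m)"
  "\<not> (a \<in> carrier A \<and> m \<in> carrier M) \<Longrightarrow> act (to_lmodule M) a m = undefined"
  by (auto simp: to_lmodule_def)

lemma to_comodule_sel [simp]: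
  "carrier (to_comodule N) = carrier N" "mult (to_comodule N) = mult N" "one (to_comodule N) = one N"
  "zero (to_comodule N) = zero N" "add (to_comodule N) = add N" "smult (to_comodule N) = smult N"
  by (simp_all add: to_comodule_def)

lemma generated_submodule_least:
  "\<lbrakk>act_submodule K A N L; m \<in> L\<rbrakk> \<Longrightarrow> generated_submodule K A N m \<subseteq> L"
  by (auto simp: generated_submodule_def)

lemma generated_submodule:
  assumes N: "vectorspace K N" and act: "is_action N (act N)" and m: "m \<in> carrier N"
  shows "act_submodule K A N (generated_submodule K A N m)" "m \<in> generated_submodule K A N m"
proof -
  interpret N: vectorspace K N by fact
  \<comment> \<open>The whole module is a member of the intersected family, which keeps the
    generated submodule inside the carrier.\<close>
  have top: "act_submodule K A N (carrier N)"
    using is_actionD(3)[OF act] by (auto simp: act_submodule_def intro!: subspaceI[OF N])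
  show "m \<in> generated_submodule K A N m" by (auto simp: generated_submodule_def)
  show "act_submodule K A N (generated_submodule K A N m)"
    unfolding act_submodule_def
  proof (intro conjI ballI subspaceI[OF N])
    show "generated_submodule K A N m \<subseteq> carrier N"
      by (rule generated_submodule_least[OF top m])
  qed (auto simp: generated_submodule_def act_submodule_def dest: subspaceD(3-5))
qed

section \<open>From comodules to locally finite unital modules\<close>

context
  fixes M :: "('k, 'a \<Rightarrow> 'k, 'v) comodule"
  assumes rc: "right_comodule K C M"
begin

lemma comodule_vs: "vectorspace K M"
  using rc by (simp add: right_comodule_def)

lemma coact_hom: "coact M \<in> module_hom K M (tensor_space K M C)"
  by (rule right_comodule.coact_linear[OF rc])

lemma coact_closed: "m \<in> carrier M \<Longrightarrow> coact M m \<in> carrier (tensor_space K M C)"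
  by (rule module_hom_mem[OF coact_hom])

lemma comodule_action: "is_action M (\<lambda>a m. ev M a (coact M m))"
  unfolding is_action_def
proof (intro conjI ballI bilinI)
  show "(\<lambda>a. ev M a (coact M m)) \<in> module_hom K A M" if "m \<in> carrier M" for m
    by (rule ev_hom_arg[OF comodule_vs coact_closed[OF that]])
  show "(\<lambda>m. ev M a (coact M m)) \<in> module_hom K M M" if "a \<in> carrier A" for a
    by (rule module_hom_comp[OF coact_hom ev_hom[OF comodule_vs that]])
  show "ev M (a \<otimes>\<^bsub>A\<^esub> b) (coact M m) = ev M a (coact M (ev M b (coact M m)))"
    if "a \<in> carrier A" "b \<in> carrier A" "m \<in> carrier M" for a b m
    using coassoc_iff[OF comodule_vs coact_hom that(3)] right_comodule.coact_coassoc[OF rc that(3)] that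
    by simp
qed

lemma comodule_unit_large:
  assumes m: "m \<in> carrier M"
  shows "large (\<lambda>F. ev M (e_sum F) (coact M m) = m)"
  using counit_lift_large[OF comodule_vs coact_closed[OF m]]
  by (rule eventually_mono) (simp add: right_comodule.coact_counit[OF rc m])

lemma to_lmodule_left_module: "left_module K A (to_lmodule M)"
  unfolding left_module_iff
proof
  show "vectorspace K (to_lmodule M)"
    by (rule vectorspace_record_cong[OF comodule_vs]) simp_all
  show "is_action (to_lmodule M) (act (to_lmodule M))"
    by (rule is_action_cong[OF comodule_action comodule_vs]) (simp_all add: act_to_lmodule)
qed

lemma to_lmodule_unital: "unital_module K A (to_lmodule M)"
proof -
  have N: "vectorspace K (to_lmodule M)" and act: "is_action (to_lmodule M) (act (to_lmodule M))"
    using to_lmodule_left_module by (simp_all add: left_module_iff)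
  let ?S = "{act (to_lmodule M) a m | a m. a \<in> carrier A \<and> m \<in> carrier (to_lmodule M)}"
  have S: "?S \<subseteq> carrier (to_lmodule M)" using is_actionD(3)[OF act] by auto
  have "carrier (to_lmodule M) \<subseteq> module.span K (to_lmodule M) ?S"
  proof
    fix m assume m: "m \<in> carrier (to_lmodule M)"
    then obtain F where F: "F \<subseteq> R" "ev M (e_sum F) (coact M m) = m"
      using comodule_unit_large[of m] by (auto elim: large_obtain)
    then have "m = act (to_lmodule M) (e_sum F) m" using m by (simp add: act_to_lmodule)
    then have "m \<in> ?S" using F(1) m e_sum_closed[OF F(1)] by blast
    then show "m \<in> module.span K (to_lmodule M) ?S" using span_superset[OF N S] by auto
  qed
  then show ?thesis
    unfolding unital_module_def using subspaceD(2)[OF subspace_span[OF N S]] by auto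
qed

text \<open>A m is a submodule, and it contains m because e_F m = m for large F; hence it contains
  the submodule generated by m. It lies in the span of the first components of a presentation of the
  coaction at m.\<close>

lemma to_lmodule_locally_finite: "locally_finite K A (to_lmodule M)"
  unfolding locally_finite_def
proof
  let ?N = "to_lmodule M"
  have N: "vectorspace K ?N" and act: "is_action ?N (act ?N)"
    using to_lmodule_left_module by (simp_all add: left_module_iff)
  interpret N: vectorspace K ?N by (rule N)
  fix m assume "m \<in> carrier ?N"
  then have m: "m \<in> carrier M" by simp
  interpret P: vs_pair K M C by (rule pair_C[OF comodule_vs])
  obtain n :: nat and v w where vw: "v \<in> {..<n} \<rightarrow> carrier M" "w \<in> {..<n} \<rightarrow> carrier C"
    and t: "coact M m = (\<Oplus>\<^bsub>tensor_space K M C\<^esub>i\<in>{..<n}. tensor K M C (v i) (w i))"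
    using coact_closed[OF m] by (rule P.tensor_expand)
  have c: "v i \<in> carrier M" "w i \<in> carrier C" if "i < n" for i using vw that by auto
  let ?S = "v ` {..<n}"
  have S: "?S \<subseteq> carrier ?N" using c by auto
  note sp = subspace_span[OF comodule_vs S[simplified]]
  let ?L = "(\<lambda>a. act ?N a m) ` carrier A"
  have "subspace K (carrier A) A" by (rule subspaceI[OF A_vs]) auto
  then have "subspace K ?L ?N"
    using bilinD(1)[OF is_actionD(1)[OF act]] m by (intro subspace_image[OF A_vs N]) auto
  moreover have "act ?N a x \<in> ?L" if "a \<in> carrier A" "x \<in> ?L" for a x
  proof -
    from that obtain b where "b \<in> carrier A" "x = act ?N b m" by auto
    then have "act ?N a x = act ?N (a \<otimes>\<^bsub>A\<^esub> b) m" "a \<otimes>\<^bsub>A\<^esub> b \<in> carrier A"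
      using is_actionD(2)[OF act] that(1) m by (auto simp: mult_closed)
    then show ?thesis by blast
  qed
  ultimately have L: "act_submodule K A ?N ?L" by (auto simp: act_submodule_def)
  obtain F where F: "F \<subseteq> R" "ev M (e_sum F) (coact M m) = m"
    using comodule_unit_large[OF m] by (auto elim: large_obtain)
  then have "m = act ?N (e_sum F) m" using m by (simp add: act_to_lmodule)
  then have "m \<in> ?L" using e_sum_closed[OF F(1)] by blast
  then have sub: "generated_submodule K A ?N m \<subseteq> ?L" by (rule generated_submodule_least[OF L])
  have "act ?N a m \<in> module.span K M ?S" if a: "a \<in> carrier A" for a
  proof -
    have "act ?N a m = ev M a (coact M m)" using a m by (simp add: act_to_lmodule)
    also have "\<dots> = (\<Oplus>\<^bsub>M\<^esub>i\<in>{..<n}. ev M a (tensor K M C (v i) (w i)))"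
      unfolding t using c by (intro module_hom_finsum[OF P.T_vs comodule_vs ev_hom[OF comodule_vs a]]) auto
    also have "\<dots> \<in> module.span K M ?S"
    proof (rule subspace_finsum[OF sp])
      fix i assume i: "i \<in> {..<n}"
      then have "v i \<in> module.span K M ?S" using span_superset[OF comodule_vs S[simplified]] by auto
      then show "ev M a (tensor K M C (v i) (w i)) \<in> module.span K M ?S"
        using subspaceD(5)[OF sp] c i a by (simp add: ev_tensor[OF comodule_vs a])
    qed
    finally show ?thesis .
  qed
  then have "?L \<subseteq> module.span K M ?S" by auto
  \<comment> \<open>The spans are taken in records of different types; the identity is a linear map
    between them.\<close>
  moreover have "module.span K M ?S = module.span K ?N ?S"
    using span_image[OF comodule_vs N, of id ?S] S by (auto simp: module_hom_def)
  ultimately have "generated_submodule K A ?N m \<subseteq> module.span K ?N ?S" using sub by auto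
  then show "vectorspace.fin_dim K (?N\<lparr>carrier := generated_submodule K A ?N m\<rparr>)"
    using generated_submodule(1)[OF N act, of m] m S
    by (intro fin_dim_subspace) (auto simp: act_submodule_def)
qed

lemma to_comodule_to_lmodule:
  assumes "coact M \<in> extensional (carrier M)"
  shows "to_comodule (to_lmodule M) = M"
proof (rule comodule.equality)
  have T: "tensor_space K (to_lmodule M) C = tensor_space K M C"
    by (rule tensor_space_cong) simp_all
  have E: "ev (to_lmodule M) = ev M" by (rule ev_cong) simp_all
  have "(THE t. t \<in> carrier (tensor_space K M C) \<and> (\<forall>a\<in>carrier A. ev M a t = act (to_lmodule M) a m)) =
    coact M m" if m: "m \<in> carrier M" for m
    using coact_closed[OF m] m by (intro the_equality ev_eqI[OF comodule_vs]) (auto simp: act_to_lmodule)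
  then show "coact (to_comodule (to_lmodule M)) = coact M"
    using assms by (auto simp: to_comodule_def T E extensional_def fun_eq_iff)
qed simp_all

end

section \<open>From locally finite unital modules to comodules\<close>

context
  fixes N :: "('k, 'a, 'v) lmodule"
  assumes lm: "left_module K A N" and lf: "locally_finite K A N" and un: "unital_module K A N"
begin

lemma lmodule_vs: "vectorspace K N"
  using lm by (simp add: left_module_iff)

lemma lmodule_action: "is_action N (act N)"
  using lm by (simp add: left_module_iff)

lemma to_comodule_vs: "vectorspace K (to_comodule N)"
  by (rule vectorspace_record_cong[OF lmodule_vs]) simp_all

lemma to_comodule_eqs:
  "tensor_space K (to_comodule N) C = tensor_space K N C" "ev (to_comodule N) = ev N"
  by (rule tensor_space_cong ev_cong; simp)+

lemma to_comodule_coact: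
  assumes m: "m \<in> carrier N"
  shows "coact (to_comodule N) m \<in> carrier (tensor_space K N C)"
    and "a \<in> carrier A \<Longrightarrow> ev N a (coact (to_comodule N) m) = act N a m"
proof -
  let ?Q = "\<lambda>t. t \<in> carrier (tensor_space K N C) \<and> (\<forall>a\<in>carrier A. ev N a t = act N a m)"
  note gen = generated_submodule[OF lmodule_vs lmodule_action m]
  have "\<exists>t\<in>carrier (tensor_space K N C). \<forall>a\<in>carrier A. ev N a t = act N a m"
    using gen lf m
    by (intro coaction_exists[OF lmodule_vs lmodule_action, of "generated_submodule K A N m"])
      (auto simp: act_submodule_def locally_finite_def)
  then have "\<exists>!t. ?Q t" using ev_eqI[OF lmodule_vs] by metis
  from theI'[OF this] have "?Q (coact (to_comodule N) m)"
    using m by (simp add: to_comodule_def)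
  then show "coact (to_comodule N) m \<in> carrier (tensor_space K N C)"
    "a \<in> carrier A \<Longrightarrow> ev N a (coact (to_comodule N) m) = act N a m" by auto
qed

text \<open>The elements fixed by all large e_F form a subspace, since finitely many requirements on
  F combine. It contains every a m because e_F a = a eventually, and these products span a unital
  module.\<close>

lemma lmodule_unit_large:
  assumes m: "m \<in> carrier N"
  shows "large (\<lambda>F. act N (e_sum F) m = m)"
proof -
  interpret N: vectorspace K N by (rule lmodule_vs)
  let ?W = "{m \<in> carrier N. large (\<lambda>F. act N (e_sum F) m = m)}"
  let ?S = "{act N a m | a m. a \<in> carrier A \<and> m \<in> carrier N}"
  note act = lmodule_action
  note h = bilinD(2)[OF is_actionD(1)[OF act] e_sum_closed]
  have W: "subspace K ?W N"
  proof (rule subspaceI[OF lmodule_vs])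
    show "\<zero>\<^bsub>N\<^esub> \<in> ?W"
      using large_subsets by (auto elim!: eventually_mono intro: module_hom_zero[OF lmodule_vs lmodule_vs h])
    show "u \<oplus>\<^bsub>N\<^esub> v \<in> ?W" if "u \<in> ?W" "v \<in> ?W" for u v
    proof -
      have "large (\<lambda>F. (finite F \<and> F \<subseteq> R) \<and> act N (e_sum F) u = u \<and> act N (e_sum F) v = v)"
        using that large_subsets by (intro eventually_conj) auto
      then have "large (\<lambda>F. act N (e_sum F) (u \<oplus>\<^bsub>N\<^esub> v) = u \<oplus>\<^bsub>N\<^esub> v)"
        by (rule eventually_mono) (use that in \<open>simp add: module_hom_add[OF h]\<close>)
      then show ?thesis using that by auto
    qed
    show "c \<odot>\<^bsub>N\<^esub> v \<in> ?W" if "c \<in> carrier K" "v \<in> ?W" for c v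
    proof -
      have "large (\<lambda>F. (finite F \<and> F \<subseteq> R) \<and> act N (e_sum F) v = v)"
        using that large_subsets by (intro eventually_conj) auto
      then have "large (\<lambda>F. act N (e_sum F) (c \<odot>\<^bsub>N\<^esub> v) = c \<odot>\<^bsub>N\<^esub> v)"
        by (rule eventually_mono) (use that in \<open>simp add: module_hom_smult[OF h]\<close>)
      then show ?thesis using that by auto
    qed
  qed auto
  have "?S \<subseteq> ?W"
  proof
    fix x assume "x \<in> ?S"
    then obtain a m where x: "x = act N a m" and a: "a \<in> carrier A" and m: "m \<in> carrier N" by auto
    have "large (\<lambda>F. (finite F \<and> F \<subseteq> R) \<and> e_sum F \<otimes>\<^bsub>A\<^esub> a = a)"
      using large_subsets e_sum_mult_large[OF a] by (intro eventually_conj) auto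
    then have "large (\<lambda>F. act N (e_sum F) x = x)"
      by (rule eventually_mono) (use a m in \<open>simp add: x is_actionD(2)[OF act, symmetric]\<close>)
    then show "x \<in> ?W" using is_actionD(3)[OF act a m] x by simp
  qed
  from span_least[OF W this] show ?thesis using un m by (auto simp: unital_module_def)
qed

lemma to_comodule_right_comodule: "right_comodule K C (to_comodule N)"
proof (intro right_comodule.intro right_comodule_axioms.intro C_coalgebra to_comodule_vs)
  let ?M = "to_comodule N"
  note M = to_comodule_vs
  note coact = to_comodule_coact[folded to_comodule_eqs]
  show hom: "coact ?M \<in> module_hom K ?M (tensor_space K ?M C)"
  proof (rule coaction_hom[OF M])
    show "bilin K A ?M ?M (act N)"
      using is_actionD(1)[OF is_action_cong[OF lmodule_action lmodule_vs, of "act N" ?M]] by simp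
  qed (use coact in auto)
  fix m assume "m \<in> carrier ?M"
  then have m: "m \<in> carrier N" by simp
  show "tensor_assoc K ?M C C (tensor_map K ?M C (tensor_space K ?M C) C (coact ?M) id (coact ?M m)) =
    tensor_map K ?M C ?M (tensor_space K C C) id (comult C) (coact ?M m)"
    using m is_actionD(2,3)[OF lmodule_action]
    by (subst coassoc_iff[OF M hom]) (auto simp: coact mult_closed)
  \<comment> \<open>A single F both fixes m and turns the counit into evaluation at e_F.\<close>
  obtain F where "F \<subseteq> R" "act N (e_sum F) m = m"
    "tensor_lift K ?M C ?M (\<lambda>x c. counit C c \<odot>\<^bsub>?M\<^esub> x) (coact ?M m) = ev ?M (e_sum F) (coact ?M m)"
    using eventually_conj[OF lmodule_unit_large[OF m] counit_lift_large[OF M coact(1)[OF m]]]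
    by (auto elim: large_obtain)
  then show "tensor_lift K ?M C ?M (\<lambda>x c. counit C c \<odot>\<^bsub>?M\<^esub> x) (coact ?M m) = m"
    using coact(2)[OF m, of "e_sum F"] by simp
qed

lemma to_lmodule_to_comodule:
  assumes "\<And>a m. \<not> (a \<in> carrier A \<and> m \<in> carrier N) \<Longrightarrow> act N a m = undefined"
  shows "to_lmodule (to_comodule N) = N"
proof (rule lmodule.equality)
  show "act (to_lmodule (to_comodule N)) = act N"
    using to_comodule_coact(2) assms by (auto simp: fun_eq_iff to_lmodule_def to_comodule_eqs)
qed simp_all

end

text \<open>On pure tensors ev_a (f \<otimes> id) = f ev_a. So after all evaluations colinearity
  becomes A-linearity, and separation gives the converse. Equality as sets of functions is what lets
  both functors leave morphisms unchanged.\<close>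

lemma comodule_hom_eq:
  assumes M: "right_comodule K C M" and N: "right_comodule K C N"
  shows "comodule_hom K C M N = lmodule_hom K A (to_lmodule M) (to_lmodule N)"
proof -
  note Mv = comodule_vs[OF M] and Nv = comodule_vs[OF N]
  interpret P: vs_pair K M C by (rule pair_C[OF Mv])
  have hom: "module_hom K (to_lmodule M) (to_lmodule N) = module_hom K M N"
    by (simp add: module_hom_def)
  have "(\<forall>m\<in>carrier M. coact N (f m) = tensor_map K M C N C f id (coact M m)) \<longleftrightarrow>
      (\<forall>a\<in>carrier A. \<forall>m\<in>carrier M. f (act (to_lmodule M) a m) = act (to_lmodule N) a (f m))"
    if f: "f \<in> module_hom K M N" for f
  proof -
    note th = P.tensor_map_hom[OF Nv C_vs f id_hom[OF C_vs]]
    have ev: "ev N a (tensor_map K M C N C f id (coact M m)) = f (ev M a (coact M m))"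
      if a: "a \<in> carrier A" and m: "m \<in> carrier M" for a m
      by (rule P.hom_eqI[OF Nv module_hom_comp[OF th ev_hom[OF Nv a]] module_hom_comp[OF ev_hom[OF Mv a] f]
            _ coact_closed[OF M m]])
        (use a in \<open>simp add: P.tensor_map_tensor[OF Nv C_vs f id_hom[OF C_vs]] ev_tensor[OF Nv a]
            ev_tensor[OF Mv a] module_hom_mem[OF f] module_hom_smult[OF f]\<close>)
    have "coact N (f m) = tensor_map K M C N C f id (coact M m) \<longleftrightarrow>
        (\<forall>a\<in>carrier A. f (act (to_lmodule M) a m) = act (to_lmodule N) a (f m))" if m: "m \<in> carrier M" for m
      using ev_eqI[OF Nv coact_closed[OF N module_hom_mem[OF f m]] module_hom_mem[OF th coact_closed[OF M m]]]
        m module_hom_mem[OF f m] by (auto simp: act_to_lmodule ev)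
    then show ?thesis by blast
  qed
  then show ?thesis by (auto simp: comodule_hom_def lmodule_hom_def hom)
qed

section \<open>The two categories and their isomorphism\<close>

lemma LocFin_category_eq:
  "LocFin_category K A = \<lparr>Obj = {N. left_module K A N \<and> normalized K N \<and>
      (\<forall>a m. \<not> (a \<in> carrier A \<and> m \<in> carrier N) \<longrightarrow> act N a m = undefined) \<and>
      locally_finite K A N \<and> unital_module K A N},
    Hom = lmodule_hom K A, Ident = (\<lambda>M. \<lambda>m\<in>carrier M. m),
    Comp = (\<lambda>L M N g f. compose (carrier L) g f)\<rparr>"
  by (auto simp: LocFin_category_def full_subcategory_def lmodule_category_def)

lemma LocFin_category_category: "category (LocFin_category K A)"
  unfolding LocFin_category_eq
proof (rule concrete_category, goal_cases)
  case (1 M N f)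
  then show ?case by (auto simp: lmodule_hom_def module_hom_def)
next
  case (2 M)
  then show ?case
    by (auto simp: left_module_iff dest: is_actionD(3) intro!: lmodule_hom_ident)
next
  case (3 L M N f g)
  then show ?case
    by (auto simp: left_module_iff dest: is_actionD(3) intro!: lmodule_hom_compose[of K L f A M g N])
qed

text \<open>Identities and composites are colinear because they are A-linear, by
  \<open>comodule_hom_eq\<close>; no calculation with tensor products of maps is required.\<close>

lemma comodule_category_category: "category (comodule_category K C)"
  unfolding comodule_category_def
proof (rule concrete_category, goal_cases)
  case (1 M N f)
  then show ?case by (auto simp: comodule_hom_def module_hom_def)
next
  case (2 M)
  then have M: "right_comodule K C M" by simp
  then show ?case
    using lmodule_hom_ident[of K "to_lmodule M" A] left_module.act_closed[OF to_lmodule_left_module[OF M]]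
      to_lmodule_left_module[OF M]
    by (simp add: comodule_hom_eq[OF M M] left_module_iff)
next
  case (3 L M N f g)
  then have L: "right_comodule K C L" and M: "right_comodule K C M" and N: "right_comodule K C N"
    by simp_all
  show ?case
    using 3(4,5) to_lmodule_left_module[OF L]
      lmodule_hom_compose[of K "to_lmodule L" f A "to_lmodule M" g "to_lmodule N"]
      left_module.act_closed[OF to_lmodule_left_module[OF L]]
    by (simp add: comodule_hom_eq[OF L M] comodule_hom_eq[OF M N] comodule_hom_eq[OF L N] left_module_iff)
qed

lemma to_lmodule_Obj:
  "M \<in> Obj (comodule_category K C) \<Longrightarrow> to_lmodule M \<in> Obj (LocFin_category K A)"
  by (auto simp: comodule_category_def LocFin_category_eq to_lmodule_left_module to_lmodule_unital
      to_lmodule_locally_finite act_to_lmodule(2) normalized_def)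

lemma to_comodule_Obj:
  "N \<in> Obj (LocFin_category K A) \<Longrightarrow> to_comodule N \<in> Obj (comodule_category K C)"
  by (auto simp: comodule_category_def LocFin_category_eq to_comodule_right_comodule normalized_def,
      simp add: to_comodule_def)

lemma to_lmodule_inverse:
  "M \<in> Obj (comodule_category K C) \<Longrightarrow> to_comodule (to_lmodule M) = M"
  by (simp add: comodule_category_def to_comodule_to_lmodule)

lemma to_comodule_inverse:
  "N \<in> Obj (LocFin_category K A) \<Longrightarrow> to_lmodule (to_comodule N) = N"
  by (auto simp: LocFin_category_eq intro!: to_lmodule_to_comodule)

lemma Hom_eq:
  "\<lbrakk>M \<in> Obj (comodule_category K C); N \<in> Obj (comodule_category K C)\<rbrakk> \<Longrightarrow>
    Hom (comodule_category K C) M N = Hom (LocFin_category K A) (to_lmodule M) (to_lmodule N)"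
  by (simp add: comodule_category_def LocFin_category_eq comodule_hom_eq)

lemma Ident_Comp_eq:
  "Ident (LocFin_category K A) (to_lmodule M) = Ident (comodule_category K C) M"
  "Comp (LocFin_category K A) (to_lmodule L) (to_lmodule M) (to_lmodule N) = Comp (comodule_category K C) L M N"
  by (simp_all add: comodule_category_def LocFin_category_eq)

lemma comodule_category_isomorphic:
  "isomorphic_categories
    (comodule_category K C :: (('k, 'a \<Rightarrow> 'k, 'v) comodule, 'v \<Rightarrow> 'v) category)
    (LocFin_category K A :: (('k, 'a, 'v) lmodule, 'v \<Rightarrow> 'v) category)"
  unfolding isomorphic_categories_def
proof (intro exI conjI)
  let ?C = "comodule_category K C :: (('k, 'a \<Rightarrow> 'k, 'v) comodule, 'v \<Rightarrow> 'v) category"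
  let ?D = "LocFin_category K A :: (('k, 'a, 'v) lmodule, 'v \<Rightarrow> 'v) category"
  show "category_functor ?C ?D to_lmodule (\<lambda>_ _ f. f)"
    by (intro category_functor.intro category_functor_axioms.intro
        comodule_category_category LocFin_category_category)
      (auto simp: to_lmodule_Obj Hom_eq Ident_Comp_eq)
  \<comment> \<open>The comparison facts speak of \<open>to_lmodule\<close>, so an object X of
    \<open>?D\<close> is first rewritten as \<open>to_lmodule (to_comodule X)\<close>.\<close>
  show "category_functor ?D ?C to_comodule (\<lambda>_ _ f. f)"
  proof (intro category_functor.intro category_functor_axioms.intro
        comodule_category_category LocFin_category_category)
    fix X assume "X \<in> Obj ?D"
    then show "Ident ?D X = Ident ?C (to_comodule X)"
      using Ident_Comp_eq(1)[of "to_comodule X"] by (simp add: to_comodule_inverse)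
  next
    fix X Y Z f g assume "X \<in> Obj ?D" "Y \<in> Obj ?D" "Z \<in> Obj ?D"
    then show "Comp ?D X Y Z g f = Comp ?C (to_comodule X) (to_comodule Y) (to_comodule Z) g f"
      using Ident_Comp_eq(2)[of "to_comodule X" "to_comodule Y" "to_comodule Z"]
      by (simp add: to_comodule_inverse)
  qed (auto simp: to_comodule_Obj Hom_eq to_comodule_inverse)
qed (auto simp: to_lmodule_inverse to_comodule_inverse)

end

theorem proposition2p6:
  fixes K :: "('k, 'n) ring_scheme" and A :: "('k, 'a, 'b) module_scheme"
    and R :: "'r set" and e :: "'r \<Rightarrow> 'a"
  assumes "field K"
    and "assoc_algebra K A"
    and "enough_idempotents K A R e"
  shows "isomorphic_categories
    (comodule_category K (finite_dual K A R e) :: (('k, 'a \<Rightarrow> 'k, 'v) comodule, 'v \<Rightarrow> 'v) category)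
    (LocFin_category K A :: (('k, 'a, 'v) lmodule, 'v \<Rightarrow> 'v) category)"
  by (rule enough_idempotents.comodule_category_isomorphic[OF assms(3)])

end
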